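(* Let $\mathsf{k}$ be a field of characteristic zero and let $h=(h_0,h_1,\dots,h_d)$ be a sequence of positive integers. Then $h$ is the Hilbert function of some (standard graded) Artinian Gorenstein $\mathsf{k}$-algebra with the strong Lefschetz property if and only if $h$ is an SI-sequence.
   Context: An Artinian graded algebra here is $A=S/I$ with $S=\mathsf{k}[x_0,\dots,x_n]$ standard graded and $I$ a homogeneous ideal such that $A$ has Krull dimension zero. Its Hilbert function (or $h$-vector) is $h_A=(h_0,\dots,h_d)$, where $h_i=\dim_{\mathsf{k}}A_i$ and $d$ (the socle degree) is the largest index with $h_d\neq 0$. $A$ is Gorenstein if its socle is one-dimensional over $\mathsf{k}$. $A$ satisfies the strong Lefschetz property (SLP) if there is a linear form $\ell\in A_1$ such that the multiplication map $\times\ell^j:A_i\to A_{i+j}$ has maximal rank (is injective or surjective) for all $i,j\geq 0$. For positive integers $h,i$, write uniquely $h=\binom{m_i}{i}+\binom{m_{i-1}}{i-1}+\cdots+\binom{m_j}{j}$ with $m_i>m_{i-1}>\cdots>m_j\geq j\geq 1$, and set $h^{\langle i\rangle}=\binom{m_i+1}{i+1}+\binom{m_{i-1}+1}{i}+\cdots+\binom{m_j+1}{j+1}$; also $0^{\langle i\rangle}:=0$. A (finite or infinite) sequence of non-negative integers $(h_0,h_1,\dots)$ is an O-sequence if $h_0=1$ and $h_{i+1}\leq h_i^{\langle i\rangle}$ for all $i\geq 1$ (for which the terms occur). A sequence $(h_0,h_1,\dots)$ is differentiable if its first difference $(h_0,h_1-h_0,h_2-h_1,\dots)$ is an O-sequence.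 A sequence $(h_0,\dots,h_d)$ is unimodal if $h_0\leq h_1\leq\cdots\leq h_i\geq h_{i+1}\geq\cdots\geq h_d$ for some $i$, and symmetric if $h_i=h_{d-i}$ for all $i$. It is an SI-sequence (Stanley–Iarrobino sequence) if it is symmetric, unimodal and its first half $(h_0,h_1,\dots,h_{\lfloor d/2\rfloor})$ is differentiable. *)

theory Defs
  imports Complex_Main "HOL-Library.Poly_Mapping" "HOL-Algebra.Embedded_Algebras" "HOL-Algebra.QuotRing"
begin

section \<open>The polynomial ring and its grading\<close>

text \<open>A monomial is a finitely supported exponent vector; polynomials are finitely supported
  coefficient functions on monomials, with the convolution product of \<^theory>\<open>HOL-Library.Poly_Mapping\<close>.\<close>

type_synonym monomial = "nat \<Rightarrow>\<^sub>0 nat"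
type_synonym 'k mpoly = "monomial \<Rightarrow>\<^sub>0 'k"

definition mono_degree :: "monomial \<Rightarrow> nat" where
  "mono_degree m = (\<Sum>v\<in>Poly_Mapping.keys m. Poly_Mapping.lookup m v)"

definition Const :: "'k::zero \<Rightarrow> 'k mpoly" where
  "Const c = Poly_Mapping.single 0 c"

definition Var :: "nat \<Rightarrow> 'k::zero_neq_one mpoly" where
  "Var v = Poly_Mapping.single (Poly_Mapping.single v 1) 1"

text \<open>The ring \<open>k[x\<^sub>0, \<dots>, x\<^sub>n]\<close> (that is, \<open>n + 1\<close> variables).\<close>

definition poly_ring :: "nat \<Rightarrow> 'k::field mpoly ring" where
  "poly_ring n = \<lparr>carrier = {p. \<forall>m\<in>Poly_Mapping.keys p. Poly_Mapping.keys m \<subseteq> {..n}},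
     mult = (*), one = 1, zero = 0, add = (+)\<rparr>"

lemma poly_ring_cring: "cring (poly_ring n :: 'k::field mpoly ring)"
proof -
  let ?C = "carrier (poly_ring n :: 'k mpoly ring)"
  have C: "?C = {p. \<forall>m\<in>Poly_Mapping.keys p. Poly_Mapping.keys m \<subseteq> {..n}}"
    by (simp add: poly_ring_def)
  have add: "p + q \<in> ?C" if "p \<in> ?C" "q \<in> ?C" for p q :: "'k mpoly"
    using that Poly_Mapping.keys_add[of p q] unfolding C by blast
  have minus: "- p \<in> ?C" if "p \<in> ?C" for p :: "'k mpoly"
    using that unfolding C by simp
  have mult: "p * q \<in> ?C" if "p \<in> ?C" "q \<in> ?C" for p q :: "'k mpoly"
  proof -
    have "Poly_Mapping.keys m \<subseteq> {..n}" if m: "m \<in> Poly_Mapping.keys (p * q)" for m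
    proof -
      obtain a b where "m = a + b" "a \<in> Poly_Mapping.keys p" "b \<in> Poly_Mapping.keys q"
        using m Poly_Mapping.keys_mult[of p q] by blast
      then show ?thesis
        using \<open>p \<in> ?C\<close> \<open>q \<in> ?C\<close> Poly_Mapping.keys_add[of a b] unfolding C by blast
    qed
    then show ?thesis unfolding C by blast
  qed
  have zero: "0 \<in> ?C" and one: "1 \<in> ?C"
    unfolding C by simp_all
  have ops: "x \<oplus>\<^bsub>poly_ring n\<^esub> y = x + y" "x \<otimes>\<^bsub>poly_ring n\<^esub> y = x * y"
    "\<zero>\<^bsub>poly_ring n\<^esub> = (0 :: 'k mpoly)" "\<one>\<^bsub>poly_ring n\<^esub> = (1 :: 'k mpoly)" for x y :: "'k mpoly"
    by (simp_all add: poly_ring_def)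
  have "abelian_group (poly_ring n :: 'k mpoly ring)"
  proof (rule abelian_groupI, unfold ops)
    show "\<exists>q\<in>?C. q + p = 0" if "p \<in> ?C" for p
      by (rule bexI[OF _ minus[OF that]]) simp
  qed (use zero in \<open>auto intro: add simp: add.assoc intro: add.commute\<close>)
  moreover have "comm_monoid (poly_ring n :: 'k mpoly ring)"
    by (rule comm_monoidI, unfold ops)
      (use one in \<open>auto intro: mult simp: mult.assoc intro: mult.commute\<close>)
  ultimately show ?thesis
    by (rule cringI) (simp add: ops distrib_right)
qed

definition homog_part :: "nat \<Rightarrow> nat \<Rightarrow> 'k::field mpoly set" where
  "homog_part n i =
     {p \<in> carrier (poly_ring n). \<forall>m\<in>Poly_Mapping.keys p. mono_degree m = i}"

definition homogeneous_ideal :: "nat \<Rightarrow> 'k::field mpoly set \<Rightarrow> bool" where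
  "homogeneous_ideal n I \<longleftrightarrow> ideal I (poly_ring n) \<and>
     (\<exists>B \<subseteq> (\<Union>i. homog_part n i). I = Idl\<^bsub>poly_ring n\<^esub> B)"


section \<open>The graded algebra \<open>A = S/I\<close>\<close>

abbreviation quot_alg :: "nat \<Rightarrow> 'k::field mpoly set \<Rightarrow> 'k mpoly set ring" where
  "quot_alg n I \<equiv> poly_ring n Quot I"

abbreviation quot_map :: "nat \<Rightarrow> 'k::field mpoly set \<Rightarrow> 'k mpoly \<Rightarrow> 'k mpoly set" where
  "quot_map n I p \<equiv> I +>\<^bsub>poly_ring n\<^esub> p"

definition graded_part :: "nat \<Rightarrow> 'k::field mpoly set \<Rightarrow> nat \<Rightarrow> 'k mpoly set set" where
  "graded_part n I i = quot_map n I ` homog_part n i"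

text \<open>The copy of the ground field in \<open>A\<close>, over which dimensions are taken.\<close>

definition scalars :: "nat \<Rightarrow> 'k::field mpoly set \<Rightarrow> 'k mpoly set set" where
  "scalars n I = (quot_map n I \<circ> Const) ` UNIV"

definition hilbert_function :: "nat \<Rightarrow> 'k::field mpoly set \<Rightarrow> nat \<Rightarrow> nat" where
  "hilbert_function n I i = ring.dim (quot_alg n I) (scalars n I) (graded_part n I i)"

definition has_h_vector :: "nat \<Rightarrow> 'k::field mpoly set \<Rightarrow> nat \<Rightarrow> (nat \<Rightarrow> nat) \<Rightarrow> bool" where
  "has_h_vector n I d h \<longleftrightarrow> (\<forall>i\<le>d. hilbert_function n I i = h i) \<and>
     hilbert_function n I d \<noteq> 0 \<and> (\<forall>i>d. hilbert_function n I i = 0)"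

text \<open>The Krull dimension is the largest length of a strict chain \<open>P\<^sub>0 \<subset> \<dots> \<subset> P\<^sub>m\<close> of
  prime ideals; the zero ring has no such chain and hence no Krull dimension in \<open>\<nat>\<close>.\<close>

definition prime_chain :: "('a, 'b) ring_scheme \<Rightarrow> nat \<Rightarrow> (nat \<Rightarrow> 'a set) \<Rightarrow> bool" where
  "prime_chain R m P \<longleftrightarrow> (\<forall>i\<le>m. primeideal (P i) R) \<and> (\<forall>i<m. P i \<subset> P (Suc i))"

definition has_krull_dim :: "('a, 'b) ring_scheme \<Rightarrow> nat \<Rightarrow> bool" where
  "has_krull_dim R m \<longleftrightarrow> (\<exists>P. prime_chain R m P) \<and> (\<forall>l P. prime_chain R l P \<longrightarrow> l \<le> m)"

definition artinian_graded :: "nat \<Rightarrow> 'k::field mpoly set \<Rightarrow> bool" where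
  "artinian_graded n I \<longleftrightarrow> homogeneous_ideal n I \<and> has_krull_dim (quot_alg n I) 0"

definition irrelevant_ideal :: "nat \<Rightarrow> 'k::field mpoly set \<Rightarrow> 'k mpoly set set" where
  "irrelevant_ideal n I = Idl\<^bsub>quot_alg n I\<^esub> ((quot_map n I \<circ> Var) ` {..n})"

definition socle :: "nat \<Rightarrow> 'k::field mpoly set \<Rightarrow> 'k mpoly set set" where
  "socle n I = {a \<in> carrier (quot_alg n I).
     \<forall>b\<in>irrelevant_ideal n I. a \<otimes>\<^bsub>quot_alg n I\<^esub> b = \<zero>\<^bsub>quot_alg n I\<^esub>}"

definition gorenstein :: "nat \<Rightarrow> 'k::field mpoly set \<Rightarrow> bool" where
  "gorenstein n I \<longleftrightarrow> ring.dimension (quot_alg n I) 1 (scalars n I) (socle n I)"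

definition strong_lefschetz :: "nat \<Rightarrow> 'k::field mpoly set \<Rightarrow> bool" where
  "strong_lefschetz n I \<longleftrightarrow> (\<exists>l\<in>graded_part n I 1. \<forall>i j.
     let \<mu> = (\<lambda>a. (l [^]\<^bsub>quot_alg n I\<^esub> j) \<otimes>\<^bsub>quot_alg n I\<^esub> a) in
       inj_on \<mu> (graded_part n I i) \<or> \<mu> ` graded_part n I i = graded_part n I (i + j))"


section \<open>Numerical sequences\<close>

text \<open>A sequence \<open>(h\<^sub>0, \<dots>, h\<^sub>d)\<close> is given by \<open>d\<close> and a function of which only the values at
  indices \<open>\<le> d\<close> are ever used.\<close>

definition macaulay_rep :: "nat \<Rightarrow> nat \<Rightarrow> nat \<Rightarrow> (nat \<Rightarrow> nat) \<Rightarrow> bool" where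
  "macaulay_rep a i j m \<longleftrightarrow> 1 \<le> j \<and> j \<le> i \<and> j \<le> m j \<and> (\<forall>k\<in>{j..<i}. m k < m (Suc k)) \<and>
     a = (\<Sum>k=j..i. m k choose k)"

text \<open>\<open>macaulay_growth a i\<close> is \<open>a\<close> to the power \<open>\<langle>i\<rangle>\<close>; the representation
  (hence the value) is unique for \<open>a, i \<ge> 1\<close>.\<close>

definition macaulay_growth :: "nat \<Rightarrow> nat \<Rightarrow> nat" where
  "macaulay_growth a i = (if a = 0 then 0 else
     (THE b. \<exists>j m. macaulay_rep a i j m \<and> b = (\<Sum>k=j..i. Suc (m k) choose Suc k)))"

text \<open>Integer-valued, since first differences may be negative.\<close>

definition O_sequence :: "nat \<Rightarrow> (nat \<Rightarrow> int) \<Rightarrow> bool" where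
  "O_sequence d g \<longleftrightarrow> (\<forall>i\<le>d. 0 \<le> g i) \<and> g 0 = 1 \<and>
     (\<forall>i. 1 \<le> i \<and> i < d \<longrightarrow> g (Suc i) \<le> int (macaulay_growth (nat (g i)) i))"

definition first_difference :: "(nat \<Rightarrow> nat) \<Rightarrow> nat \<Rightarrow> int" where
  "first_difference h i = (if i = 0 then int (h 0) else int (h i) - int (h (i - 1)))"

definition differentiable_seq :: "nat \<Rightarrow> (nat \<Rightarrow> nat) \<Rightarrow> bool" where
  "differentiable_seq d h \<longleftrightarrow> O_sequence d (first_difference h)"

definition unimodal_seq :: "nat \<Rightarrow> (nat \<Rightarrow> nat) \<Rightarrow> bool" where
  "unimodal_seq d h \<longleftrightarrow> (\<exists>i\<le>d. (\<forall>j<i. h j \<le> h (Suc j)) \<and>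
     (\<forall>j. i \<le> j \<and> j < d \<longrightarrow> h (Suc j) \<le> h j))"

definition symmetric_seq :: "nat \<Rightarrow> (nat \<Rightarrow> nat) \<Rightarrow> bool" where
  "symmetric_seq d h \<longleftrightarrow> (\<forall>i\<le>d. h i = h (d - i))"

definition SI_sequence :: "nat \<Rightarrow> (nat \<Rightarrow> nat) \<Rightarrow> bool" where
  "SI_sequence d h \<longleftrightarrow> symmetric_seq d h \<and> unimodal_seq d h \<and> differentiable_seq (d div 2) h"

end

theory Submission
  imports Defs "HOL-Library.Multiset"
begin

text \<open>Necessity: in a Gorenstein algebra \<open>A\<close> of socle degree \<open>d\<close> the products \<open>A\<^sub>i \<times> A\<^bsub>d-i\<^esub> \<rightarrow> A\<^sub>d\<close>
  are perfect pairings, so \<open>h\<close> is symmetric. Multiplication by a Lefschetz element \<open>l\<close>, once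
  surjective, stays surjective, so \<open>h\<close> is unimodal; by duality it is injective up to the middle
  degree, where the first difference of \<open>h\<close> is therefore the Hilbert function of \<open>A/lA\<close>. The
  standard monomials of \<open>A/lA\<close> form an order ideal, to which Macaulay's theorem applies; that
  theorem is proved by compressing sets of monomials towards one variable and induction.

  Sufficiency: the first half of the first difference of \<open>h\<close> is the Hilbert function of an order
  ideal \<open>M\<close> of monomials (initial colexicographic segments). Read exponent vectors of \<open>M\<close> as points
  \<open>p\<close> of affine space and let \<open>A\<close> be dual to the functional \<open>f \<mapsto> \<Sum>p\<in>M. f(p)\<close> on forms of degree \<open>d\<close>.
  By Newton interpolation polynomials of degree \<open>\<le> i\<close> have as many independent restrictions to \<open>M\<close>
  as \<open>M\<close> has elements of degree \<open>\<le> i\<close>, which gives the Hilbert function. With \<open>l = x\<^sub>0\<close> the form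
  \<open>(f, g) \<mapsto> l\<^bsup>d-2i\<^esup> f g\<close> on \<open>A\<^sub>i\<close> becomes \<open>\<Sum>p\<in>M. f(p) g(p)\<close>, which is positive definite over \<open>\<rat>\<close>
  and hence nondegenerate over every field of characteristic zero.\<close>

section \<open>Ranks of weakly decreasing lists and Macaulay's growth function\<close>

text \<open>Macaulay's theorem is driven by Green's number \<open>a_<d>\<close>, the rank of the
  list of rank \<open>a\<close> with all entries lowered by one. Green bounds by it the section of
  an algebra by a general linear form, and no general position is available for sets of monomials.
  Compression supplies a substitute: once a set is stable, cancelling \<open>z\<close> already
  yields the whole shadow, and the members avoiding \<open>z\<close> play the part of the section.
  Two consequences of Pascal's rule then close a double induction: \<open>a \<le> c^<d>\<close>
  implies \<open>a - c \<le> a_<d+1>\<close>, which bounds the section, and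
  \<open>a^<d> = a + (a_<d>)^<d>\<close>, which puts shadow and section together again.

  In the construction everything hinges on one fact: up to the middle degree the ideal dual to the
  functional consists of the forms vanishing on \<open>M\<close>. One inclusion is immediate, the
  other is the definiteness of the pairing. Since \<open>x_0\<close> is \<open>1\<close> at all the
  points, its powers do not change values, so the same fact yields both the Hilbert function and the
  Lefschetz property. Degrees above the middle are reached by duality.\<close>

text \<open>A weakly decreasing list \<open>e\<^sub>d \<ge> \<dots> \<ge> e\<^sub>1\<close> stands for the monomial \<open>x\<^bsub>e\<^sub>d\<^esub> \<cdots> x\<^bsub>e\<^sub>1\<^esub>\<close>. With
  \<open>m\<^sub>k = e\<^sub>k + k - 1\<close> its rank in the colexicographic order is \<open>\<Sum>k. m\<^sub>k choose k\<close>, a Macaulay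
  representation in which the trailing zero terms have been kept; raising this number to the
  power \<open>\<langle>d\<rangle>\<close> amounts to multiplying the monomial by \<open>x\<^sub>0\<close>, that is, to appending \<open>0\<close>.\<close>

fun colex_rank :: "nat list \<Rightarrow> nat" where
  "colex_rank [] = 0"
| "colex_rank (x # xs) = colex_rank xs + (x + length xs choose Suc (length xs))"

abbreviation desc :: "nat list \<Rightarrow> bool" where
  "desc xs \<equiv> sorted_wrt (\<ge>) xs"

text \<open>The bound is the number of monomials of degree \<open>length e\<close> in the variables
  \<open>0, ..., x\<close>. Pascal's rule turns the bound for the tail plus the term of the head
  into the bound for the whole list.\<close>

lemma colex_rank_less:
  assumes "desc e" "\<forall>y\<in>set e. y \<le> x"
  shows "colex_rank e < (x + length e choose length e)"
  using assms
proof (induction e arbitrary: x)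
  case (Cons y ys)
  have "colex_rank ys < (y + length ys choose length ys)"
    using Cons by auto
  then have "colex_rank (y # ys) < (Suc (y + length ys) choose Suc (length ys))"
    by simp
  also have "\<dots> \<le> (x + length (y # ys) choose Suc (length ys))"
    using Cons.prems by (intro binomial_right_mono) auto
  finally show ?case by simp
qed simp

lemma colex_rank_less_hd:
  assumes "x < y" "desc (x # xs)" "length xs = length ys"
  shows "colex_rank (x # xs) < colex_rank (y # ys)"
proof -
  have "colex_rank xs < (x + length xs choose length xs)"
    using assms by (intro colex_rank_less) auto
  then have "colex_rank (x # xs) < (Suc (x + length xs) choose Suc (length xs))" by simp
  also have "\<dots> \<le> (y + length ys choose Suc (length ys))"
    unfolding assms(3) by (rule binomial_right_mono) (use assms in auto)
  finally show ?thesis by simp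
qed

text \<open>On weakly decreasing lists of equal length the rank order is lexicographic, so the first
  difference decides and no appended entry can reverse it.\<close>

lemma colex_rank_less_colex_rank_append:
  assumes "desc e" "desc f" "length e = length f" "colex_rank e < colex_rank f"
    "desc (e @ [a])" "desc (f @ [b])"
  shows "colex_rank (e @ [a]) < colex_rank (f @ [b])"
  using assms(3,1,2,4-)
proof (induction e f rule: list_induct2)
  case (Cons x xs y ys)
  consider "x < y" | "x = y" | "y < x" by linarith
  then show ?case
  proof cases
    case 1
    then show ?thesis using colex_rank_less_hd[of x y "xs @ [a]" "ys @ [b]"] Cons by simp
  next
    case 2
    then show ?thesis using Cons by auto
  next
    case 3
    then show ?thesis using colex_rank_less_hd[of y x ys xs] Cons by simp
  qed
qed simp

lemma colex_rank_inj:
  assumes "length e = length f" "desc e" "desc f" "colex_rank e = colex_rank f"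
  shows "e = f"
  using assms
proof (induction e f rule: list_induct2)
  case (Cons x xs y ys)
  have "x = y"
    using colex_rank_less_hd[of x y xs ys] colex_rank_less_hd[of y x ys xs] Cons by (metis less_irrefl linorder_neqE_nat)
  then show ?case using Cons by auto
qed simp

text \<open>The greedy algorithm for Macaulay representations. The head is the largest
  \<open>x\<close> whose term still fits; maximality and Pascal's rule leave a remainder below
  \<open>x + d choose d\<close>, which forces the later entries to be at most \<open>x\<close>. In
  degree zero only the rank \<open>0\<close> occurs, hence the assumption.\<close>

lemma colex_rank_ex:
  assumes "d = 0 \<Longrightarrow> a = 0"
  shows "\<exists>e. desc e \<and> length e = d \<and> colex_rank e = a"
  using assms
proof (induction d arbitrary: a)
  case 0
  then show ?case by (intro exI[of _ "[]"]) simp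
next
  case (Suc d)
  define P where "P = (\<lambda>x. (x + d choose Suc d) \<le> a)"
  have bd: "x \<le> a" if "P x" for x
  proof (rule ccontr)
    assume "\<not> x \<le> a"
    then obtain y where y: "x = Suc y" "a \<le> y" by (metis not_less_eq_eq old.nat.exhaust le0)
    have "y + 1 \<le> (y + d + 1 choose Suc d)"
    proof (induction d)
      case (Suc d)
      then show ?case by simp
    qed simp
    then show False using that y unfolding P_def by simp
  qed
  have "P 0" unfolding P_def by (simp add: binomial_eq_0)
  define x where "x = Greatest P"
  have Px: "P x" unfolding x_def using \<open>P 0\<close> bd by (rule GreatestI_nat)
  have nP: "\<not> P (Suc x)"
    unfolding x_def using Greatest_le_nat[of P "Suc x" a] bd unfolding x_def by fastforce
  define r where "r = a - (x + d choose Suc d)"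
  have r: "r < (x + d choose d)"
    using nP Px unfolding P_def r_def by simp
  have "d = 0 \<Longrightarrow> r = 0" using r by simp
  from Suc.IH[OF this] obtain e where e: "desc e" "length e = d" "colex_rank e = r" by blast
  have "\<forall>y\<in>set e. y \<le> x"
  proof (cases e)
    case (Cons y ys)
    have "(y + length ys choose Suc (length ys)) < (x + d choose d)"
      using e r Cons by simp
    moreover have "d = Suc (length ys)" using e(2) Cons by simp
    ultimately have "\<not> x + d \<le> y + length ys"
      using binomial_right_mono[of "x + d" "y + length ys" d] by (auto simp del: binomial_Suc_Suc)
    then have "y \<le> x" using \<open>d = Suc (length ys)\<close> by simp
    then show ?thesis using e(1) Cons by auto
  qed simp
  then have "desc (x # e)" using e by auto
  moreover have "colex_rank (x # e) = a" using e Px unfolding P_def r_def by simp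
  ultimately show ?case using e by (intro exI[of _ "x # e"]) simp
qed

lemma desc_append_0: "desc (e @ [0]) \<longleftrightarrow> desc e"
  by (simp add: sorted_wrt_append)

lemma colex_rank_append: "colex_rank (e @ [a]) = colex_rank (e @ [0]) + a"
  by (induction e) auto

lemma colex_rank_append_mono:
  assumes "desc e" "desc f" "length e = length f" "colex_rank e \<le> colex_rank f"
  shows "colex_rank (e @ [0]) \<le> colex_rank (f @ [0])"
  using colex_rank_less_colex_rank_append[of e f 0 0] colex_rank_inj[of e f] assms
  by (cases "colex_rank e = colex_rank f") (auto simp: desc_append_0)

text \<open>Appending \<open>0\<close> gives the least extension of \<open>f\<close>, so nothing at
  or below it can extend a list beyond \<open>f\<close>. This is the reason why initial segments
  attain Macaulay's bound.\<close>

lemma colex_rank_butlast: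
  assumes "desc (e @ [a])" "desc f" "length e = length f" "colex_rank (e @ [a]) \<le> colex_rank (f @ [0])"
  shows "colex_rank e < colex_rank f \<or> e = f \<and> a = 0"
proof -
  have de: "desc e" using assms(1) by (simp add: sorted_wrt_append)
  have "\<not> colex_rank f < colex_rank e"
    using colex_rank_less_colex_rank_append[of f e 0 a] assms de by (auto simp: desc_append_0)
  moreover have "colex_rank f = colex_rank e \<Longrightarrow> e = f \<and> a = 0"
    using colex_rank_inj[of e f] assms de colex_rank_append[of f a] by auto
  ultimately show ?thesis by linarith
qed

section \<open>Green's numbers and Pascal's rule\<close>

text \<open>With \<open>m_k = e_k + k - 1\<close> this turns each \<open>m_k choose k\<close> into
  \<open>m_k - 1 choose k\<close>, so the rank becomes Green's number \<open>a_<d>\<close>. The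
  truncated subtraction does no harm, since an entry \<open>0\<close> contributes nothing before or
  after.\<close>

definition decrement :: "nat list \<Rightarrow> nat list" where "decrement = map (\<lambda>x. x - 1)"

lemma desc_decrement: "desc e \<Longrightarrow> desc (decrement e)"
  unfolding decrement_def by (induction e) (auto intro: diff_le_mono)

lemma length_decrement [simp]: "length (decrement e) = length e"
  by (simp add: decrement_def)

text \<open>Pascal's rule in every term: \<open>m_k + 1 choose k + 1\<close> is
  \<open>m_k choose k\<close> plus \<open>m_k choose k + 1\<close>, and the latter is the growth
  term of the lowered entry.\<close>

lemma colex_rank_append_0: "colex_rank (e @ [0]) = colex_rank e + colex_rank (decrement e @ [0])"
proof (induction e)
  case (Cons x xs)
  then show ?case by (cases x) (auto simp: decrement_def binomial_eq_0)
qed (simp add: decrement_def)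

text \<open>Pascal's rule now splits \<open>m_k choose k\<close> into
  \<open>m_k - 1 choose k\<close> and \<open>m_k - 1 choose k - 1\<close>. The second terms make up
  the rank of the list without its last entry; at the last entry itself, where \<open>k = 1\<close>,
  such a term is \<open>1\<close> unless the entry is \<open>0\<close>.\<close>

lemma colex_rank_append_le_decrement:
  "colex_rank (e @ [a]) \<le> colex_rank (decrement (e @ [a])) + colex_rank e + (if a = 0 then 0 else 1)"
proof (induction e)
  case (Cons x xs)
  then show ?case by (cases x) (auto simp: decrement_def binomial_eq_0)
qed (simp add: decrement_def)

text \<open>The extra \<open>1\<close> of the preceding estimate arises only for a positive last
  entry, and then the shortened list lies strictly below \<open>f\<close>, which pays for
  it.\<close>

lemma colex_rank_le_decrement:
  assumes "desc e" "desc f" "length e = Suc (length f)" "colex_rank e \<le> colex_rank (f @ [0])"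
  shows "colex_rank e \<le> colex_rank f + colex_rank (decrement e)"
proof -
  obtain e' a where e: "e = e' @ [a]" using assms(3) by (cases e rule: rev_cases) auto
  have "colex_rank e' < colex_rank f \<or> e' = f \<and> a = 0" using colex_rank_butlast[of e' a f] assms e by auto
  then show ?thesis using colex_rank_append_le_decrement[of e' a] e by (auto split: if_splits)
qed

section \<open>Macaulay's growth function in terms of ranks\<close>

definition rank_list :: "nat \<Rightarrow> nat \<Rightarrow> nat list" where
  "rank_list d a = (SOME e. desc e \<and> length e = d \<and> colex_rank e = a)"

lemma rank_list: 
  assumes "0 < d" shows "desc (rank_list d a)" "length (rank_list d a) = d" "colex_rank (rank_list d a) = a"
proof -
  have "\<exists>e. desc e \<and> length e = d \<and> colex_rank e = a" using assms by (intro colex_rank_ex) auto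
  from someI_ex[OF this] show "desc (rank_list d a)" "length (rank_list d a) = d" "colex_rank (rank_list d a) = a"
    unfolding rank_list_def by auto
qed

definition mgrowth :: "nat \<Rightarrow> nat \<Rightarrow> nat" where
  "mgrowth d a = colex_rank (rank_list d a @ [0])"

lemma mgrowth_mono: "0 < d \<Longrightarrow> a \<le> b \<Longrightarrow> mgrowth d a \<le> mgrowth d b"
  unfolding mgrowth_def by (intro colex_rank_append_mono) (auto simp: rank_list)

lemma mgrowth_colex_rank: "desc e \<Longrightarrow> e \<noteq> [] \<Longrightarrow> mgrowth (length e) (colex_rank e) = colex_rank (e @ [0])"
  unfolding mgrowth_def using colex_rank_inj[of "rank_list (length e) (colex_rank e)" e] rank_list[of "length e" "colex_rank e"] by auto

text \<open>The recursion behind the induction on the number of variables in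
  \<open>macaulay_shadow\<close>: the summand \<open>a\<close> accounts for the monomials divisible
  by \<open>z\<close>, the other one for those avoiding it.\<close>

lemma mgrowth_split: "0 < d \<Longrightarrow> mgrowth d a = a + mgrowth d (colex_rank (decrement (rank_list d a)))"
proof -
  assume d: "0 < d"
  have "mgrowth d (colex_rank (decrement (rank_list d a))) = colex_rank (decrement (rank_list d a) @ [0])"
    using mgrowth_colex_rank[OF desc_decrement[OF rank_list(1)[OF d]], of a] rank_list[OF d] d
    by (metis length_decrement length_greater_0_conv)
  then show ?thesis
    using colex_rank_append_0[of "rank_list d a"] rank_list[OF d] by (simp add: mgrowth_def[of d a])
qed

text \<open>The numerical form of Green's bound: when \<open>a\<close> and \<open>c\<close> are the
  sizes of a stable set and of its shadow, \<open>a - c\<close> counts the members avoiding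
  \<open>z\<close>.\<close>

lemma mgrowth_step: 
  assumes "0 < d" "a \<le> mgrowth d c"
  shows "a \<le> c + colex_rank (decrement (rank_list (Suc d) a))"
  using colex_rank_le_decrement[of "rank_list (Suc d) a" "rank_list d c"] rank_list[of d c] rank_list[of "Suc d" a] assms
  unfolding mgrowth_def by auto

lemma mgrowth_step_1: "a \<le> Suc (colex_rank (decrement (rank_list (Suc 0) a)))"
  using colex_rank_append_le_decrement[of "[]" "hd (rank_list (Suc 0) a)"] rank_list[of "Suc 0" a]
  by (cases "rank_list (Suc 0) a") (auto split: if_splits)

lemma mgrowth_0: assumes "0 < d" shows "mgrowth d 0 = 0"
proof -
  have r: "colex_rank (replicate n 0) = 0" for n by (induction n) (auto simp: binomial_eq_0)
  have "colex_rank (replicate d 0 @ [0]) = 0" using r[of "Suc d"] by (simp add: replicate_append_same)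
  moreover have "desc (replicate d 0)" by (induction d) auto
  ultimately show ?thesis using mgrowth_colex_rank[of "replicate d 0"] r[of d] assms by simp
qed

section \<open>Comparison with Macaulay representations\<close>

lemma colex_rank_map_rev_upt:
  "colex_rank (map E (rev [1..<Suc d])) = (\<Sum>k=1..d. E k + k - 1 choose k)"
proof (induction d)
  case (Suc d)
  have "{1..Suc d} = insert (Suc d) {1..d}" by auto
  then show ?case using Suc by (simp add: upt_Suc_append del: upt_Suc)
qed simp

lemma colex_rank_map_rev_upt_append_0:
  "colex_rank (map E (rev [1..<Suc d]) @ [0]) = (\<Sum>k=1..d. E k + k choose Suc k)"
proof (induction d)
  case (Suc d)
  have "{1..Suc d} = insert (Suc d) {1..d}" by auto
  then show ?case using Suc by (simp add: upt_Suc_append del: upt_Suc)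
qed simp

lemma macaulay_rep_growth:
  assumes "macaulay_rep a d j m"
  shows "(\<Sum>k=j..d. Suc (m k) choose Suc k) = mgrowth d a"
proof -
  \<comment> \<open>Passes from \<open>m_k\<close> to \<open>e_k = m_k - k + 1\<close> and restores
    the omitted indices below \<open>j\<close> by entries \<open>0\<close>; their terms
    \<open>k - 1 choose k\<close> and \<open>k choose k + 1\<close> vanish.\<close>
  define E where "E = (\<lambda>k. if k < j then 0 else m k + 1 - k)"
  have j: "1 \<le> j" "j \<le> d" "j \<le> m j" and step: "\<And>k. k \<in> {j..<d} \<Longrightarrow> m k < m (Suc k)"
    and a: "a = (\<Sum>k=j..d. m k choose k)"
    using assms unfolding macaulay_rep_def by auto
  have ge: "k \<le> m k" if "j \<le> k" "k \<le> d" for k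
    using that
  proof (induction k rule: dec_induct)
    case (step k)
    then show ?case using \<open>\<And>k. k \<in> {j..<d} \<Longrightarrow> m k < m (Suc k)\<close>[of k] by auto
  qed (use j in auto)
  have E_mono: "E k \<le> E (Suc k)" if "k < d" for k
    using step[of k] that ge[of k] unfolding E_def by auto
  have mono: "E k \<le> E l" if "k \<le> l" "l \<le> d" for k l
    using that by (induction l rule: dec_induct) (auto intro: order_trans[OF _ E_mono])
  let ?e = "map E (rev [1..<Suc d])"
  have "desc ?e"
    unfolding sorted_wrt_map sorted_wrt_rev
    by (rule sorted_wrt_mono_rel[OF _ strict_sorted_list_of_set[of "{1..<Suc d}", unfolded sorted_list_of_set_range]])
      (auto intro: mono)
  have split: "(\<Sum>k=1..d. f k) = (\<Sum>k=j..d. f k)" if "\<And>k. 1 \<le> k \<Longrightarrow> k < j \<Longrightarrow> f k = 0" for f :: "nat \<Rightarrow> nat"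
    by (rule sum.mono_neutral_right) (use j that in auto)
  have "colex_rank ?e = (\<Sum>k=j..d. E k + k - 1 choose k)"
    unfolding colex_rank_map_rev_upt by (rule split) (auto simp: E_def binomial_eq_0)
  also have "\<dots> = a"
    unfolding a using ge by (intro sum.cong) (auto simp: E_def Suc_diff_le)
  finally have 1: "colex_rank ?e = a" .
  have "colex_rank (?e @ [0]) = (\<Sum>k=j..d. E k + k choose Suc k)"
    unfolding colex_rank_map_rev_upt_append_0 by (rule split) (auto simp: E_def binomial_eq_0)
  also have "\<dots> = (\<Sum>k=j..d. Suc (m k) choose Suc k)"
    by (rule sum.cong) (use ge in \<open>auto simp: E_def Suc_diff_le simp del: binomial_Suc_Suc\<close>)
  finally have 2: "colex_rank (?e @ [0]) = (\<Sum>k=j..d. Suc (m k) choose Suc k)" .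
  show ?thesis using mgrowth_colex_rank[OF \<open>desc ?e\<close>] 1 2 j by auto
qed

lemma macaulay_rep_ex:
  assumes "0 < d" "0 < a"
  shows "\<exists>j m. macaulay_rep a d j m"
proof -
  define e where "e = rank_list d a"
  have e: "desc e" "length e = d" "colex_rank e = a" using rank_list[OF assms(1)] unfolding e_def by auto
  define E where "E = (\<lambda>k. e ! (d - k))"
  have eE: "e = map E (rev [1..<Suc d])"
    by (rule nth_equalityI) (auto simp: e E_def rev_nth simp del: upt_Suc)
  have mono: "E k \<le> E l" if "1 \<le> k" "k \<le> l" "l \<le> d" for k l
  proof (cases "k = l")
    case False
    then show ?thesis using sorted_wrt_nth_less[OF e(1), of "d - l" "d - k"] that e(2) unfolding E_def by auto
  qed simp
  have a: "a = (\<Sum>k=1..d. E k + k - 1 choose k)" using colex_rank_map_rev_upt[of E d] e eE by simp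
  have "\<exists>k. 1 \<le> k \<and> k \<le> d \<and> 0 < E k"
  proof (rule ccontr)
    assume "\<not> ?thesis"
    then have "a = 0" unfolding a by (auto simp: binomial_eq_0)
    then show False using assms by simp
  qed
  then have ex: "\<exists>k. 1 \<le> k \<and> k \<le> d \<and> 0 < E k" .
  \<comment> \<open>The representation has to end at the last nonzero term, that is, at the least
    index with a positive entry.\<close>
  define j where "j = (LEAST k. 1 \<le> k \<and> k \<le> d \<and> 0 < E k)"
  have j: "1 \<le> j" "j \<le> d" "0 < E j" using LeastI_ex[OF ex] unfolding j_def by auto
  have lt: "E k = 0" if "1 \<le> k" "k < j" for k
    using not_less_Least[of k "\<lambda>k. 1 \<le> k \<and> k \<le> d \<and> 0 < E k"] that j unfolding j_def by auto
  have "a = (\<Sum>k=j..d. E k + k - 1 choose k)"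
    unfolding a by (rule sum.mono_neutral_right) (use j lt in \<open>auto simp: binomial_eq_0\<close>)
  moreover have "E k + k - 1 < E (Suc k) + Suc k - 1" if "k \<in> {j..<d}" for k
    using mono[of k "Suc k"] that j by auto
  ultimately have "macaulay_rep a d j (\<lambda>k. E k + k - 1)"
    unfolding macaulay_rep_def using j by auto
  then show ?thesis by blast
qed

text \<open>Whatever the representation of \<open>a\<close>, it yields \<open>mgrowth d a\<close>,
  so the definite description denotes this value as soon as one representation exists.\<close>

lemma macaulay_growth_eq_mgrowth:
  assumes "0 < d" shows "macaulay_growth a d = mgrowth d a"
proof (cases "a = 0")
  case False
  then obtain j m where jm: "macaulay_rep a d j m" using macaulay_rep_ex assms by blast
  have "(THE b. \<exists>j m. macaulay_rep a d j m \<and> b = (\<Sum>k=j..d. Suc (m k) choose Suc k)) = mgrowth d a"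
    (is "(THE b. ?P b) = _")
  proof (rule the_equality)
    show "?P (mgrowth d a)"
      by (rule exI[of _ j], rule exI[of _ m], rule conjI[OF jm macaulay_rep_growth[OF jm, symmetric]])
  qed (elim exE conjE, simp only: macaulay_rep_growth)
  then show ?thesis using False unfolding macaulay_growth_def by simp
qed (simp add: macaulay_growth_def mgrowth_0[OF assms])


section \<open>Compression and Macaulay's theorem for sets of monomials\<close>

definition shadow :: "'a multiset set \<Rightarrow> 'a multiset set" where
  "shadow T = {m. \<exists>x. add_mset x m \<in> T}"

lemma shadow_altdef: "shadow T = (\<Union>f\<in>T. (\<lambda>x. f - {#x#}) ` set_mset f)"
  unfolding shadow_def by (force dest: multi_member_split)

lemma finite_shadow: "finite T \<Longrightarrow> finite (shadow T)"
  unfolding shadow_altdef by auto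

text \<open>The monomials of a fixed degree with a given core form a chain indexed by the exponent of \<open>j\<close>.
  Compression replaces the members of \<open>T\<close> in each chain by as many members with the least
  exponents of \<open>j\<close>.\<close>

definition core :: "'a \<Rightarrow> 'a \<Rightarrow> 'a multiset \<Rightarrow> 'a multiset" where
  "core z j f = {#x \<in># f. x \<noteq> z \<and> x \<noteq> j#}"

definition fibre :: "'a \<Rightarrow> 'a \<Rightarrow> 'a multiset set \<Rightarrow> 'a multiset \<Rightarrow> 'a multiset set" where
  "fibre z j T \<kappa> = {f \<in> T. core z j f = \<kappa>}"

definition compress :: "'a \<Rightarrow> 'a \<Rightarrow> nat \<Rightarrow> 'a multiset set \<Rightarrow> 'a multiset set" where
  "compress z j d T = {f. size f = d \<and> count f j < card (fibre z j T (core z j f))}"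

lemma size_core: "z \<noteq> j \<Longrightarrow> size f = size (core z j f) + count f z + count f j"
  unfolding core_def by (induction f) auto

lemma core_eqI:
  assumes "z \<noteq> j" "core z j f = core z j g" "size f = size g" "count f j = count g j"
  shows "f = g"
proof (rule multiset_eqI)
  fix x
  show "count f x = count g x"
  proof (cases "x = z \<or> x = j")
    case True
    then show ?thesis using size_core[OF assms(1), of f] size_core[OF assms(1), of g] assms by auto
  next
    case False
    have "count (core z j f) x = count (core z j g) x" using assms by simp
    then show ?thesis using False unfolding core_def by simp
  qed
qed

lemma core_minus: "v = z \<or> v = j \<Longrightarrow> core z j (f - {#v#}) = core z j f"
  unfolding core_def by (intro multiset_eqI) auto

lemma core_minus_other: "v \<noteq> z \<Longrightarrow> v \<noteq> j \<Longrightarrow> core z j (f - {#v#}) = core z j f - {#v#}"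
  unfolding core_def by (intro multiset_eqI) auto

locale compression =
  fixes z j :: 'a and d :: nat and T :: "'a multiset set"
  assumes zj: "z \<noteq> j" and fin: "finite T" and deg: "\<And>f. f \<in> T \<Longrightarrow> size f = d"
begin

lemma inj_fibre: "inj_on (\<lambda>f. count f j) (fibre z j T \<kappa>)"
  unfolding fibre_def using core_eqI[OF zj] deg by (intro inj_onI) auto

lemma card_fibre_le: 
  assumes "size f = d"
  shows "card (fibre z j T (core z j f)) \<le> Suc (count f z + count f j)"
proof -
  have "(\<lambda>f. count f j) ` fibre z j T (core z j f) \<subseteq> {..count f z + count f j}"
  proof safe
    fix g assume "g \<in> fibre z j T (core z j f)"
    then have "core z j g = core z j f" "size g = size f" using deg assms unfolding fibre_def by auto
    then show "count g j \<le> count f z + count f j"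
      using size_core[OF zj, of f] size_core[OF zj, of g] by simp
  qed
  from card_mono[OF _ this] show ?thesis by (simp add: card_image inj_fibre)
qed

lemma fibre_compress: "fibre z j (compress z j d T) \<kappa> =
    {f. size f = d \<and> core z j f = \<kappa> \<and> count f j < card (fibre z j T \<kappa>)}"
  unfolding fibre_def compress_def by auto

lemma count_fibre_compress:
  "(\<lambda>f. count f j) ` fibre z j (compress z j d T) \<kappa> = {..<card (fibre z j T \<kappa>)}"
  unfolding fibre_compress
proof (intro equalityI subsetI)
  fix b assume b: "b \<in> {..<card (fibre z j T \<kappa>)}"
  then have "fibre z j T \<kappa> \<noteq> {}" by auto
  then obtain g where g: "g \<in> T" "core z j g = \<kappa>" unfolding fibre_def by auto
  define c where "c = count g z + count g j"
  have "b \<le> c" using b card_fibre_le[of g] g deg unfolding c_def by auto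
  \<comment> \<open>The member of the chain with exponent \<open>b\<close> at \<open>j\<close>. The
    exponent \<open>c - b\<close> of \<open>z\<close> is meaningful because a fibre has at most
    \<open>Suc c\<close> members.\<close>
  define f where "f = \<kappa> + replicate_mset (c - b) z + replicate_mset b j"
  have "count \<kappa> z = 0" "count \<kappa> j = 0" using g unfolding core_def by auto
  then have "count f j = b" using zj unfolding f_def by simp
  moreover have "core z j f = \<kappa>"
    unfolding f_def using g(2) zj unfolding core_def by (intro multiset_eqI) auto
  moreover have "size f = d"
    using deg[OF g(1)] size_core[OF zj, of g] g(2) \<open>b \<le> c\<close> unfolding f_def c_def by simp
  ultimately show "b \<in> (\<lambda>f. count f j) ` {f. size f = d \<and> core z j f = \<kappa> \<and> count f j < card (fibre z j T \<kappa>)}"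
    using b by force
qed auto

lemma inj_fibre_compress: "inj_on (\<lambda>f. count f j) (fibre z j (compress z j d T) \<kappa>)"
  unfolding fibre_compress using core_eqI[OF zj] by (intro inj_onI) auto

lemma compress_eq_UN: "compress z j d T = (\<Union>\<kappa>\<in>core z j ` T. fibre z j (compress z j d T) \<kappa>)"
proof (intro equalityI subsetI)
  fix f assume f: "f \<in> compress z j d T"
  then have "fibre z j T (core z j f) \<noteq> {}" unfolding compress_def by auto
  then show "f \<in> (\<Union>\<kappa>\<in>core z j ` T. fibre z j (compress z j d T) \<kappa>)"
    using f unfolding fibre_def by auto metis
qed (auto simp: fibre_def)

lemma eq_UN_fibre: "T = (\<Union>\<kappa>\<in>core z j ` T. fibre z j T \<kappa>)"
  unfolding fibre_def by auto

lemma finite_fibre: "finite (fibre z j T \<kappa>)" "finite (fibre z j (compress z j d T) \<kappa>)"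
  subgoal unfolding fibre_def using fin by simp
  subgoal using finite_imageD[OF _ inj_fibre_compress] count_fibre_compress[of \<kappa>] by simp
  done

lemma card_fibre_compress: "card (fibre z j (compress z j d T) \<kappa>) = card (fibre z j T \<kappa>)"
  using card_image[OF inj_fibre_compress, of \<kappa>] count_fibre_compress[of \<kappa>] by simp

lemma finite_compress: "finite (compress z j d T)"
  using compress_eq_UN fin finite_fibre by (metis (no_types, lifting) finite_UN finite_imageI)

lemma sum_fibres:
  fixes F :: "'a multiset \<Rightarrow> nat"
  shows "(\<Sum>f\<in>T. F f) = (\<Sum>\<kappa>\<in>core z j ` T. \<Sum>f\<in>fibre z j T \<kappa>. F f)"
    "(\<Sum>f\<in>compress z j d T. F f) = (\<Sum>\<kappa>\<in>core z j ` T. \<Sum>f\<in>fibre z j (compress z j d T) \<kappa>. F f)"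
  subgoal by (subst eq_UN_fibre, rule sum.UNION_disjoint) (use fin finite_fibre in \<open>auto simp: fibre_def\<close>)
  subgoal by (subst compress_eq_UN, rule sum.UNION_disjoint) (use fin finite_fibre in \<open>auto simp: fibre_def\<close>)
  done

lemma card_compress: "card (compress z j d T) = card T"
  using sum_fibres[of "\<lambda>_. 1"] by (simp add: card_fibre_compress)

end

text \<open>Makes the weight in \<open>weight_compress\<close> drop: compression pushes the
  exponents of \<open>j\<close> in a fibre down to the one set of their number with the least
  sum.\<close>

lemma sum_lessThan_card_le:
  fixes B :: "nat set"
  assumes "finite B"
  shows "\<Sum>{..<card B} \<le> \<Sum>B \<and> (B \<noteq> {..<card B} \<longrightarrow> \<Sum>{..<card B} < \<Sum>B)"
  using assms
proof (induction B rule: finite_linorder_max_induct)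
  case (insert b B)
  have "b \<notin> B" using insert by auto
  have "B \<subseteq> {..<b}" using insert by auto
  then have le: "card B \<le> b" using card_mono[of "{..<b}" B] by simp
  have eq: "B = {..<card B}" if "card B = b"
    using card_subset_eq[of "{..<b}" B] \<open>B \<subseteq> {..<b}\<close> that by simp
  have "\<Sum>{..<card (insert b B)} = \<Sum>{..<card B} + card B"
    using insert \<open>b \<notin> B\<close> by simp
  moreover have "\<Sum>(insert b B) = \<Sum>B + b" using insert \<open>b \<notin> B\<close> by simp
  moreover have "insert b B = {..<card (insert b B)}" if "card B = b" "B = {..<card B}"
    using that insert \<open>b \<notin> B\<close> by (auto simp: less_Suc_eq)
  ultimately show ?case using insert.IH le eq by (cases "card B = b") auto
qed simp

section \<open>Shadow and weight under compression\<close>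

context compression
begin

text \<open>The minimum is unavoidable: the chain one degree lower has just
  \<open>c = count f z + count f j\<close> members, so a full fibre of \<open>Suc c\<close> members
  must lose one. Every smaller fibre loses none.\<close>

lemma card_fibre_shadow:
  assumes "size f = d" "v = z \<or> v = j" "v \<in># f"
  shows "min (card (fibre z j T (core z j f))) (count f z + count f j)
    \<le> card (fibre z j (shadow T) (core z j (f - {#v#})))"
proof -
  define \<kappa> where "\<kappa> = core z j f"
  define c where "c = count f z + count f j"
  have \<kappa>: "core z j (f - {#v#}) = \<kappa>" using core_minus[OF assms(2), of f] unfolding \<kappa>_def by simp
  have cnt: "count g z = c - count g j" "count g j \<le> c" "size g = d" "g \<in> T" "core z j g = \<kappa>"
    if "g \<in> fibre z j T \<kappa>" for g
    using that size_core[OF zj, of g] size_core[OF zj, of f] deg[of g] assms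
    unfolding fibre_def \<kappa>_def c_def by auto
  have fs: "finite (fibre z j (shadow T) \<kappa>)" unfolding fibre_def using finite_shadow[OF fin] by simp
  have mem: "g - {#w#} \<in> fibre z j (shadow T) \<kappa>" if "g \<in> fibre z j T \<kappa>" "w = z \<or> w = j" "w \<in># g" for g w
  proof -
    have "g - {#w#} \<in> shadow T" using cnt(4)[OF that(1)] that(3) unfolding shadow_altdef by auto
    then show ?thesis
      using cnt(5)[OF that(1)] core_minus[OF that(2), of g] unfolding fibre_def by simp
  qed
  have "min (card (fibre z j T \<kappa>)) c \<le> card (fibre z j (shadow T) \<kappa>)"
  proof (cases "card (fibre z j T \<kappa>) \<le> c")
    case True
    \<comment> \<open>Divide by \<open>z\<close> below a gap \<open>b0\<close> of the fibre and by \<open>j\<close> above it: no two quotients collide.\<close>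
    have "\<exists>b0\<le>c. b0 \<notin> (\<lambda>g. count g j) ` fibre z j T \<kappa>"
    proof (rule ccontr)
      assume "\<not> ?thesis"
      then have "{..c} \<subseteq> (\<lambda>g. count g j) ` fibre z j T \<kappa>" by auto
      from card_mono[OF _ this] have "Suc c \<le> card (fibre z j T \<kappa>)"
        by (simp add: card_image inj_fibre finite_fibre)
      then show False using True by simp
    qed
    then obtain b0 where b0: "b0 \<le> c" "b0 \<notin> (\<lambda>g. count g j) ` fibre z j T \<kappa>" by blast
    define F where "F = (\<lambda>g. if count g j < b0 then g - {#z#} else g - {#j#})"
    have ne: "count g j \<noteq> b0" if "g \<in> fibre z j T \<kappa>" for g using b0(2) that by auto
    have zin: "z \<in># g" if "g \<in> fibre z j T \<kappa>" "count g j < b0" for g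
      using cnt[OF that(1)] that b0 by (intro count_inI) auto
    have jin: "j \<in># g" if "g \<in> fibre z j T \<kappa>" "\<not> count g j < b0" for g
      using ne[OF that(1)] that by (intro count_inI) auto
    have cF: "count (F g) j = (if count g j < b0 then count g j else count g j - 1)" for g
      unfolding F_def using zj by simp
    have "inj_on F (fibre z j T \<kappa>)"
    proof (rule inj_onI)
      fix g g' assume g: "g \<in> fibre z j T \<kappa>" "g' \<in> fibre z j T \<kappa>" "F g = F g'"
      have "count (F g) j = count (F g') j" using g by simp
      then have "count g j = count g' j"
        unfolding cF using ne[OF g(1)] ne[OF g(2)] by (auto split: if_splits)
      then show "g = g'" using inj_fibre g(1,2) by (auto dest: inj_onD)
    qed
    moreover have "F ` fibre z j T \<kappa> \<subseteq> fibre z j (shadow T) \<kappa>"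
      using mem zin jin unfolding F_def by auto
    ultimately have "card (fibre z j T \<kappa>) \<le> card (fibre z j (shadow T) \<kappa>)"
      using fs by (rule card_inj_on_le)
    then show ?thesis by simp
  next
    case False
    \<comment> \<open>Here the fibre is the full chain. All its members except the one with exponent
      \<open>c\<close> at \<open>j\<close> contain \<open>z\<close>, and cancelling \<open>z\<close>
      is injective on them.\<close>
    define G where "G = {g \<in> fibre z j T \<kappa>. count g j \<noteq> c}"
    have "fibre z j T \<kappa> \<subseteq> G \<union> {g \<in> fibre z j T \<kappa>. count g j = c}" unfolding G_def by auto
    moreover have "card {g \<in> fibre z j T \<kappa>. count g j = c} \<le> 1"
    proof -
      have "inj_on (\<lambda>f. count f j) {g \<in> fibre z j T \<kappa>. count g j = c}"
        by (rule inj_on_subset[OF inj_fibre]) auto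
      then show ?thesis using card_inj_on_le[of _ _ "{c}"] by fastforce
    qed
    moreover have "finite G" unfolding G_def using finite_fibre by auto
    ultimately have "c \<le> card G"
      using False card_mono[of "G \<union> {g \<in> fibre z j T \<kappa>. count g j = c}" "fibre z j T \<kappa>"]
        card_Un_le[of G "{g \<in> fibre z j T \<kappa>. count g j = c}"] finite_fibre(1)[of \<kappa>]
      by auto
    also have "\<dots> \<le> card (fibre z j (shadow T) \<kappa>)"
    proof (rule card_inj_on_le[of "\<lambda>g. g - {#z#}", OF _ _ fs])
      have zin: "z \<in># g" if "g \<in> G" for g
        using cnt[of g] that unfolding G_def by (intro count_inI) auto
      then show "(\<lambda>g. g - {#z#}) ` G \<subseteq> fibre z j (shadow T) \<kappa>"
        using mem unfolding G_def by auto
      show "inj_on (\<lambda>g. g - {#z#}) G"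
        using zin by (intro inj_onI) (metis insert_DiffM)
    qed
    finally show ?thesis by simp
  qed
  then show ?thesis unfolding \<kappa> \<kappa>_def c_def .
qed

lemma card_fibre_shadow_other:
  assumes "v \<noteq> z" "v \<noteq> j" "v \<in># f"
  shows "card (fibre z j T (core z j f)) \<le> card (fibre z j (shadow T) (core z j (f - {#v#})))"
proof (rule card_inj_on_le[of "\<lambda>g. g - {#v#}"])
  have vin: "v \<in># g" if "g \<in> fibre z j T (core z j f)" for g
  proof -
    have "count (core z j g) v = count (core z j f) v" using that unfolding fibre_def by simp
    then have "count g v = count f v" using assms unfolding core_def by simp
    then show ?thesis using assms by (metis count_eq_zero_iff)
  qed
  then show "inj_on (\<lambda>g. g - {#v#}) (fibre z j T (core z j f))"
    by (intro inj_onI) (metis insert_DiffM)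
  show "(\<lambda>g. g - {#v#}) ` fibre z j T (core z j f) \<subseteq> fibre z j (shadow T) (core z j (f - {#v#}))"
    using vin core_minus_other[OF assms(1,2)] unfolding fibre_def shadow_altdef by auto
  show "finite (fibre z j (shadow T) (core z j (f - {#v#})))"
    unfolding fibre_def using finite_shadow[OF fin] by simp
qed

text \<open>The exponent of \<open>j\<close> in a quotient is at most that in the original, and the
  fibres of the shadow are large enough by the two preceding lemmas, so the quotient still falls
  into the initial segment. As compression preserves cardinalities, this inclusion gives the
  inequality between the shadows.\<close>

lemma shadow_compress: "shadow (compress z j d T) \<subseteq> compress z j (d - 1) (shadow T)"
proof
  fix g assume "g \<in> shadow (compress z j d T)"
  then obtain f v where f: "f \<in> compress z j d T" "v \<in># f" "g = f - {#v#}"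
    unfolding shadow_altdef by auto
  have sf: "size f = d" "count f j < card (fibre z j T (core z j f))"
    using f(1) unfolding compress_def by auto
  have "count g j < card (fibre z j (shadow T) (core z j g))"
  proof (cases "v = z \<or> v = j")
    case True
    have "count g j < count f z + count f j"
      using True f zj by (auto simp: count_greater_zero_iff[symmetric] simp del: count_greater_zero_iff)
    moreover have "count g j \<le> count f j" using f(3) by simp
    ultimately show ?thesis using card_fibre_shadow[OF sf(1) True f(2)] sf(2) f(3) by simp
  next
    case False
    then show ?thesis using card_fibre_shadow_other[of v f] sf f by auto
  qed
  moreover have "size g = d - 1" using f sf by (simp add: size_Diff_singleton)
  ultimately show "g \<in> compress z j (d - 1) (shadow T)" unfolding compress_def by simp
qed

lemma card_shadow_compress: "card (shadow (compress z j d T)) \<le> card (shadow T)"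
proof -
  interpret S: compression z j "d - 1" "shadow T"
    by standard (use zj finite_shadow[OF fin] deg in \<open>auto simp: shadow_def size_Diff_singleton dest!: deg\<close>)
  show ?thesis
    using card_mono[OF S.finite_compress shadow_compress] S.card_compress by simp
qed

text \<open>The weight is the total degree in the variables other than \<open>z\<close>. It grows in
  no fibre, and it drops in the fibre of \<open>m\<close>, where the exponents of \<open>j\<close>
  have a gap right below \<open>count m j\<close>: the chain member there is the missing
  monomial.\<close>

lemma weight_compress:
  assumes "m \<in> T" "j \<in># m" "add_mset z (m - {#j#}) \<notin> T"
  shows "(\<Sum>f\<in>compress z j d T. size {#x \<in># f. x \<noteq> z#}) < (\<Sum>f\<in>T. size {#x \<in># f. x \<noteq> z#})"
proof -
  have w: "size {#x \<in># f. x \<noteq> z#} = size (core z j f) + count f j" for f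
    unfolding core_def using zj by (induction f) auto
  define N where "N = (\<lambda>\<kappa>. card (fibre z j T \<kappa>))"
  define B where "B = (\<lambda>\<kappa>. (\<lambda>f. count f j) ` fibre z j T \<kappa>)"
  have cB: "card (B \<kappa>) = N \<kappa>" "finite (B \<kappa>)" for \<kappa>
    unfolding B_def N_def by (simp_all add: card_image inj_fibre finite_fibre)
  have 1: "(\<Sum>f\<in>fibre z j T \<kappa>. size {#x \<in># f. x \<noteq> z#}) = N \<kappa> * size \<kappa> + \<Sum>(B \<kappa>)" for \<kappa>
  proof -
    have "(\<Sum>f\<in>fibre z j T \<kappa>. size {#x \<in># f. x \<noteq> z#}) = (\<Sum>f\<in>fibre z j T \<kappa>. size \<kappa> + count f j)"
      unfolding w by (rule sum.cong) (auto simp: fibre_def)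
    also have "\<dots> = N \<kappa> * size \<kappa> + \<Sum>(B \<kappa>)"
      unfolding sum.distrib N_def B_def by (simp add: sum.reindex[OF inj_fibre])
    finally show ?thesis .
  qed
  have 2: "(\<Sum>f\<in>fibre z j (compress z j d T) \<kappa>. size {#x \<in># f. x \<noteq> z#}) = N \<kappa> * size \<kappa> + \<Sum>{..<N \<kappa>}" for \<kappa>
  proof -
    have "(\<Sum>f\<in>fibre z j (compress z j d T) \<kappa>. size {#x \<in># f. x \<noteq> z#})
        = (\<Sum>f\<in>fibre z j (compress z j d T) \<kappa>. size \<kappa> + count f j)"
      unfolding w by (rule sum.cong) (auto simp: fibre_def)
    also have "\<dots> = N \<kappa> * size \<kappa> + \<Sum>((\<lambda>f. count f j) ` fibre z j (compress z j d T) \<kappa>)"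
      unfolding sum.distrib N_def by (simp add: sum.reindex[OF inj_fibre_compress] card_fibre_compress)
    finally show ?thesis unfolding count_fibre_compress N_def .
  qed
  let ?\<kappa> = "core z j m"
  have "B ?\<kappa> \<noteq> {..<N ?\<kappa>}"
  proof
    assume B: "B ?\<kappa> = {..<N ?\<kappa>}"
    have "count m j \<in> B ?\<kappa>" using assms(1) unfolding B_def fibre_def by auto
    then have "count m j - 1 \<in> B ?\<kappa>" unfolding B by auto
    then obtain g where g: "g \<in> T" "core z j g = ?\<kappa>" "count g j = count m j - 1"
      unfolding B_def fibre_def by auto
    have "g = add_mset z (m - {#j#})"
    proof (rule core_eqI[OF zj])
      show "core z j g = core z j (add_mset z (m - {#j#}))"
        using g core_minus[of j z j m] by (simp add: core_def)
      show "size g = size (add_mset z (m - {#j#}))"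
        using deg g(1) assms(1,2) by (metis insert_DiffM size_add_mset)
      show "count g j = count (add_mset z (m - {#j#})) j" using g zj by simp
    qed
    then show False using g assms by simp
  qed
  then have "\<Sum>{..<N ?\<kappa>} < \<Sum>(B ?\<kappa>)" using sum_lessThan_card_le[OF cB(2)] cB(1) by metis
  moreover have "\<Sum>{..<N \<kappa>} \<le> \<Sum>(B \<kappa>)" for \<kappa> using sum_lessThan_card_le[OF cB(2)] cB(1) by metis
  ultimately show ?thesis
    unfolding sum_fibres 1 2 using assms(1) fin by (intro sum_strict_mono_ex1) auto
qed

end

section \<open>Stable sets and Macaulay's theorem\<close>

definition stable :: "'a \<Rightarrow> 'a multiset set \<Rightarrow> bool" where
  "stable z T \<longleftrightarrow> (\<forall>m\<in>T. \<forall>j\<in>#m. add_mset z (m - {#j#}) \<in> T)"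

text \<open>Compress as long as some exchange leads out of the set. Whether a compression for one
  \<open>j\<close> spoils what was gained for another does not matter, as the weight drops each
  time.\<close>

lemma stable_ex:
  assumes "finite T" "\<And>f. f \<in> T \<Longrightarrow> size f = d" "\<And>f. f \<in> T \<Longrightarrow> set_mset f \<subseteq> V" "z \<in> V"
  shows "\<exists>T'. finite T' \<and> (\<forall>f\<in>T'. size f = d \<and> set_mset f \<subseteq> V) \<and> card T' = card T \<and>
    card (shadow T') \<le> card (shadow T) \<and> stable z T'"
  using assms(1-3)
proof (induction "\<Sum>f\<in>T. size {#x \<in># f. x \<noteq> z#}" arbitrary: T rule: less_induct)
  case less
  show ?case
  proof (cases "stable z T")
    case False
    then obtain m j where m: "m \<in> T" "j \<in># m" "add_mset z (m - {#j#}) \<notin> T"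
      unfolding stable_def by auto
    have zj: "z \<noteq> j" using m by auto
    interpret compression z j d T by standard (use zj less.prems in auto)
    have "set_mset f \<subseteq> V" if f: "f \<in> compress z j d T" for f
    proof -
      obtain g where g: "g \<in> T" "core z j g = core z j f"
        using f unfolding compress_def fibre_def
        by (metis (mono_tags, lifting) Collect_empty_eq card.empty less_nat_zero_code mem_Collect_eq)
      have "x \<in> V" if "x \<in># f" for x
      proof (cases "x = z \<or> x = j")
        case True
        then show ?thesis using m less.prems(3) assms(4) by auto
      next
        case False
        then have "x \<in># core z j f" using that unfolding core_def by simp
        then have "x \<in># core z j g" using g by simp
        then show ?thesis using less.prems(3)[OF g(1)] unfolding core_def by auto
      qed
      then show ?thesis by auto
    qed
    then have "\<exists>T'. finite T' \<and> (\<forall>f\<in>T'. size f = d \<and> set_mset f \<subseteq> V) \<and>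
        card T' = card (compress z j d T) \<and> card (shadow T') \<le> card (shadow (compress z j d T)) \<and> stable z T'"
      by (intro less.hyps weight_compress[OF m] finite_compress) (simp_all add: compress_def)
    then show ?thesis unfolding card_compress by (meson card_shadow_compress order_trans)
  qed (use less.prems in auto)
qed

text \<open>Exchanging a variable of a member for \<open>z\<close> and then cancelling
  \<open>z\<close> gives the same quotient as cancelling the variable itself.\<close>

lemma shadow_stable:
  assumes "stable z T"
  shows "shadow T = {m. add_mset z m \<in> T}"
  using assms unfolding stable_def shadow_def by force

lemma stable_shadow:
  assumes "stable z T"
  shows "stable z (shadow T)"
  unfolding stable_def
proof (intro ballI)
  fix m j assume m: "m \<in> shadow T" "j \<in># m"
  then have "add_mset z (add_mset z m - {#j#}) \<in> T"
    using assms unfolding shadow_stable[OF assms] stable_def by auto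
  moreover have "add_mset z m - {#j#} = add_mset z (m - {#j#})"
    using m(2) by (metis add_mset_commute insert_DiffM add_mset_remove_trivial)
  ultimately show "add_mset z (m - {#j#}) \<in> shadow T" unfolding shadow_stable[OF assms] by simp
qed

text \<open>Cancelling \<open>z\<close> maps the members containing \<open>z\<close> bijectively
  onto the shadow.\<close>

lemma card_stable:
  assumes "finite T" "stable z T"
  shows "card T = card (shadow T) + card {f \<in> T. z \<notin># f}"
proof -
  have "T = add_mset z ` shadow T \<union> {f \<in> T. z \<notin># f}"
    unfolding shadow_stable[OF assms(2)]
  proof (intro equalityI subsetI)
    fix f assume "f \<in> T"
    then show "f \<in> add_mset z ` {m. add_mset z m \<in> T} \<union> {f \<in> T. z \<notin># f}"
      by (cases "z \<in># f") (auto dest!: multi_member_split)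
  qed auto
  moreover have "card (add_mset z ` shadow T) = card (shadow T)" by (rule card_image) (auto simp: inj_on_def)
  moreover have "add_mset z ` shadow T \<inter> {f \<in> T. z \<notin># f} = {}" by auto
  ultimately show ?thesis
    using card_Un_disjoint[of "add_mset z ` shadow T" "{f \<in> T. z \<notin># f}"] assms(1) finite_shadow[OF assms(1)]
    by (metis (no_types, lifting) finite_Un)
qed

text \<open>Induction on the number of variables and, within it, on the degree. The inner
  hypothesis, applied to the shadow, bounds the members of the shadow avoiding \<open>n\<close> by
  Green's number. The shadow of the part of \<open>T'\<close> avoiding \<open>n\<close> lies among
  them, and this part has one variable less, so the outer hypothesis applies to it.\<close>

theorem macaulay_shadow:
  fixes T :: "nat multiset set"
  assumes "finite T" "\<And>f. f \<in> T \<Longrightarrow> size f = Suc d" "\<And>f. f \<in> T \<Longrightarrow> set_mset f \<subseteq> {..<n}" "0 < d"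
  shows "card T \<le> mgrowth d (card (shadow T))"
  using assms
proof (induction n arbitrary: d T)
  case 0
  then have "T = {}" by (metis all_not_in_conv lessThan_0 old.nat.distinct(1) set_mset_eq_empty_iff size_empty subset_empty)
  then show ?case by simp
next
  case (Suc n)
  note IHn = Suc.IH
  show ?case using Suc.prems
  proof (induction d arbitrary: T)
    case (Suc d)
    have "\<exists>T'. finite T' \<and> (\<forall>f\<in>T'. size f = Suc (Suc d) \<and> set_mset f \<subseteq> {..<Suc n}) \<and>
        card T' = card T \<and> card (shadow T') \<le> card (shadow T) \<and> stable n T'"
      by (rule stable_ex) (use Suc.prems in auto)
    then obtain T' where T': "finite T'" "\<And>f. f \<in> T' \<Longrightarrow> size f = Suc (Suc d)"
      "\<And>f. f \<in> T' \<Longrightarrow> set_mset f \<subseteq> {..<Suc n}"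
      "card T' = card T" "card (shadow T') \<le> card (shadow T)" "stable n T'"
      by blast
    define a where "a = card (shadow T')"
    let ?S = "shadow T'"
    let ?e = "rank_list (Suc d) a"
    have S: "finite ?S" "stable n ?S" "\<And>f. f \<in> ?S \<Longrightarrow> size f = Suc d" "\<And>f. f \<in> ?S \<Longrightarrow> set_mset f \<subseteq> {..<Suc n}"
      using finite_shadow T'(1) stable_shadow T'(6) T'(2,3) unfolding shadow_def by fastforce+
    have "card {f \<in> ?S. n \<notin># f} \<le> colex_rank (decrement ?e)"
    proof (cases "d = 0")
      \<comment> \<open>Here \<open>?S\<close> has degree one, where there is no inner hypothesis to
        use. It is enough that a nonempty \<open>?S\<close> has a nonempty shadow, so that not all
        of its members avoid \<open>n\<close>.\<close>
      case True
      show ?thesis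
      proof (cases "?S = {}")
        case False
        then have "shadow ?S \<noteq> {}" unfolding shadow_altdef[of ?S] using S(3) by fastforce
        then have "card (shadow ?S) \<ge> 1" using finite_shadow[OF S(1)] by (simp add: Suc_le_eq card_gt_0_iff)
        then show ?thesis using mgrowth_step_1[of a] card_stable[OF S(1,2)] True unfolding a_def by simp
      qed simp
    next
      case False
      then have "a \<le> mgrowth d (card (shadow ?S))" using Suc.IH[OF S(1,3,4)] unfolding a_def by simp
      then show ?thesis using mgrowth_step[of d a "card (shadow ?S)"] card_stable[OF S(1,2)] False unfolding a_def by simp
    qed
    moreover have "shadow {f \<in> T'. n \<notin># f} \<subseteq> {f \<in> ?S. n \<notin># f}" unfolding shadow_def by auto
    ultimately have le: "card (shadow {f \<in> T'. n \<notin># f}) \<le> colex_rank (decrement ?e)"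
      using card_mono[of "{f \<in> ?S. n \<notin># f}" "shadow {f \<in> T'. n \<notin># f}"] S(1) by auto
    have "card {f \<in> T'. n \<notin># f} \<le> mgrowth (Suc d) (card (shadow {f \<in> T'. n \<notin># f}))"
    proof (rule IHn)
      show "set_mset f \<subseteq> {..<n}" if "f \<in> {f \<in> T'. n \<notin># f}" for f
        using that T'(3)[of f] by (auto simp: less_Suc_eq)
    qed (use T' in auto)
    also have "\<dots> \<le> mgrowth (Suc d) (colex_rank (decrement ?e))" using le by (intro mgrowth_mono) auto
    finally have "card T' \<le> mgrowth (Suc d) a"
      using card_stable[OF T'(1,6)] mgrowth_split[of "Suc d" a] unfolding a_def by simp
    also have "\<dots> \<le> mgrowth (Suc d) (card (shadow T))" using T'(5) unfolding a_def by (intro mgrowth_mono) auto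
    finally show ?case using T'(4) by simp
  qed simp
qed


section \<open>Order ideals with prescribed Hilbert function\<close>

lemma desc_remove1: "desc xs \<Longrightarrow> desc (remove1 x xs)"
  by (induction xs) (auto dest: notin_set_remove1 intro: set_mp[OF set_remove1_subset])

lemma colex_rank_tl_le_butlast:
  assumes "desc (y # ys)" shows "colex_rank ys \<le> colex_rank (butlast (y # ys))"
  using assms
proof (induction ys arbitrary: y)
  case (Cons z zs)
  have "(z + length zs choose Suc (length zs)) \<le> (y + length zs choose Suc (length zs))"
    using Cons.prems by (intro binomial_right_mono) auto
  moreover have "butlast (y # z # zs) = y # butlast (z # zs)" by simp
  then have "colex_rank (butlast (y # z # zs)) = colex_rank (butlast (z # zs)) + (y + length zs choose Suc (length zs))"
    by (simp only: colex_rank.simps length_butlast) simp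
  ultimately show ?case using Cons.IH[of z] Cons.prems by simp
qed simp

text \<open>Removing an earlier entry lets smaller ones move into its place, so removing the last
  entry gives the quotient of largest rank. For closure under division only that quotient has to be
  examined.\<close>

lemma colex_rank_remove1_le_butlast:
  assumes "desc f" "x \<in> set f" shows "colex_rank (remove1 x f) \<le> colex_rank (butlast f)"
  using assms
proof (induction f)
  case (Cons y ys)
  show ?case
  proof (cases "x = y")
    case True
    then show ?thesis using colex_rank_tl_le_butlast[OF Cons.prems(1)] by simp
  next
    case False
    then have "x \<in> set ys" "colex_rank (remove1 x ys) \<le> colex_rank (butlast ys)" using Cons by auto
    then show ?thesis using False by (cases "ys = []") (auto simp: length_remove1)
  qed
qed simp

definition desc_list :: "nat multiset \<Rightarrow> nat list" where
  "desc_list m = rev (sorted_list_of_multiset m)"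

lemma desc_desc_list: "desc (desc_list m)"
  unfolding desc_list_def sorted_wrt_rev by simp

lemma mset_desc_list [simp]: "mset (desc_list m) = m"
  unfolding desc_list_def by simp

lemma length_desc_list [simp]: "length (desc_list m) = size m"
  by (metis mset_desc_list size_mset)

lemma desc_list_mset: "desc e \<Longrightarrow> desc_list (mset e) = e"
  unfolding desc_list_def sorted_list_of_multiset_mset
  by (metis mset_rev properties_for_sort rev_swap sorted_wrt_rev)

theorem order_ideal_ex:
  fixes g :: "nat \<Rightarrow> nat"
  assumes "g 0 = 1" "\<And>i. 1 \<le> i \<Longrightarrow> i < t \<Longrightarrow> g (Suc i) \<le> mgrowth i (g i)"
  shows "\<exists>M :: nat multiset set. finite M \<and> (\<forall>x m. add_mset x m \<in> M \<longrightarrow> m \<in> M) \<and>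
    (\<forall>m\<in>M. size m \<le> t) \<and> (\<forall>i\<le>t. card {m \<in> M. size m = i} = g i)"
proof -
  define M where "M = {m. size m \<le> t \<and> colex_rank (desc_list m) < g (size m)}"
  have bij: "bij_betw (\<lambda>m. colex_rank (desc_list m)) {m \<in> M. size m = i} {..<g i}" if "i \<le> t" for i
  proof (rule bij_betwI')
    fix m m' assume "m \<in> {m \<in> M. size m = i}" "m' \<in> {m \<in> M. size m = i}"
    then have "length (desc_list m) = length (desc_list m')" by simp
    then show "colex_rank (desc_list m) = colex_rank (desc_list m') \<longleftrightarrow> m = m'"
      using colex_rank_inj[OF _ desc_desc_list desc_desc_list] mset_desc_list by metis
  next
    fix a assume a: "a \<in> {..<g i}"
    then have "i = 0 \<Longrightarrow> a = 0" using assms(1) by auto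
    from colex_rank_ex[OF this] obtain e where e: "desc e" "length e = i" "colex_rank e = a" by blast
    then have "mset e \<in> M" "size (mset e) = i" "a = colex_rank (desc_list (mset e))"
      using a that by (auto simp: M_def desc_list_mset)
    then show "\<exists>m\<in>{m \<in> M. size m = i}. a = colex_rank (desc_list m)" by blast
  qed (auto simp: M_def)
  have "finite {m \<in> M. size m = i}" if "i \<le> t" for i
    using bij_betw_finite[OF bij[OF that]] by simp
  then have "finite (\<Union>i\<in>{..t}. {m \<in> M. size m = i})" by blast
  moreover have "M \<subseteq> (\<Union>i\<in>{..t}. {m \<in> M. size m = i})" unfolding M_def by auto
  ultimately have "finite M" by (rule rev_finite_subset)
  moreover have "m \<in> M" if xm: "add_mset x m \<in> M" for x m
  proof (cases "size m = 0")
    case True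
    then show ?thesis using assms(1) by (simp add: M_def desc_list_def)
  next
    case False
    define d where "d = size m"
    define f where "f = desc_list (add_mset x m)"
    have d: "0 < d" "d < t" using False xm by (auto simp: d_def M_def nonempty_has_size)
    have f: "desc f" "length f = Suc d" "x \<in> set f" "colex_rank f < g (Suc d)"
      using xm desc_desc_list unfolding f_def
      by (auto simp: d_def M_def simp flip: set_mset_mset)
    have "mset (remove1 x f) = m" unfolding f_def by simp
    then have "desc_list m = remove1 x f"
      using desc_list_mset[OF desc_remove1[OF f(1)], of x] by simp
    then have le: "colex_rank (desc_list m) \<le> colex_rank (butlast f)" using colex_rank_remove1_le_butlast[OF f(1,3)] by simp
    \<comment> \<open>The first list of degree \<open>d\<close> outside \<open>M\<close>. The growth
      condition puts \<open>f\<close> strictly below its least extension \<open>e @ [0]\<close>,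
      which excludes the case of equality in \<open>colex_rank_butlast\<close>.\<close>
    define e where "e = rank_list d (g d)"
    have e: "desc e" "length e = d" "colex_rank e = g d" using rank_list[OF d(1)] unfolding e_def by auto
    have lt: "colex_rank f < colex_rank (e @ [0])" using f(4) assms(2)[of d] d unfolding mgrowth_def e_def by simp
    obtain f' a where f': "f = f' @ [a]" using f(2) by (cases f rule: rev_cases) auto
    have "colex_rank f' < colex_rank e"
      using colex_rank_butlast[of f' a e] f f' e lt by auto
    then show ?thesis using le f' e d by (auto simp: M_def d_def)
  qed
  moreover have "card {m \<in> M. size m = i} = g i" if "i \<le> t" for i
    using bij_betw_same_card[OF bij[OF that]] by simp
  ultimately show ?thesis by (intro exI[of _ M]) (auto simp: M_def)
qed


section \<open>Polynomials, gradings and bases modulo a subspace\<close>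

abbreviation polys :: "nat \<Rightarrow> 'k::field mpoly set" where
  "polys n \<equiv> carrier (poly_ring n)"

lemma polys_iff: "p \<in> polys n \<longleftrightarrow> (\<forall>m\<in>Poly_Mapping.keys p. Poly_Mapping.keys m \<subseteq> {..n})"
  by (simp add: poly_ring_def)

lemma poly_ring_ops [simp]:
  "x \<oplus>\<^bsub>poly_ring n\<^esub> y = x + y" "x \<otimes>\<^bsub>poly_ring n\<^esub> y = x * y"
  "\<zero>\<^bsub>poly_ring n\<^esub> = 0" "\<one>\<^bsub>poly_ring n\<^esub> = 1"
  by (simp_all add: poly_ring_def)

lemma mono_degree_superset:
  assumes "finite A" "Poly_Mapping.keys m \<subseteq> A"
  shows "mono_degree m = (\<Sum>v\<in>A. Poly_Mapping.lookup m v)"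
  unfolding mono_degree_def by (rule sum.mono_neutral_left) (use assms in \<open>auto simp: in_keys_iff\<close>)

lemma mono_degree_add: "mono_degree (m + m') = mono_degree m + mono_degree m'"
proof -
  let ?A = "Poly_Mapping.keys m \<union> Poly_Mapping.keys m'"
  have "Poly_Mapping.keys (m + m') \<subseteq> ?A" by (rule Poly_Mapping.keys_add)
  then show ?thesis
    using mono_degree_superset[of ?A "m + m'"] mono_degree_superset[of ?A m] mono_degree_superset[of ?A m']
    by (simp add: lookup_add sum.distrib)
qed

lemma mono_degree_0 [simp]: "mono_degree 0 = 0"
  by (simp add: mono_degree_def)

lemma mono_degree_single [simp]: "mono_degree (Poly_Mapping.single v a) = a"
  by (simp add: mono_degree_def)

lemma mono_degree_eq_0_iff [simp]: "mono_degree m = 0 \<longleftrightarrow> m = 0"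
  by (auto simp: mono_degree_def in_keys_iff intro!: poly_mapping_eqI)

lemma keys_add_monomial: "Poly_Mapping.keys (m + m' :: monomial) = Poly_Mapping.keys m \<union> Poly_Mapping.keys m'"
  by (auto simp: in_keys_iff lookup_add)

definition mons :: "nat \<Rightarrow> nat \<Rightarrow> monomial set" where
  "mons n i = {m. Poly_Mapping.keys m \<subseteq> {..n} \<and> mono_degree m = i}"

lemma homog_part_iff: "p \<in> homog_part n i \<longleftrightarrow> Poly_Mapping.keys p \<subseteq> mons n i"
  unfolding homog_part_def mons_def polys_iff by auto

lemma finite_mons: "finite (mons n i)"
proof (rule finite_imageD)
  show "inj_on Poly_Mapping.lookup (mons n i)"
    by (rule inj_onI) (simp only: lookup_inject)
  have "Poly_Mapping.lookup m v \<le> i" if m: "m \<in> mons n i" "v \<le> n" for m v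
  proof -
    have "Poly_Mapping.lookup m v \<le> (\<Sum>v\<in>{..n}. Poly_Mapping.lookup m v)"
      by (rule member_le_sum) (use m in auto)
    then show ?thesis
      using m mono_degree_superset[of "{..n}" m] unfolding mons_def by auto
  qed
  moreover have "Poly_Mapping.lookup m v = 0" if "m \<in> mons n i" "\<not> v \<le> n" for m v
    using that unfolding mons_def by (auto simp: subset_iff in_keys_iff)
  ultimately have "Poly_Mapping.lookup ` mons n i
      \<subseteq> {f. \<forall>v. (v \<in> {..n} \<longrightarrow> f v \<in> {..i}) \<and> (v \<notin> {..n} \<longrightarrow> f v = 0)}"
    by auto
  then show "finite (Poly_Mapping.lookup ` mons n i)"
    by (rule finite_subset) (rule finite_set_of_finite_funs, auto)
qed

lemma polys_closed [simp, intro]: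
  fixes p q :: "'k::field mpoly"
  shows "(0 :: 'k mpoly) \<in> polys n" "(1 :: 'k mpoly) \<in> polys n" "Const (c :: 'k) \<in> polys n"
  "p \<in> polys n \<Longrightarrow> q \<in> polys n \<Longrightarrow> p + q \<in> polys n"
  "p \<in> polys n \<Longrightarrow> q \<in> polys n \<Longrightarrow> p * q \<in> polys n"
  "p \<in> polys n \<Longrightarrow> - p \<in> polys n"
  "p \<in> polys n \<Longrightarrow> q \<in> polys n \<Longrightarrow> p - q \<in> polys n"
proof -
  interpret cring "poly_ring n :: 'k mpoly ring" by (rule poly_ring_cring)
  show "(0 :: 'k mpoly) \<in> polys n" "(1 :: 'k mpoly) \<in> polys n" using zero_closed one_closed by simp_all
  show "Const (c :: 'k) \<in> polys n" unfolding polys_iff Const_def by auto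
  show "p \<in> polys n \<Longrightarrow> q \<in> polys n \<Longrightarrow> p + q \<in> polys n" using a_closed[of p q] by simp
  show "p \<in> polys n \<Longrightarrow> q \<in> polys n \<Longrightarrow> p * q \<in> polys n" using m_closed[of p q] by simp
  show u: "p \<in> polys n \<Longrightarrow> - p \<in> polys n" for p :: "'k mpoly" unfolding polys_iff by simp
  show "p \<in> polys n \<Longrightarrow> q \<in> polys n \<Longrightarrow> p - q \<in> polys n" using a_closed[of p "- q"] u by simp
qed

lemma polys_power: "p \<in> polys n \<Longrightarrow> p ^ j \<in> polys n"
  by (induction j) auto

lemma homog_part_sub: "p \<in> homog_part n i \<Longrightarrow> p \<in> polys n"
  by (simp add: homog_part_def)

lemma Const_simps [simp]:
  "Const 0 = 0" "Const 1 = 1" "Const (a + b) = Const a + Const (b :: 'k::comm_ring_1)"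
  "Const (- a) = - Const (a :: 'k::comm_ring_1)"
  "Const (a - b) = Const a - Const (b :: 'k::comm_ring_1)"
  "Const (a * b) = Const a * Const (b :: 'k::comm_ring_1)"
  by (simp_all add: Const_def single_add single_uminus single_diff mult_single)

lemma Const_sum: "Const (sum f X) = (\<Sum>x\<in>X. Const (f x :: 'k::comm_ring_1))"
  by (induction X rule: infinite_finite_induct) auto

lemma lookup_Const_mult [simp]:
  "Poly_Mapping.lookup (Const c * p) m = (c :: 'k::comm_ring_1) * Poly_Mapping.lookup p m"
  unfolding Const_def mult_map_scale_conv_mult[symmetric] by (simp add: map.rep_eq when_def)

lemma homog_part_closed [simp, intro]:
  "0 \<in> homog_part n i"
  "p \<in> homog_part n i \<Longrightarrow> q \<in> homog_part n i \<Longrightarrow> p + q \<in> homog_part n i"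
  "p \<in> homog_part n i \<Longrightarrow> q \<in> homog_part n i \<Longrightarrow> p - q \<in> homog_part n i"
  "p \<in> homog_part n i \<Longrightarrow> Const c * p \<in> homog_part n i"
  "Const c \<in> homog_part n 0" "1 \<in> homog_part n 0"
  unfolding homog_part_iff
  subgoal by simp
  subgoal using Poly_Mapping.keys_add[of p q] by blast
  subgoal using keys_diff[of p q] by blast
  subgoal by (auto simp: in_keys_iff)
  subgoal by (auto simp: Const_def mons_def)
  subgoal by (auto simp: mons_def)
  done

lemma mons_add: "m \<in> mons n i \<Longrightarrow> m' \<in> mons n j \<Longrightarrow> m + m' \<in> mons n (i + j)"
  by (auto simp: mons_def keys_add_monomial mono_degree_add)

lemma homog_part_mult:
  "p \<in> homog_part n i \<Longrightarrow> q \<in> homog_part n j \<Longrightarrow> p * q \<in> homog_part n (i + j)"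
  unfolding homog_part_iff using Poly_Mapping.keys_mult[of p q] mons_add by fastforce

lemma homog_part_power: "p \<in> homog_part n i \<Longrightarrow> p ^ j \<in> homog_part n (j * i)"
  by (induction j) (auto intro: homog_part_mult)

lemma Var_homog: "v \<le> n \<Longrightarrow> Var v \<in> homog_part n 1"
  unfolding homog_part_iff Var_def mons_def by auto

lemma single_homog: "m \<in> mons n i \<Longrightarrow> Poly_Mapping.single m c \<in> homog_part n i"
  unfolding homog_part_iff by auto

lemma poly_eq_sum_single:
  fixes p :: "'a \<Rightarrow>\<^sub>0 'b::comm_monoid_add"
  assumes "finite A" "Poly_Mapping.keys p \<subseteq> A"
  shows "p = (\<Sum>m\<in>A. Poly_Mapping.single m (Poly_Mapping.lookup p m))"
proof (rule poly_mapping_eqI)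
  fix m
  show "Poly_Mapping.lookup p m = Poly_Mapping.lookup (\<Sum>m\<in>A. Poly_Mapping.single m (Poly_Mapping.lookup p m)) m"
    using assms by (auto simp: lookup_sum lookup_single when_def in_keys_iff)
qed

lemma Const_mult_single: "Const c * Poly_Mapping.single m 1 = Poly_Mapping.single m (c :: 'k::comm_ring_1)"
  by (simp add: Const_def mult_single)

lemma poly_induct [consumes 1, case_names zero add single]:
  fixes p :: "'a \<Rightarrow>\<^sub>0 'b::comm_monoid_add"
  assumes "Poly_Mapping.keys p \<subseteq> A" "P 0" "\<And>p q. P p \<Longrightarrow> P q \<Longrightarrow> P (p + q)"
    and "\<And>m c. m \<in> A \<Longrightarrow> P (Poly_Mapping.single m c)"
  shows "P p"
proof -
  have "P (\<Sum>m\<in>B. Poly_Mapping.single m (Poly_Mapping.lookup p m))" if "B \<subseteq> A" "finite B" for B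
    using that(2,1) by (induction B rule: finite_induct) (auto intro: assms)
  from this[OF assms(1)] show ?thesis using poly_eq_sum_single[of "Poly_Mapping.keys p" p] by simp
qed

subsection \<open>Homogeneous components\<close>

definition hcomp :: "nat \<Rightarrow> 'k::comm_ring_1 mpoly \<Rightarrow> 'k mpoly" where
  "hcomp i p = (\<Sum>m\<in>{m \<in> Poly_Mapping.keys p. mono_degree m = i}. Poly_Mapping.single m (Poly_Mapping.lookup p m))"

lemma lookup_hcomp: "Poly_Mapping.lookup (hcomp i p) m = (if mono_degree m = i then Poly_Mapping.lookup p m else 0)"
  unfolding hcomp_def by (auto simp: lookup_sum lookup_single when_def in_keys_iff)

lemma keys_hcomp: "Poly_Mapping.keys (hcomp i p) = {m \<in> Poly_Mapping.keys p. mono_degree m = i}"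
  by (auto simp: in_keys_iff lookup_hcomp split: if_splits)

lemma hcomp_add: "hcomp i (p + q) = hcomp i p + hcomp i q"
  by (rule poly_mapping_eqI) (simp add: lookup_hcomp lookup_add)

lemma hcomp_diff: "hcomp i (p - q) = hcomp i p - hcomp i q"
  by (rule poly_mapping_eqI) (simp add: lookup_hcomp lookup_minus)

lemma hcomp_Const_mult: "hcomp i (Const c * p) = Const c * hcomp i p"
  by (rule poly_mapping_eqI) (simp add: lookup_hcomp)

lemma hcomp_0 [simp]: "hcomp i 0 = 0"
  by (rule poly_mapping_eqI) (simp add: lookup_hcomp)

lemma hcomp_homog: "p \<in> polys n \<Longrightarrow> hcomp i p \<in> homog_part n i"
  by (auto simp: homog_part_def polys_iff keys_hcomp)

lemma hcomp_same: "p \<in> homog_part n i \<Longrightarrow> hcomp i p = p"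
  unfolding homog_part_def by (auto intro!: poly_mapping_eqI simp: lookup_hcomp in_keys_iff)

lemma hcomp_other: "p \<in> homog_part n j \<Longrightarrow> i \<noteq> j \<Longrightarrow> hcomp i p = 0"
  unfolding homog_part_def by (auto intro!: poly_mapping_eqI simp: lookup_hcomp in_keys_iff)

lemma hcomp_single: "hcomp i (Poly_Mapping.single m c) = (if mono_degree m = i then Poly_Mapping.single m c else 0)"
  by (rule poly_mapping_eqI) (auto simp: lookup_hcomp lookup_single when_def)

lemma eq_sum_hcomp: "p = (\<Sum>i\<in>mono_degree ` Poly_Mapping.keys p. hcomp i p)"
  by (rule poly_mapping_eqI) (auto simp: lookup_sum lookup_hcomp in_keys_iff)

lemma hcomp_mult:
  fixes p q :: "'k::field mpoly"
  assumes "q \<in> homog_part n j" "p \<in> polys n"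
  shows "hcomp i (p * q) = (if j \<le> i then hcomp (i - j) p * q else 0)"
proof -
  have "Poly_Mapping.keys p \<subseteq> {m. Poly_Mapping.keys m \<subseteq> {..n}}" using assms(2) by (auto simp: polys_iff)
  then show ?thesis
  proof (induction p rule: poly_induct)
    case (single m c)
    then have "Poly_Mapping.single m c * q \<in> homog_part n (mono_degree m + j)"
      using assms(1) by (intro homog_part_mult single_homog) (auto simp: mons_def)
    then show ?case
      using hcomp_same[of "Poly_Mapping.single m c * q" n] hcomp_other[of "Poly_Mapping.single m c * q" n "mono_degree m + j" i]
      by (cases "i = mono_degree m + j") (auto simp: hcomp_single)
  qed (auto simp: hcomp_add distrib_right)
qed

subsection \<open>Bases modulo a subspace\<close>

text \<open>Bases are indexed families with a free index type, so that they can be enlarged by an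
  option type or joined by a disjoint sum. Counting modulo \<open>I\<close> keeps all linear algebra
  within the polynomials; the quotient ring enters in \<open>dimension_basis\<close>.\<close>

definition lincomb :: "'x set \<Rightarrow> ('x \<Rightarrow> 'k::field mpoly) \<Rightarrow> ('x \<Rightarrow> 'k) \<Rightarrow> 'k mpoly" where
  "lincomb X u c = (\<Sum>x\<in>X. Const (c x) * u x)"

definition subsp :: "'k::field mpoly set \<Rightarrow> bool" where
  "subsp I \<longleftrightarrow> 0 \<in> I \<and> (\<forall>p\<in>I. \<forall>q\<in>I. p + q \<in> I) \<and> (\<forall>c. \<forall>p\<in>I. Const c * p \<in> I)"

definition indep_mod :: "'k::field mpoly set \<Rightarrow> 'x set \<Rightarrow> ('x \<Rightarrow> 'k mpoly) \<Rightarrow> bool" where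
  "indep_mod I X u \<longleftrightarrow> (\<forall>c. lincomb X u c \<in> I \<longrightarrow> (\<forall>x\<in>X. c x = 0))"

definition spans_mod :: "'k::field mpoly set \<Rightarrow> 'k mpoly set \<Rightarrow> 'x set \<Rightarrow> ('x \<Rightarrow> 'k mpoly) \<Rightarrow> bool" where
  "spans_mod I V X u \<longleftrightarrow> (\<forall>v\<in>V. \<exists>c. v - lincomb X u c \<in> I)"

definition basis_mod :: "'k::field mpoly set \<Rightarrow> 'k mpoly set \<Rightarrow> 'x set \<Rightarrow> ('x \<Rightarrow> 'k mpoly) \<Rightarrow> bool" where
  "basis_mod I V X u \<longleftrightarrow> finite X \<and> u ` X \<subseteq> V \<and> indep_mod I X u \<and> spans_mod I V X u"

lemma subspD:
  assumes "subsp I"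
  shows "0 \<in> I" "p \<in> I \<Longrightarrow> q \<in> I \<Longrightarrow> p + q \<in> I" "p \<in> I \<Longrightarrow> Const c * p \<in> I"
    "p \<in> I \<Longrightarrow> - p \<in> I" "p \<in> I \<Longrightarrow> q \<in> I \<Longrightarrow> p - q \<in> I"
proof -
  have C: "Const c * p \<in> I" if "p \<in> I" for c p using assms that unfolding subsp_def by blast
  have A: "p + q \<in> I" if "p \<in> I" "q \<in> I" for p q using assms that unfolding subsp_def by blast
  show "0 \<in> I" using assms unfolding subsp_def by blast
  show "p \<in> I \<Longrightarrow> q \<in> I \<Longrightarrow> p + q \<in> I" "p \<in> I \<Longrightarrow> Const c * p \<in> I" using A C by auto
  show N: "p \<in> I \<Longrightarrow> - p \<in> I" for p using C[of p "- 1"] by simp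
  show "p \<in> I \<Longrightarrow> q \<in> I \<Longrightarrow> p - q \<in> I" using A[of p "- q"] N by simp
qed

lemma subsp_sum: "subsp I \<Longrightarrow> (\<And>x. x \<in> X \<Longrightarrow> f x \<in> I) \<Longrightarrow> sum f X \<in> I"
  by (induction X rule: infinite_finite_induct) (auto intro: subspD)

lemma subsp_lincomb: "subsp I \<Longrightarrow> (\<And>x. x \<in> X \<Longrightarrow> u x \<in> I) \<Longrightarrow> lincomb X u c \<in> I"
  unfolding lincomb_def by (intro subsp_sum subspD)

lemma subsp_polys: "subsp (polys n)"
  unfolding subsp_def by auto

lemma subsp_homog_part: "subsp (homog_part n i)"
  unfolding subsp_def by auto

lemma lincomb_add: "lincomb X u (\<lambda>x. c x + c' x) = lincomb X u c + lincomb X u c'"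
  unfolding lincomb_def by (simp add: distrib_right sum.distrib)

lemma lincomb_scale: "lincomb X u (\<lambda>x. a * c x) = Const a * lincomb X u c"
  unfolding lincomb_def by (simp add: sum_distrib_left mult.assoc)

lemma lincomb_mult: "lincomb X (\<lambda>x. f * u x) c = f * lincomb X u c"
  unfolding lincomb_def by (simp add: sum_distrib_left ac_simps)

lemma lincomb_cong: "(\<And>x. x \<in> X \<Longrightarrow> c x = c' x) \<Longrightarrow> (\<And>x. x \<in> X \<Longrightarrow> u x = u' x) \<Longrightarrow> lincomb X u c = lincomb X u' c'"
  unfolding lincomb_def by (intro sum.cong) auto

lemma lincomb_cong_mod:
  assumes "subsp I" "\<And>x. x \<in> X \<Longrightarrow> u x - u' x \<in> I"
  shows "lincomb X u c - lincomb X u' c \<in> I"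
proof -
  have "lincomb X u c - lincomb X u' c = lincomb X (\<lambda>x. u x - u' x) c"
    unfolding lincomb_def by (simp add: right_diff_distrib sum_subtractf)
  then show ?thesis using subsp_lincomb[OF assms(1), of X "\<lambda>x. u x - u' x" c] assms(2) by simp
qed

text \<open>Gaussian elimination, one equation at a time: equation \<open>y\<close> is solved for
  the unknown \<open>x0\<close>, which is substituted into the others.\<close>

lemma underdetermined_system:
  fixes A :: "'x \<Rightarrow> 'y \<Rightarrow> 'k::field"
  assumes "finite Y" "finite X" "card Y < card X"
  shows "\<exists>c. (\<exists>x\<in>X. c x \<noteq> 0) \<and> (\<forall>y\<in>Y. (\<Sum>x\<in>X. c x * A x y) = 0)"
  using assms
proof (induction Y arbitrary: X A rule: finite_induct)
  case empty
  then have "X \<noteq> {}" by auto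
  then show ?case by (intro exI[of _ "\<lambda>_. 1"]) auto
next
  case (insert y Y)
  show ?case
  proof (cases "\<forall>x\<in>X. A x y = 0")
    case True
    then show ?thesis using insert.IH[of X A] insert.prems insert.hyps by auto
  next
    case False
    then obtain x0 where x0: "x0 \<in> X" "A x0 y \<noteq> 0" by auto
    let ?A = "\<lambda>x z. A x z - A x y / A x0 y * A x0 z"
    have "card Y < card (X - {x0})" using insert.prems insert.hyps x0 by simp
    then obtain c x1 where c: "x1 \<in> X - {x0}" "c x1 \<noteq> 0"
      "\<And>z. z \<in> Y \<Longrightarrow> (\<Sum>x\<in>X - {x0}. c x * ?A x z) = 0"
      using insert.IH[of "X - {x0}" ?A] insert.prems by auto
    let ?c = "c(x0 := - (\<Sum>x\<in>X - {x0}. c x * (A x y / A x0 y)))"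
    have eq: "(\<Sum>x\<in>X. ?c x * A x z) = (\<Sum>x\<in>X - {x0}. c x * ?A x z)" for z
    proof -
      have "(\<Sum>x\<in>X. ?c x * A x z) = ?c x0 * A x0 z + (\<Sum>x\<in>X - {x0}. ?c x * A x z)"
        using sum.remove[OF insert.prems(1) x0(1)] .
      also have "(\<Sum>x\<in>X - {x0}. ?c x * A x z) = (\<Sum>x\<in>X - {x0}. c x * A x z)"
        by (rule sum.cong) auto
      finally show ?thesis by (simp add: right_diff_distrib sum_subtractf sum_distrib_right mult.assoc)
    qed
    have "(\<Sum>x\<in>X. ?c x * A x z) = 0" if "z \<in> insert y Y" for z
      unfolding eq using that c(3) x0(2) by (cases "z = y") auto
    moreover have "?c x1 \<noteq> 0" using c by auto
    ultimately show ?thesis using c(1) by (intro exI[of _ ?c]) blast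
  qed
qed

text \<open>Expand each \<open>u x\<close> in terms of \<open>w\<close>. With fewer equations than
  unknowns some nontrivial combination has all coordinates zero, which is a relation among the
  \<open>u x\<close> modulo \<open>I\<close>.\<close>

lemma indep_card_le:
  assumes I: "subsp I" and "finite X" "finite Y" "indep_mod I X u" "spans_mod I V Y w" "u ` X \<subseteq> V"
  shows "card X \<le> card Y"
proof (rule ccontr)
  assume "\<not> card X \<le> card Y"
  have "\<forall>x\<in>X. \<exists>a. u x - lincomb Y w a \<in> I" using assms unfolding spans_mod_def by auto
  then obtain A where A: "\<And>x. x \<in> X \<Longrightarrow> u x - lincomb Y w (A x) \<in> I" by metis
  obtain c x where c: "x \<in> X" "c x \<noteq> 0" "\<And>y. y \<in> Y \<Longrightarrow> (\<Sum>x\<in>X. c x * A x y) = 0"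
    using underdetermined_system[of Y X A] assms \<open>\<not> card X \<le> card Y\<close> by auto
  have "lincomb X (\<lambda>x. lincomb Y w (A x)) c = lincomb Y w (\<lambda>y. \<Sum>x\<in>X. c x * A x y)"
    unfolding lincomb_def
    by (simp add: sum_distrib_left sum_distrib_right Const_sum mult.assoc) (rule sum.swap)
  also have "\<dots> = 0" unfolding lincomb_def using c(3) by simp
  finally have "lincomb X u c \<in> I"
    using lincomb_cong_mod[OF I, of X u "\<lambda>x. lincomb Y w (A x)" c] A by simp
  then show False using assms(4) c unfolding indep_mod_def by auto
qed

lemma basis_card_eq:
  assumes "subsp I" "basis_mod I V X u" "basis_mod I V Y w"
  shows "card X = card Y"
  using indep_card_le[OF assms(1), of X Y u V w] indep_card_le[OF assms(1), of Y X w V u] assms(2,3)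
  unfolding basis_mod_def by (simp add: le_antisym)

text \<open>A vector outside the span, placed at the index \<open>None\<close>, would extend the
  family to an independent one that is too large. Serves to conclude that an injective map between
  spaces of equal dimension is surjective.\<close>

lemma indep_card_eq_spans:
  assumes I: "subsp I" and "finite X" "indep_mod I X u" "u ` X \<subseteq> V" "finite Y" "spans_mod I V Y w" "card Y \<le> card X"
  shows "spans_mod I V X u"
  unfolding spans_mod_def
proof (intro ballI, rule ccontr)
  fix v assume v: "v \<in> V" "\<nexists>c. v - lincomb X u c \<in> I"
  let ?u = "\<lambda>x. case x of None \<Rightarrow> v | Some x \<Rightarrow> u x"
  let ?X = "insert None (Some ` X)"
  have lc: "lincomb ?X ?u c = Const (c None) * v + lincomb X u (\<lambda>x. c (Some x))" for c
    unfolding lincomb_def using assms(2) by (simp add: sum.reindex)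
  have "indep_mod I ?X ?u"
    unfolding indep_mod_def
  proof (intro allI impI)
    fix c assume c: "lincomb ?X ?u c \<in> I"
    have "c None = 0"
    proof (rule ccontr)
      assume nz: "c None \<noteq> 0"
      have "Const (1 / c None) * lincomb ?X ?u c = v - lincomb X u (\<lambda>x. - 1 / c None * c (Some x))"
        unfolding lc lincomb_scale using nz
        by (simp add: distrib_left mult.assoc[symmetric] flip: Const_simps(6))
      then show False using subspD(3)[OF I c] v(2) by metis
    qed
    moreover from this have "\<forall>x\<in>X. c (Some x) = 0"
      using c spec[OF assms(3)[unfolded indep_mod_def], of "\<lambda>x. c (Some x)"] unfolding lc by simp
    ultimately show "\<forall>x\<in>?X. c x = 0" by auto
  qed
  then have "card ?X \<le> card Y"
    using assms v by (intro indep_card_le[OF I _ _ _ assms(6), of ?X ?u]) auto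
  then show False using assms by (simp add: card_image)
qed

subsection \<open>Standard monomials\<close>

text \<open>The monomials that are not leading monomials of elements of \<open>I\<close>, for the monomial order
  provided by the linear order on \<^typ>\<open>monomial\<close>.\<close>

definition std_mons :: "'k::field mpoly set \<Rightarrow> nat \<Rightarrow> nat \<Rightarrow> monomial set" where
  "std_mons I n i = {m \<in> mons n i. \<not> (\<exists>f\<in>I. m \<in> Poly_Mapping.keys f \<and> Poly_Mapping.keys f \<subseteq> mons n i \<and> (\<forall>m'\<in>Poly_Mapping.keys f. m' \<le> m))}"

lemma lookup_lincomb_single:
  "finite X \<Longrightarrow> Poly_Mapping.lookup (lincomb X (\<lambda>m. Poly_Mapping.single m 1) c) m = (if m \<in> X then c m else 0)"
  unfolding lincomb_def by (simp add: Const_mult_single lookup_sum lookup_single when_def)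

text \<open>A nonzero combination in \<open>I\<close> would have its largest monomial as leading
  monomial, so standard monomials are independent. They span by induction along the order: a
  nonstandard monomial is rewritten by a member of \<open>I\<close> that it leads.\<close>

lemma basis_std_mons:
  assumes I: "subsp I"
  shows "basis_mod I (homog_part n i) (std_mons I n i) (\<lambda>m. Poly_Mapping.single m 1)"
proof -
  let ?X = "std_mons I n i" and ?u = "\<lambda>m. Poly_Mapping.single m (1 :: 'a)"
  have sub: "?X \<subseteq> mons n i" unfolding std_mons_def by auto
  have fin: "finite ?X" using finite_subset[OF sub finite_mons] .
  have "indep_mod I ?X ?u"
    unfolding indep_mod_def
  proof (intro allI impI, rule ccontr)
    fix c assume c: "lincomb ?X ?u c \<in> I" "\<not> (\<forall>x\<in>?X. c x = 0)"
    define f where "f = lincomb ?X ?u c"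
    have keys: "Poly_Mapping.keys f = {m \<in> ?X. c m \<noteq> 0}"
      unfolding f_def by (auto simp: in_keys_iff lookup_lincomb_single[OF fin] split: if_splits)
    then have ne: "Poly_Mapping.keys f \<noteq> {}" using c by auto
    define m where "m = Max (Poly_Mapping.keys f)"
    have "m \<in> Poly_Mapping.keys f" "\<forall>m'\<in>Poly_Mapping.keys f. m' \<le> m"
      using ne unfolding m_def by (auto intro: Max_in)
    moreover have "Poly_Mapping.keys f \<subseteq> mons n i" using keys sub by auto
    moreover have "f \<in> I" using c(1) unfolding f_def .
    ultimately have "m \<notin> ?X" unfolding std_mons_def by blast
    then show False using \<open>m \<in> Poly_Mapping.keys f\<close> keys by auto
  qed
  moreover have mono: "\<exists>c. ?u m - lincomb ?X ?u c \<in> I" if "m \<in> mons n i" for m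
    using that
  proof (induction "card {m' \<in> mons n i. m' < m}" arbitrary: m rule: less_induct)
    case less
    show ?case
    proof (cases "m \<in> ?X")
      case True
      have "lincomb ?X ?u (\<lambda>x. if x = m then 1 else 0) = ?u m"
        by (rule poly_mapping_eqI) (use True in \<open>auto simp: lookup_lincomb_single[OF fin] lookup_single when_def\<close>)
      then show ?thesis using subspD(1)[OF I] by (intro exI[of _ "\<lambda>x. if x = m then 1 else 0"]) simp
    next
      case False
      then obtain f where f: "f \<in> I" "m \<in> Poly_Mapping.keys f" "Poly_Mapping.keys f \<subseteq> mons n i"
        "\<forall>m'\<in>Poly_Mapping.keys f. m' \<le> m"
        using less.prems unfolding std_mons_def by auto
      let ?a = "Poly_Mapping.lookup f m"
      let ?K = "Poly_Mapping.keys f - {m}"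
      have a: "?a \<noteq> 0" using f(2) by (simp add: in_keys_iff)
      have "\<exists>c. ?u m' - lincomb ?X ?u c \<in> I" if "m' \<in> ?K" for m'
      proof (rule less.hyps)
        have "m' < m" "m' \<in> mons n i" using that f by auto
        then have "{x \<in> mons n i. x < m'} \<subset> {x \<in> mons n i. x < m}" by auto
        then show "card {x \<in> mons n i. x < m'} < card {x \<in> mons n i. x < m}"
          by (rule psubset_card_mono[rotated]) (use finite_mons in auto)
        show "m' \<in> mons n i" by fact
      qed
      then obtain C where C: "\<And>m'. m' \<in> ?K \<Longrightarrow> ?u m' - lincomb ?X ?u (C m') \<in> I" by metis
      \<comment> \<open>Comes from solving \<open>f = ?a m + rest\<close> for \<open>m\<close>, with
        the smaller monomials of the rest expressed through \<open>C\<close>.\<close>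
      let ?c = "\<lambda>x. - 1 / ?a * (\<Sum>m'\<in>?K. Poly_Mapping.lookup f m' * C m' x)"
      have "f = Poly_Mapping.single m ?a + (\<Sum>m'\<in>?K. Poly_Mapping.single m' (Poly_Mapping.lookup f m'))"
        using poly_eq_sum_single[of "Poly_Mapping.keys f" f]
          sum.remove[of "Poly_Mapping.keys f" m "\<lambda>m. Poly_Mapping.single m (Poly_Mapping.lookup f m)"] f(2)
        by simp
      then have f_eq: "f = Const ?a * ?u m + lincomb ?K ?u (Poly_Mapping.lookup f)"
        unfolding lincomb_def by (simp add: Const_mult_single)
      have rearr: "f' - (L - L') = P + L'" if "f' = P + L" for f' P L L' :: "'a mpoly"
        using that by simp
      have swap: "lincomb ?K (\<lambda>m'. lincomb ?X ?u (C m')) (Poly_Mapping.lookup f)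
          = lincomb ?X ?u (\<lambda>x. \<Sum>m'\<in>?K. Poly_Mapping.lookup f m' * C m' x)"
        unfolding lincomb_def
        by (simp add: sum_distrib_left sum_distrib_right Const_sum mult.assoc) (rule sum.swap)
      have "lincomb ?K ?u (Poly_Mapping.lookup f) - lincomb ?X ?u (\<lambda>x. \<Sum>m'\<in>?K. Poly_Mapping.lookup f m' * C m' x) \<in> I"
        using lincomb_cong_mod[OF I, of ?K ?u "\<lambda>m'. lincomb ?X ?u (C m')" "Poly_Mapping.lookup f"] C
        unfolding swap by blast
      then have "f - (lincomb ?K ?u (Poly_Mapping.lookup f) - lincomb ?X ?u (\<lambda>x. \<Sum>m'\<in>?K. Poly_Mapping.lookup f m' * C m' x)) \<in> I"
        using subspD(5)[OF I f(1)] by blast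
      then have "Const ?a * ?u m + lincomb ?X ?u (\<lambda>x. \<Sum>m'\<in>?K. Poly_Mapping.lookup f m' * C m' x) \<in> I"
        by (simp only: rearr[OF f_eq])
      then have "Const (1 / ?a) * (Const ?a * ?u m + lincomb ?X ?u (\<lambda>x. \<Sum>m'\<in>?K. Poly_Mapping.lookup f m' * C m' x)) \<in> I"
        by (rule subspD(3)[OF I])
      moreover have "Const (1 / ?a) * (Const ?a * ?u m + lincomb ?X ?u (\<lambda>x. \<Sum>m'\<in>?K. Poly_Mapping.lookup f m' * C m' x))
          = ?u m - lincomb ?X ?u ?c"
        unfolding lincomb_scale using a
        by (simp add: distrib_left mult.assoc[symmetric] flip: Const_simps(6))
      ultimately show ?thesis by metis
    qed
  qed
  moreover have "\<exists>c. v - lincomb ?X ?u c \<in> I" if "v \<in> homog_part n i" for v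
    using that[unfolded homog_part_iff]
  proof (induction v rule: poly_induct)
    case zero
    then show ?case using subspD(1)[OF I] by (intro exI[of _ "\<lambda>_. 0"]) (simp add: lincomb_def)
  next
    case (add p q)
    then obtain c c' where "p - lincomb ?X ?u c \<in> I" "q - lincomb ?X ?u c' \<in> I" by auto
    then have "(p - lincomb ?X ?u c) + (q - lincomb ?X ?u c') \<in> I" by (rule subspD(2)[OF I])
    then have "p + q - lincomb ?X ?u (\<lambda>x. c x + c' x) \<in> I" unfolding lincomb_add by (simp add: algebra_simps)
    then show ?case by blast
  next
    case (single m a)
    then obtain c where "?u m - lincomb ?X ?u c \<in> I" using mono by blast
    then have "Const a * (?u m - lincomb ?X ?u c) \<in> I" by (rule subspD(3)[OF I])
    then have "Poly_Mapping.single m a - lincomb ?X ?u (\<lambda>x. a * c x) \<in> I"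
      unfolding lincomb_scale by (simp add: right_diff_distrib Const_mult_single)
    then show ?case by blast
  qed
  ultimately show ?thesis
    unfolding basis_mod_def spans_mod_def using fin sub by (auto intro: single_homog)
qed


section \<open>The graded quotient algebra\<close>

lemma ideal_poly_ringD:
  assumes "ideal I (poly_ring n)"
  shows "I \<subseteq> polys n" "0 \<in> I" "f \<in> I \<Longrightarrow> g \<in> I \<Longrightarrow> f + g \<in> I"
    "f \<in> I \<Longrightarrow> g \<in> polys n \<Longrightarrow> g * f \<in> I"
proof -
  interpret ideal I "poly_ring n" by fact
  show "I \<subseteq> polys n" by (rule a_subset)
  show "0 \<in> I" using additive_subgroup.zero_closed[OF is_additive_subgroup] by simp
  show "f \<in> I \<Longrightarrow> g \<in> I \<Longrightarrow> f + g \<in> I" using additive_subgroup.a_closed[OF is_additive_subgroup, of f g] by simp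
  show "f \<in> I \<Longrightarrow> g \<in> polys n \<Longrightarrow> g * f \<in> I" using I_l_closed[of f g] by simp
qed

lemma ideal_poly_ringI:
  fixes I :: "'k::field mpoly set"
  assumes "I \<subseteq> polys n" "0 \<in> I" "\<And>f g. f \<in> I \<Longrightarrow> g \<in> I \<Longrightarrow> f + g \<in> I"
    "\<And>f g. f \<in> I \<Longrightarrow> g \<in> polys n \<Longrightarrow> g * f \<in> I"
  shows "ideal I (poly_ring n)"
proof -
  interpret cring "poly_ring n :: 'k mpoly ring" by (rule poly_ring_cring)
  have uminus: "\<ominus>\<^bsub>poly_ring n\<^esub> f = - f" if "f \<in> polys n" for f :: "'k mpoly"
    using that by (intro minus_equality) auto
  show ?thesis
  proof (rule idealI)
    show "subgroup I (add_monoid (poly_ring n))"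
    proof (rule add.subgroupI)
      show "\<ominus>\<^bsub>poly_ring n\<^esub> f \<in> I" if "f \<in> I" for f
        using uminus[of f] assms(1) that assms(4)[OF that, of "- 1"] by auto
    qed (use assms in auto)
  qed (use assms ring_axioms in \<open>auto simp: mult.commute\<close>)
qed

locale graded_ideal =
  fixes n :: nat and I :: "'k::field mpoly set"
  assumes ideal: "ideal I (poly_ring n)"
    and hcomp_closed: "f \<in> I \<Longrightarrow> hcomp i f \<in> I"
begin

lemmas sub_polys = ideal_poly_ringD(1)[OF ideal]
lemmas mult_closed = ideal_poly_ringD(4)[OF ideal]

lemma subsp: "subsp I"
  unfolding subsp_def using ideal_poly_ringD[OF ideal] by auto

lemmas zero_closed = subspD(1)[OF subsp]
lemmas add_closed = subspD(2)[OF subsp]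
lemmas diff_closed = subspD(5)[OF subsp]

end

text \<open>The polynomials all of whose components lie in \<open>I\<close> form an ideal; it
  contains the homogeneous generators and hence \<open>I\<close>. Conversely, a member is the sum of
  its components, which are then homogeneous members.\<close>

lemma homogeneous_ideal_iff:
  fixes I :: "'k::field mpoly set"
  shows "homogeneous_ideal n I \<longleftrightarrow> graded_ideal n I"
proof
  interpret R: cring "poly_ring n :: 'k mpoly ring" by (rule poly_ring_cring)
  assume "homogeneous_ideal n I"
  then obtain B where B: "ideal I (poly_ring n)" "B \<subseteq> (\<Union>i. homog_part n i)" "I = Idl\<^bsub>poly_ring n\<^esub> B"
    unfolding homogeneous_ideal_def by auto
  have B_sub: "B \<subseteq> polys n" using B(2) homog_part_sub by blast
  have BI: "B \<subseteq> I" unfolding B(3) by (rule R.genideal_self[OF B_sub])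
  note ID = ideal_poly_ringD[OF B(1)]
  define J where "J = {f \<in> polys n. \<forall>i. hcomp i f \<in> I}"
  have "ideal J (poly_ring n)"
  proof (rule ideal_poly_ringI)
    fix f g :: "'k mpoly" assume f: "f \<in> J" and g: "g \<in> polys n"
    have "hcomp i (g * f) \<in> I" for i
    proof -
      have "hcomp i (f * q) \<in> I" if "q \<in> homog_part n j" for q j
        using hcomp_mult[OF that, of f i] f ID(2) ID(4)[of "hcomp (i - j) f" q] homog_part_sub[OF that]
        unfolding J_def by (auto simp: mult.commute)
      then have *: "hcomp i (f * hcomp j g) \<in> I" for j using hcomp_homog[OF g] by blast
      have "hcomp i (f * (\<Sum>j\<in>A. hcomp j g)) \<in> I" for A
        by (induction A rule: infinite_finite_induct) (auto simp: ID(2) distrib_left hcomp_add intro: ID(3) *)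
      from this[of "mono_degree ` Poly_Mapping.keys g"] show ?thesis
        unfolding eq_sum_hcomp[symmetric] by (simp add: mult.commute)
    qed
    then show "g * f \<in> J" using f g unfolding J_def by auto
  qed (use ID in \<open>auto simp: J_def hcomp_add\<close>)
  moreover have "B \<subseteq> J"
  proof
    fix b assume b: "b \<in> B"
    then obtain j where j: "b \<in> homog_part n j" using B(2) by auto
    have "hcomp i b \<in> I" for i
      using hcomp_same[OF j] hcomp_other[OF j, of i] b BI ID(2) by (cases "i = j") auto
    then show "b \<in> J" using b B_sub unfolding J_def by auto
  qed
  ultimately have "I \<subseteq> J" unfolding B(3) by (rule R.genideal_minimal)
  then show "graded_ideal n I" using B(1) unfolding J_def by (intro graded_ideal.intro) auto
next
  interpret R: cring "poly_ring n :: 'k mpoly ring" by (rule poly_ring_cring)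
  assume "graded_ideal n I"
  then interpret graded_ideal n I .
  let ?B = "I \<inter> (\<Union>i. homog_part n i)"
  have B: "?B \<subseteq> polys n" using sub_polys by auto
  note ID = ideal_poly_ringD[OF R.genideal_ideal[OF B]]
  have "I \<subseteq> Idl\<^bsub>poly_ring n\<^esub> ?B"
  proof
    fix f assume f: "f \<in> I"
    have "hcomp i f \<in> Idl\<^bsub>poly_ring n\<^esub> ?B" for i
    proof (rule subsetD[OF R.genideal_self[OF B]])
      show "hcomp i f \<in> ?B" using hcomp_closed[OF f] hcomp_homog[of f n i] f sub_polys by auto
    qed
    then have "(\<Sum>i\<in>A. hcomp i f) \<in> Idl\<^bsub>poly_ring n\<^esub> ?B" for A
      by (induction A rule: infinite_finite_induct) (auto intro: ID(2,3))
    from this[of "mono_degree ` Poly_Mapping.keys f"] show "f \<in> Idl\<^bsub>poly_ring n\<^esub> ?B"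
      unfolding eq_sum_hcomp[symmetric] .
  qed
  moreover have "Idl\<^bsub>poly_ring n\<^esub> ?B \<subseteq> I" by (rule R.genideal_minimal[OF ideal]) auto
  ultimately show "homogeneous_ideal n I"
    unfolding homogeneous_ideal_def using ideal by blast
qed

section \<open>Dimensions in the quotient ring and the Lefschetz condition\<close>

context graded_ideal
begin

lemma quot_map_eq_iff: "quot_map n I f = quot_map n I g \<longleftrightarrow> f - g \<in> I"
proof
  have q: "quot_map n I p = (\<lambda>h. h + p) ` I" for p :: "'k mpoly" unfolding a_r_coset_def' by auto
  show "f - g \<in> I" if "quot_map n I f = quot_map n I g"
  proof -
    have "f \<in> quot_map n I f" unfolding q using zero_closed by force
    then show ?thesis unfolding that unfolding q by auto
  qed
  show "quot_map n I f = quot_map n I g" if fg: "f - g \<in> I"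
  proof -
    have "h + f \<in> (\<lambda>h. h + g) ` I" if "h \<in> I" for h
      using add_closed[OF that fg] by (intro image_eqI[of _ _ "h + (f - g)"]) auto
    moreover have "h + g \<in> (\<lambda>h. h + f) ` I" if "h \<in> I" for h
      using diff_closed[OF that fg] by (intro image_eqI[of _ _ "h - (f - g)"]) auto
    ultimately show ?thesis unfolding q by auto
  qed
qed

lemma quot_carrier: "carrier (quot_alg n I) = quot_map n I ` polys n"
  unfolding FactRing_def A_RCOSETS_def' by auto

lemma quot_zero: "\<zero>\<^bsub>quot_alg n I\<^esub> = quot_map n I 0"
  unfolding FactRing_def a_r_coset_def' by auto

lemma quot_one: "\<one>\<^bsub>quot_alg n I\<^esub> = quot_map n I 1"
  unfolding FactRing_def by simp

lemma quot_add:
  assumes "f \<in> polys n" "g \<in> polys n"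
  shows "quot_map n I f \<oplus>\<^bsub>quot_alg n I\<^esub> quot_map n I g = quot_map n I (f + g)"
proof -
  interpret ideal I "poly_ring n" by (rule ideal)
  show ?thesis using ring_hom_add[OF rcos_ring_hom assms] by simp
qed

lemma quot_mult:
  assumes "f \<in> polys n" "g \<in> polys n"
  shows "quot_map n I f \<otimes>\<^bsub>quot_alg n I\<^esub> quot_map n I g = quot_map n I (f * g)"
proof -
  interpret ideal I "poly_ring n" by (rule ideal)
  show ?thesis using ring_hom_mult[OF rcos_ring_hom assms] by simp
qed

lemma quot_cring: "cring (quot_alg n I)"
  by (rule ideal.quotient_is_cring[OF ideal poly_ring_cring])

lemma quot_ring: "ring (quot_alg n I)"
  using quot_cring by (rule cring.axioms(1))

lemma quot_uminus:
  assumes "f \<in> polys n"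
  shows "\<ominus>\<^bsub>quot_alg n I\<^esub> quot_map n I f = quot_map n I (- f)"
proof -
  interpret Q: cring "quot_alg n I" by (rule quot_cring)
  show ?thesis
    using assms by (intro Q.minus_equality) (auto simp: quot_add quot_zero quot_carrier)
qed

lemma quot_pow:
  assumes "f \<in> polys n"
  shows "quot_map n I f [^]\<^bsub>quot_alg n I\<^esub> (j :: nat) = quot_map n I (f ^ j)"
proof -
  interpret Q: cring "quot_alg n I" by (rule quot_cring)
  show ?thesis
    by (induction j) (use assms in \<open>simp_all add: quot_one quot_mult polys_power mult.commute\<close>)
qed

lemma quot_zero_iff: "quot_map n I f = \<zero>\<^bsub>quot_alg n I\<^esub> \<longleftrightarrow> f \<in> I"
  unfolding quot_zero quot_map_eq_iff by simp

lemma scalars_subfield: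
  assumes "1 \<notin> I"
  shows "subfield (scalars n I) (quot_alg n I)"
proof -
  interpret Q: cring "quot_alg n I" by (rule quot_cring)
  have K: "scalars n I = range (\<lambda>c. quot_map n I (Const c))" unfolding scalars_def by auto
  show ?thesis
  proof (rule Q.subfieldI)
    show "subcring (scalars n I) (quot_alg n I)"
    proof (rule Q.subcringI', rule Q.subringI)
      show "scalars n I \<subseteq> carrier (quot_alg n I)" unfolding K quot_carrier by auto
      show "\<one>\<^bsub>quot_alg n I\<^esub> \<in> scalars n I" unfolding K quot_one by (rule range_eqI[of _ _ 1]) simp
      show "\<ominus>\<^bsub>quot_alg n I\<^esub> h \<in> scalars n I" if "h \<in> scalars n I" for h
        using that unfolding K by (auto simp: quot_uminus simp flip: Const_simps(4))
      show "h1 \<otimes>\<^bsub>quot_alg n I\<^esub> h2 \<in> scalars n I" if "h1 \<in> scalars n I" "h2 \<in> scalars n I" for h1 h2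
        using that unfolding K by (auto simp: quot_mult simp flip: Const_simps(6))
      show "h1 \<oplus>\<^bsub>quot_alg n I\<^esub> h2 \<in> scalars n I" if "h1 \<in> scalars n I" "h2 \<in> scalars n I" for h1 h2
        using that unfolding K by (auto simp: quot_add simp flip: Const_simps(3))
    qed
    show "Units (quot_alg n I\<lparr>carrier := scalars n I\<rparr>) = scalars n I - {\<zero>\<^bsub>quot_alg n I\<^esub>}"
    proof (intro equalityI subsetI)
      fix x assume x: "x \<in> Units (quot_alg n I\<lparr>carrier := scalars n I\<rparr>)"
      then obtain c c' where c: "x = quot_map n I (Const c)"
        "quot_map n I (Const c' * Const c) = quot_map n I 1"
        unfolding Units_def K by (auto simp: quot_mult quot_one)
      have "Const c \<notin> I"
      proof
        assume "Const c \<in> I"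
        then have "Const c' * Const c \<in> I" by (rule mult_closed) simp
        moreover have "Const c' * Const c - 1 \<in> I" using c(2) unfolding quot_map_eq_iff .
        ultimately have "Const c' * Const c - (Const c' * Const c - 1) \<in> I" by (rule diff_closed)
        then show False using assms by simp
      qed
      then show "x \<in> scalars n I - {\<zero>\<^bsub>quot_alg n I\<^esub>}" unfolding c(1) quot_zero K
        by (auto simp: quot_map_eq_iff)
    next
      fix x assume "x \<in> scalars n I - {\<zero>\<^bsub>quot_alg n I\<^esub>}"
      then obtain c where "x = quot_map n I (Const c)" "x \<noteq> quot_map n I 0"
        unfolding K quot_zero by blast
      then have c: "x = quot_map n I (Const c)" "Const c \<notin> I" by (simp_all add: quot_map_eq_iff)
      then have "c \<noteq> 0" using zero_closed by auto
      then have "Const (1 / c) * Const c = (1 :: 'k mpoly)"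
        by (simp flip: Const_simps(6) Const_simps(2))
      then have "quot_map n I (Const (1 / c)) \<otimes>\<^bsub>quot_alg n I\<^esub> x = \<one>\<^bsub>quot_alg n I\<^esub>"
        "x \<otimes>\<^bsub>quot_alg n I\<^esub> quot_map n I (Const (1 / c)) = \<one>\<^bsub>quot_alg n I\<^esub>"
        unfolding c(1) by (simp_all add: quot_mult quot_one mult.commute)
      then show "x \<in> Units (quot_alg n I\<lparr>carrier := scalars n I\<rparr>)"
        unfolding Units_def using c(1) by (auto simp: K)
    qed
  qed
qed

lemma line_extension_quot:
  assumes "v \<in> polys n" "E \<subseteq> polys n"
  shows "ring.line_extension (quot_alg n I) (scalars n I) (quot_map n I v) (quot_map n I ` E)
    = quot_map n I ` {Const c * v + e | c e. e \<in> E}"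
proof -
  interpret Q: ring "quot_alg n I" by (rule quot_ring)
  have "Q.line_extension (scalars n I) (quot_map n I v) (quot_map n I ` E)
      = {quot_map n I (Const c) \<otimes>\<^bsub>quot_alg n I\<^esub> quot_map n I v \<oplus>\<^bsub>quot_alg n I\<^esub> quot_map n I e | c e. e \<in> E}"
    unfolding Q.line_extension_def set_add_def' r_coset_def scalars_def by auto
  also have "\<dots> = {quot_map n I (Const c * v + e) | c e. e \<in> E}"
  proof (intro Collect_cong)
    fix a
    have "quot_map n I (Const c) \<otimes>\<^bsub>quot_alg n I\<^esub> quot_map n I v \<oplus>\<^bsub>quot_alg n I\<^esub> quot_map n I e
        = quot_map n I (Const c * v + e)" if "e \<in> E" for c e
      using assms that by (simp add: quot_mult quot_add subset_iff)
    then show "(\<exists>c e. a = quot_map n I (Const c) \<otimes>\<^bsub>quot_alg n I\<^esub> quot_map n I v \<oplus>\<^bsub>quot_alg n I\<^esub> quot_map n I e \<and> e \<in> E)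
        \<longleftrightarrow> (\<exists>c e. a = quot_map n I (Const c * v + e) \<and> e \<in> E)"
      by (intro ex_cong1 rev_conj_cong) simp_all
  qed
  finally show ?thesis by auto
qed

text \<open>\<open>dimension\<close> is built by adjoining one line at a time, and independence
  modulo \<open>I\<close> is what keeps each new vector outside the span of the previous
  ones.\<close>

lemma dimension_lincomb:
  assumes "finite X" "indep_mod I X u" "u ` X \<subseteq> polys n"
  shows "ring.dimension (quot_alg n I) (card X) (scalars n I) (quot_map n I ` range (lincomb X u))"
  using assms
proof (induction X rule: finite_induct)
  interpret Q: ring "quot_alg n I" by (rule quot_ring)
  case empty
  have "range (lincomb {} u) = {0}" unfolding lincomb_def by auto
  then show ?case using Q.zero_dim[of "scalars n I"] by (simp add: quot_zero)
next
  interpret Q: ring "quot_alg n I" by (rule quot_ring)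
  case (insert x X)
  have lc: "lincomb (insert x X) u c = Const (c x) * u x + lincomb X u c" for c
    unfolding lincomb_def using insert.hyps by simp
  have lc0: "lincomb X u c = lincomb (insert x X) u (c(x := 0))" for c
    unfolding lc using insert.hyps by (auto intro!: lincomb_cong)
  have "indep_mod I X u"
    unfolding indep_mod_def
  proof (intro allI impI)
    fix c assume "lincomb X u c \<in> I"
    then have "\<forall>y\<in>insert x X. (c(x := 0)) y = 0"
      using insert.prems(1) unfolding lc0[of c] indep_mod_def by blast
    then show "\<forall>x\<in>X. c x = 0" using insert.hyps by (metis fun_upd_other insert_iff)
  qed
  then have IH: "Q.dimension (card X) (scalars n I) (quot_map n I ` range (lincomb X u))"
    using insert by simp
  have ux: "u x \<in> polys n" using insert by auto
  have sub: "range (lincomb X u) \<subseteq> polys n"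
    using insert.prems(2) subsp_lincomb[OF subsp_polys[of n], of X u] by auto
  have notin: "quot_map n I (u x) \<notin> quot_map n I ` range (lincomb X u)"
  proof
    assume "quot_map n I (u x) \<in> quot_map n I ` range (lincomb X u)"
    then obtain c where "u x - lincomb X u c \<in> I" by (auto simp: quot_map_eq_iff)
    moreover have "u x - lincomb X u c = lincomb (insert x X) u ((\<lambda>y. - c y)(x := 1))"
    proof -
      have "lincomb X u ((\<lambda>y. - c y)(x := 1)) = lincomb X u (\<lambda>y. - 1 * c y)"
        using insert.hyps by (intro lincomb_cong) auto
      then show ?thesis unfolding lc lincomb_scale by simp
    qed
    ultimately have "((\<lambda>y. - c y)(x := 1)) x = 0"
      using insert.prems(1) unfolding indep_mod_def by (metis insertI1)
    then show False by simp
  qed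
  have "range (lincomb (insert x X) u) = {Const c * u x + e | c e. e \<in> range (lincomb X u)}"
  proof (intro equalityI subsetI)
    fix p assume "p \<in> {Const c * u x + e | c e. e \<in> range (lincomb X u)}"
    then obtain a c where "p = Const a * u x + lincomb X u c" by auto
    also have "\<dots> = lincomb (insert x X) u (c(x := a))"
      unfolding lc using insert.hyps by (auto intro!: lincomb_cong)
    finally show "p \<in> range (lincomb (insert x X) u)" by blast
  qed (auto simp: lc)
  then have "Q.line_extension (scalars n I) (quot_map n I (u x)) (quot_map n I ` range (lincomb X u))
      = quot_map n I ` range (lincomb (insert x X) u)"
    using line_extension_quot[OF ux sub] by simp
  moreover have "quot_map n I (u x) \<in> carrier (quot_alg n I)" unfolding quot_carrier using ux by auto
  ultimately show ?case
    using Q.Suc_dim[OF _ notin IH] insert.hyps by simp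
qed

lemma dimension_basis:
  assumes "basis_mod I V X u" "V \<subseteq> polys n" "subsp V"
  shows "ring.dimension (quot_alg n I) (card X) (scalars n I) (quot_map n I ` V)"
proof -
  have X: "finite X" "indep_mod I X u" "u ` X \<subseteq> V" "spans_mod I V X u"
    using assms(1) unfolding basis_mod_def by auto
  have "quot_map n I ` V = quot_map n I ` range (lincomb X u)"
  proof (intro equalityI subsetI)
    fix a assume "a \<in> quot_map n I ` V"
    then obtain v c where "a = quot_map n I v" "v - lincomb X u c \<in> I"
      using X(4) unfolding spans_mod_def by blast
    then show "a \<in> quot_map n I ` range (lincomb X u)" using quot_map_eq_iff by blast
  next
    fix a assume "a \<in> quot_map n I ` range (lincomb X u)"
    then obtain c where c: "a = quot_map n I (lincomb X u c)" by auto
    have "lincomb X u c \<in> V" using X(3) by (intro subsp_lincomb[OF assms(3)]) auto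
    then show "a \<in> quot_map n I ` V" using c by blast
  qed
  then show ?thesis using dimension_lincomb[OF X(1,2)] X(3) assms(2) by auto
qed

lemma hilbert_function_eq_card:
  assumes "1 \<notin> I" "basis_mod I (homog_part n i) X u"
  shows "hilbert_function n I i = card X"
proof -
  interpret Q: ring "quot_alg n I" by (rule quot_ring)
  have "Q.dimension (card X) (scalars n I) (quot_map n I ` homog_part n i)"
    by (rule dimension_basis[OF assms(2) _ subsp_homog_part]) (auto intro: homog_part_sub)
  from Q.dimI[OF scalars_subfield[OF assms(1)] this] show ?thesis
    unfolding hilbert_function_def graded_part_def over_def .
qed

lemma strong_lefschetz_iff:
  "strong_lefschetz n I \<longleftrightarrow> (\<exists>l\<in>homog_part n 1. \<forall>i j.
     (\<forall>f\<in>homog_part n i. l ^ j * f \<in> I \<longrightarrow> f \<in> I) \<or>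
     (\<forall>f\<in>homog_part n (i + j). \<exists>g\<in>homog_part n i. f - l ^ j * g \<in> I))"
proof -
  have "(let \<mu> = (\<lambda>a. (quot_map n I l [^]\<^bsub>quot_alg n I\<^esub> j) \<otimes>\<^bsub>quot_alg n I\<^esub> a) in
       inj_on \<mu> (graded_part n I i) \<or> \<mu> ` graded_part n I i = graded_part n I (i + j)) \<longleftrightarrow>
     (\<forall>f\<in>homog_part n i. l ^ j * f \<in> I \<longrightarrow> f \<in> I) \<or>
     (\<forall>f\<in>homog_part n (i + j). \<exists>g\<in>homog_part n i. f - l ^ j * g \<in> I)"
    if l: "l \<in> homog_part n 1" for l i j
  proof -
    define \<mu> where "\<mu> = (\<lambda>a. (quot_map n I l [^]\<^bsub>quot_alg n I\<^esub> j) \<otimes>\<^bsub>quot_alg n I\<^esub> a)"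
    have lp: "l \<in> polys n" using l by (rule homog_part_sub)
    have \<mu>: "\<mu> (quot_map n I f) = quot_map n I (l ^ j * f)" if "f \<in> homog_part n i" for f
      unfolding \<mu>_def using homog_part_sub[OF that] lp by (simp add: quot_pow quot_mult polys_power)
    have lj: "l ^ j * f \<in> homog_part n (i + j)" if "f \<in> homog_part n i" for f
      using homog_part_mult[OF homog_part_power[OF l] that, of j] by (simp add: add.commute)
    have "inj_on \<mu> (graded_part n I i) \<longleftrightarrow> (\<forall>f\<in>homog_part n i. l ^ j * f \<in> I \<longrightarrow> f \<in> I)"
    proof
      assume inj: "inj_on \<mu> (graded_part n I i)"
      show "\<forall>f\<in>homog_part n i. l ^ j * f \<in> I \<longrightarrow> f \<in> I"
      proof (intro ballI impI)
        fix f assume f: "f \<in> homog_part n i" "l ^ j * f \<in> I"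
        then have "\<mu> (quot_map n I f) = \<mu> (quot_map n I 0)" by (simp add: \<mu> quot_map_eq_iff)
        then have "quot_map n I f = quot_map n I 0"
          using inj_onD[OF inj] f unfolding graded_part_def by blast
        then show "f \<in> I" by (simp add: quot_map_eq_iff)
      qed
    next
      assume inj: "\<forall>f\<in>homog_part n i. l ^ j * f \<in> I \<longrightarrow> f \<in> I"
      show "inj_on \<mu> (graded_part n I i)"
      proof (rule inj_onI)
        fix a b assume ab: "a \<in> graded_part n I i" "b \<in> graded_part n I i" "\<mu> a = \<mu> b"
        then obtain f g where fg: "a = quot_map n I f" "b = quot_map n I g" "f \<in> homog_part n i" "g \<in> homog_part n i"
          unfolding graded_part_def by blast
        then have "l ^ j * f - l ^ j * g \<in> I"
          using ab(3) \<mu>[OF fg(3)] \<mu>[OF fg(4)] by (simp add: quot_map_eq_iff)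
        then have "l ^ j * (f - g) \<in> I" by (simp add: right_diff_distrib)
        then show "a = b" using inj fg by (simp add: quot_map_eq_iff)
      qed
    qed
    moreover have "\<mu> ` graded_part n I i = graded_part n I (i + j) \<longleftrightarrow>
        (\<forall>f\<in>homog_part n (i + j). \<exists>g\<in>homog_part n i. f - l ^ j * g \<in> I)"
    proof -
      have im: "\<mu> ` graded_part n I i = (\<lambda>f. quot_map n I (l ^ j * f)) ` homog_part n i"
        unfolding graded_part_def image_image by (rule image_cong) (use \<mu> in auto)
      have sub: "(\<lambda>f. quot_map n I (l ^ j * f)) ` homog_part n i \<subseteq> graded_part n I (i + j)"
        unfolding graded_part_def using lj by auto
      have "\<mu> ` graded_part n I i = graded_part n I (i + j) \<longleftrightarrow>
          graded_part n I (i + j) \<subseteq> (\<lambda>f. quot_map n I (l ^ j * f)) ` homog_part n i"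
        unfolding im by (rule iffI, erule equalityD2, rule equalityI[OF sub])
      also have "\<dots> \<longleftrightarrow> (\<forall>f\<in>homog_part n (i + j). quot_map n I f \<in> (\<lambda>f. quot_map n I (l ^ j * f)) ` homog_part n i)"
        unfolding graded_part_def by (rule image_subset_iff)
      finally show ?thesis by (simp add: image_iff quot_map_eq_iff)
    qed
    ultimately show ?thesis unfolding \<mu>_def[symmetric] Let_def by simp
  qed
  then show ?thesis
    unfolding strong_lefschetz_def graded_part_def[of n I 1] by simp
qed

section \<open>Socle and Gorenstein condition in terms of polynomials\<close>

text \<open>The preimage of the socle. Testing the variables is enough because they generate the
  irrelevant ideal.\<close>

definition soc :: "'k mpoly set" where
  "soc = {f \<in> polys n. \<forall>v\<le>n. Var v * f \<in> I}"

lemma Var_polys: "v \<le> n \<Longrightarrow> Var v \<in> polys n"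
  using Var_homog[of v n] homog_part_sub by blast

lemma socle_eq: "socle n I = quot_map n I ` soc"
proof -
  interpret Q: cring "quot_alg n I" by (rule quot_cring)
  let ?G = "(quot_map n I \<circ> Var) ` {..n}"
  have G: "?G \<subseteq> carrier (quot_alg n I)" unfolding quot_carrier using Var_polys by auto
  have "f \<in> soc" if f: "f \<in> polys n" "\<forall>b\<in>irrelevant_ideal n I. quot_map n I f \<otimes>\<^bsub>quot_alg n I\<^esub> b = \<zero>\<^bsub>quot_alg n I\<^esub>" for f
  proof -
    have "f * Var v \<in> I" if v: "v \<le> n" for v
    proof -
      have "quot_map n I (Var v) \<in> irrelevant_ideal n I"
        using Q.genideal_self[OF G] v unfolding irrelevant_ideal_def by auto
      then show ?thesis using f quot_mult[OF f(1) Var_polys[OF v]] quot_zero_iff by auto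
    qed
    then show ?thesis using f(1) unfolding soc_def by (simp add: mult.commute)
  qed
  moreover have "quot_map n I f \<otimes>\<^bsub>quot_alg n I\<^esub> b = \<zero>\<^bsub>quot_alg n I\<^esub>"
    if f: "f \<in> soc" and b: "b \<in> irrelevant_ideal n I" for f b
  proof -
    have fp: "f \<in> polys n" using f unfolding soc_def by auto
    \<comment> \<open>The annihilator of \<open>f\<close> modulo \<open>I\<close>. It is an ideal
      containing the variables, so its image contains the irrelevant ideal.\<close>
    define J where "J = {h \<in> polys n. f * h \<in> I}"
    have "ideal J (poly_ring n)"
    proof (rule ideal_poly_ringI)
      fix h g :: "'k mpoly" assume "h \<in> J" "g \<in> polys n"
      then show "g * h \<in> J" using mult_closed[of "f * h" g] unfolding J_def by (auto simp: ac_simps)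
    qed (auto simp: J_def distrib_left zero_closed add_closed)
    then have id: "ideal (quot_map n I ` J) (quot_alg n I)"
      using ring.ring_ideal_imp_quot_ideal[OF cring.axioms(1)[OF poly_ring_cring] ideal] by blast
    have "Var v \<in> J" if "v \<le> n" for v
      using f Var_polys[OF that] that unfolding J_def soc_def by (auto simp: mult.commute)
    then have "?G \<subseteq> quot_map n I ` J" by auto
    from Q.genideal_minimal[OF id this] obtain h where h: "b = quot_map n I h" "h \<in> J"
      using b unfolding irrelevant_ideal_def by auto
    then show ?thesis using fp quot_mult[of f h] unfolding J_def by (simp add: quot_zero_iff)
  qed
  ultimately show ?thesis unfolding socle_def quot_carrier soc_def by (auto; blast?)
qed

lemma subsp_soc: "subsp soc"
proof -
  have "Var v * (Const c * p) \<in> I" if "Var v * p \<in> I" for v c p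
    using mult_closed[OF that, of "Const c"] by (simp add: ac_simps)
  then show ?thesis
    unfolding subsp_def soc_def by (auto simp: distrib_left zero_closed add_closed)
qed

lemma gorenstein_iff:
  assumes "1 \<notin> I"
  shows "gorenstein n I \<longleftrightarrow> (\<exists>e\<in>soc. e \<notin> I \<and> (\<forall>f\<in>soc. \<exists>c. f - Const c * e \<in> I))"
proof
  interpret Q: ring "quot_alg n I" by (rule quot_ring)
  assume "gorenstein n I"
  then have "Q.dimension 1 (scalars n I) (socle n I)" unfolding gorenstein_def .
  then obtain v E where v: "v \<in> carrier (quot_alg n I)" "v \<notin> E" "Q.dimension 0 (scalars n I) E"
    "socle n I = Q.line_extension (scalars n I) v E"
    by (cases rule: Q.dimension.cases) auto
  have E: "E = quot_map n I ` {0}" using Q.dimension_zero[OF scalars_subfield[OF assms] v(3)] by (simp add: quot_zero)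
  obtain e where e: "v = quot_map n I e" "e \<in> polys n" using v(1) unfolding quot_carrier by auto
  have "quot_map n I ` soc = quot_map n I ` {Const c * e + 0 | c. True}"
    using v(4) line_extension_quot[OF e(2), of "{0}"] unfolding e(1) E socle_eq by auto
  then have soc: "quot_map n I ` soc = range (\<lambda>c. quot_map n I (Const c * e))" by auto
  have "quot_map n I (Const 1 * e) \<in> quot_map n I ` soc" unfolding soc by blast
  then obtain f where f: "f \<in> soc" "e - f \<in> I" by (auto simp: quot_map_eq_iff)
  have "Var w * e \<in> I" if "w \<le> n" for w
  proof -
    have "Var w * f + Var w * (e - f) \<in> I"
      using f that mult_closed[OF f(2) Var_polys[OF that]] by (intro add_closed) (auto simp: soc_def)
    then show ?thesis by (simp add: right_diff_distrib)
  qed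
  then have "e \<in> soc" using e(2) unfolding soc_def by auto
  moreover have "e \<notin> I" using v(2) unfolding e(1) E by (simp add: quot_map_eq_iff)
  moreover have "\<exists>c. f - Const c * e \<in> I" if "f \<in> soc" for f
  proof -
    have "quot_map n I f \<in> range (\<lambda>c. quot_map n I (Const c * e))" using that soc by blast
    then show ?thesis by (auto simp: quot_map_eq_iff)
  qed
  ultimately show "\<exists>e\<in>soc. e \<notin> I \<and> (\<forall>f\<in>soc. \<exists>c. f - Const c * e \<in> I)" by blast
next
  assume "\<exists>e\<in>soc. e \<notin> I \<and> (\<forall>f\<in>soc. \<exists>c. f - Const c * e \<in> I)"
  then obtain e where e: "e \<in> soc" "e \<notin> I" "\<And>f. f \<in> soc \<Longrightarrow> \<exists>c. f - Const c * e \<in> I" by blast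
  have "indep_mod I {()} (\<lambda>_. e)"
    unfolding indep_mod_def lincomb_def
  proof (intro allI impI ballI, rule ccontr)
    fix c :: "unit \<Rightarrow> 'k" and x :: unit
    assume c: "(\<Sum>x\<in>{()}. Const (c x) * e) \<in> I" "c x \<noteq> 0"
    then have "Const (1 / c ()) * (Const (c ()) * e) \<in> I" using subspD(3)[OF subsp] by simp
    then have "Const (1 / c () * c ()) * e \<in> I" by (simp only: Const_simps mult.assoc)
    then show False using c(2) e(2) by simp
  qed
  moreover have "spans_mod I soc {()} (\<lambda>_. e)"
    unfolding spans_mod_def lincomb_def using e(3) by fastforce
  ultimately have "basis_mod I soc {()} (\<lambda>_. e)"
    unfolding basis_mod_def using e(1) by auto
  from dimension_basis[OF this _ subsp_soc] show "gorenstein n I"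
    unfolding gorenstein_def socle_eq by (auto simp: soc_def)
qed

text \<open>Otherwise the quotient is the zero ring, which has no proper ideal and hence no prime to
  start a chain.\<close>

lemma krull_dim_imp_nontrivial:
  assumes "has_krull_dim (quot_alg n I) 0"
  shows "1 \<notin> I"
proof
  assume 1: "1 \<in> I"
  obtain P where "prime_chain (quot_alg n I) 0 P" using assms unfolding has_krull_dim_def by auto
  then have "primeideal (P 0) (quot_alg n I)" unfolding prime_chain_def by auto
  then interpret primeideal "P 0" "quot_alg n I" .
  have "f \<in> I" if "f \<in> polys n" for f using mult_closed[OF 1 that] by simp
  then have "quot_map n I f = \<zero>\<^bsub>quot_alg n I\<^esub>" if "f \<in> polys n" for f
    using that by (simp only: quot_zero_iff)
  then have "carrier (quot_alg n I) \<subseteq> {\<zero>\<^bsub>quot_alg n I\<^esub>}" unfolding quot_carrier by blast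
  then have "carrier (quot_alg n I) \<subseteq> P 0"
    using additive_subgroup.zero_closed[OF is_additive_subgroup] by auto
  then show False using I_notcarr a_subset by blast
qed

end

section \<open>Constant terms and Krull dimension zero\<close>

text \<open>Makes the polynomials without constant term a prime ideal; its image is the only
  candidate for a prime of the quotient.\<close>

lemma lookup_mult_0:
  fixes f g :: "'k::field mpoly"
  shows "Poly_Mapping.lookup (f * g) 0 = Poly_Mapping.lookup f 0 * Poly_Mapping.lookup g 0"
proof -
  have z: "Poly_Mapping.lookup (p * q) 0 = 0" if "Poly_Mapping.lookup p 0 = 0" for p q :: "'k mpoly"
  proof (rule ccontr)
    assume "Poly_Mapping.lookup (p * q) 0 \<noteq> 0"
    then have "0 \<in> Poly_Mapping.keys (p * q)" by (simp add: in_keys_iff)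
    then obtain a b where ab: "0 = a + b" "a \<in> Poly_Mapping.keys p" using Poly_Mapping.keys_mult[of p q] by blast
    have "mono_degree a + mono_degree b = 0" unfolding mono_degree_add[symmetric] ab(1)[symmetric] by simp
    then show False using ab(2) that by (simp add: in_keys_iff)
  qed
  have "f * g = (f - Const (Poly_Mapping.lookup f 0)) * g + Const (Poly_Mapping.lookup f 0) * g"
    by (simp add: algebra_simps)
  moreover have "Poly_Mapping.lookup ((f - Const (Poly_Mapping.lookup f 0)) * g) 0 = 0"
    by (rule z) (simp add: lookup_minus Const_def)
  ultimately show ?thesis by (simp add: lookup_add)
qed

lemma keys_power_degree:
  fixes f :: "'k::field mpoly"
  assumes "Poly_Mapping.lookup f 0 = 0" "m \<in> Poly_Mapping.keys (f ^ j)"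
  shows "j \<le> mono_degree m"
  using assms(2)
proof (induction j arbitrary: m)
  case (Suc j)
  then obtain a b where ab: "m = a + b" "a \<in> Poly_Mapping.keys f" "b \<in> Poly_Mapping.keys (f ^ j)"
    using Poly_Mapping.keys_mult[of f "f ^ j"] by auto
  have "a \<noteq> 0" using ab(2) assms(1) by (auto simp: in_keys_iff)
  then have "mono_degree a \<noteq> 0" by simp
  then show ?case using Suc.IH[OF ab(3)] unfolding ab(1) mono_degree_add by linarith
qed simp

context graded_ideal
begin

lemma in_ideal_of_large_degree:
  assumes "\<And>i. i > d \<Longrightarrow> homog_part n i \<subseteq> I" "f \<in> polys n" "\<And>m. m \<in> Poly_Mapping.keys f \<Longrightarrow> d < mono_degree m"
  shows "f \<in> I"
proof -
  have "(\<Sum>i\<in>mono_degree ` Poly_Mapping.keys f. hcomp i f) \<in> I"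
    using assms hcomp_homog[OF assms(2)] by (intro subsp_sum[OF subsp]) blast
  then show ?thesis unfolding eq_sum_hcomp[symmetric] .
qed

text \<open>An element without constant term is nilpotent, its power \<open>Suc d\<close> having
  terms only in degrees above \<open>d\<close>, so it lies in every prime. A prime containing
  anything else contains a nonzero constant, which is a unit. Hence there is exactly one
  prime.\<close>

lemma krull_dim_0I:
  assumes "1 \<notin> I" "\<And>i. i > d \<Longrightarrow> homog_part n i \<subseteq> I"
  shows "has_krull_dim (quot_alg n I) 0"
proof -
  interpret Q: cring "quot_alg n I" by (rule quot_cring)
  define M where "M = {f \<in> polys n :: 'k mpoly set. Poly_Mapping.lookup f 0 = 0}"
  have IM: "f \<in> M" if "f \<in> I" for f
  proof (rule ccontr)
    assume "f \<notin> M"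
    then have c: "Poly_Mapping.lookup f 0 \<noteq> 0" using that sub_polys unfolding M_def by auto
    have "hcomp 0 f = Const (Poly_Mapping.lookup f 0)"
      by (rule poly_mapping_eqI) (auto simp: lookup_hcomp Const_def lookup_single when_def)
    then have "Const (Poly_Mapping.lookup f 0) \<in> I" using hcomp_closed[OF that, of 0] by simp
    then have "Const (1 / Poly_Mapping.lookup f 0) * Const (Poly_Mapping.lookup f 0) \<in> I"
      by (rule mult_closed) simp
    then show False using c assms(1) by (simp flip: Const_simps(6))
  qed
  have idM: "ideal M (poly_ring n)"
    by (rule ideal_poly_ringI) (auto simp: M_def lookup_add lookup_mult_0)
  define MQ where "MQ = quot_map n I ` M"
  have memMQ: "quot_map n I f \<in> MQ \<longleftrightarrow> f \<in> M" if "f \<in> polys n" for f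
  proof
    assume "quot_map n I f \<in> MQ"
    then obtain g where g: "g \<in> M" "f - g \<in> I" unfolding MQ_def by (auto simp: quot_map_eq_iff)
    then have "(f - g) + g \<in> M" using IM ideal_poly_ringD(3)[OF idM] by blast
    then show "f \<in> M" by simp
  qed (simp add: MQ_def)
  have "primeideal MQ (quot_alg n I)"
  proof (rule primeidealI[OF _ quot_cring])
    show "ideal MQ (quot_alg n I)"
      unfolding MQ_def using ring.ring_ideal_imp_quot_ideal[OF cring.axioms(1)[OF poly_ring_cring] ideal idM] .
    have "quot_map n I 1 \<notin> MQ" using memMQ[of 1] by (simp add: M_def)
    moreover have "quot_map n I 1 \<in> carrier (quot_alg n I)" unfolding quot_carrier by auto
    ultimately show "carrier (quot_alg n I) \<noteq> MQ" by blast
    show "a \<in> MQ \<or> b \<in> MQ" if ab: "a \<in> carrier (quot_alg n I)" "b \<in> carrier (quot_alg n I)" "a \<otimes>\<^bsub>quot_alg n I\<^esub> b \<in> MQ" for a b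
    proof -
      obtain f g where fg: "a = quot_map n I f" "b = quot_map n I g" "f \<in> polys n" "g \<in> polys n"
        using ab unfolding quot_carrier by auto
      then have "f * g \<in> M" using ab(3) memMQ[of "f * g"] by (simp add: quot_mult)
      then have "f \<in> M \<or> g \<in> M" using fg unfolding M_def by (simp add: lookup_mult_0)
      then show ?thesis using fg memMQ by auto
    qed
  qed
  moreover have "P = MQ" if "primeideal P (quot_alg n I)" for P
  proof -
    interpret P: primeideal P "quot_alg n I" by fact
    have "quot_map n I f \<in> P" if f: "f \<in> M" for f
    proof -
      have fp: "f \<in> polys n" using f unfolding M_def by auto
      have "f ^ Suc d \<in> I"
      proof (rule in_ideal_of_large_degree[OF assms(2)])
        show "d < mono_degree m" if "m \<in> Poly_Mapping.keys (f ^ Suc d)" for m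
          using keys_power_degree[of f m "Suc d"] that f unfolding M_def by auto
      qed (use fp polys_power in auto)
      then have 0: "quot_map n I (f ^ Suc d) \<in> P"
        using quot_zero_iff additive_subgroup.zero_closed[OF P.is_additive_subgroup] by metis
      have "quot_map n I f \<in> P" if "quot_map n I (f ^ Suc j) \<in> P" for j
        using that
      proof (induction j)
        case (Suc j)
        have "quot_map n I f \<otimes>\<^bsub>quot_alg n I\<^esub> quot_map n I (f ^ Suc j) \<in> P"
          using Suc.prems fp by (simp add: quot_mult polys_power)
        then show ?case
          using P.I_prime[of "quot_map n I f" "quot_map n I (f ^ Suc j)"] Suc.IH fp polys_power[OF fp, of "Suc j"]
          unfolding quot_carrier by blast
      qed simp
      then show ?thesis using 0 by blast
    qed
    then have sub: "MQ \<subseteq> P" unfolding MQ_def by auto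
    have "P \<subseteq> MQ"
    proof
      fix a assume a: "a \<in> P"
      then obtain f where f: "a = quot_map n I f" "f \<in> polys n" using P.a_subset unfolding quot_carrier by auto
      show "a \<in> MQ"
      proof (rule ccontr)
        assume "a \<notin> MQ"
        then have c: "Poly_Mapping.lookup f 0 \<noteq> 0" using f memMQ unfolding M_def by auto
        let ?c = "Poly_Mapping.lookup f 0"
        have "Const ?c - f \<in> M" using f(2) unfolding M_def by (simp add: lookup_minus) (simp add: Const_def)
        then have "quot_map n I (Const ?c - f) \<in> P" using sub memMQ[of "Const ?c - f"] unfolding M_def by auto
        then have "quot_map n I (Const ?c - f) \<oplus>\<^bsub>quot_alg n I\<^esub> quot_map n I f \<in> P"
          using a f(1) additive_subgroup.a_closed[OF P.is_additive_subgroup] by blast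
        then have "quot_map n I (Const ?c) \<in> P" using f(2) by (simp add: quot_add)
        then have "quot_map n I (Const (1 / ?c)) \<otimes>\<^bsub>quot_alg n I\<^esub> quot_map n I (Const ?c) \<in> P"
          by (intro P.I_l_closed) (auto simp: quot_carrier)
        then have "\<one>\<^bsub>quot_alg n I\<^esub> \<in> P" using c by (simp add: quot_mult quot_one flip: Const_simps(6)) 
        then show False using P.one_imp_carrier P.I_notcarr by simp
      qed
    qed
    then show ?thesis using sub by blast
  qed
  ultimately show ?thesis
    unfolding has_krull_dim_def prime_chain_def
  proof (intro conjI allI impI)
    assume a: "\<And>P. primeideal P (quot_alg n I) \<Longrightarrow> P = MQ" "primeideal MQ (quot_alg n I)"
    show "\<exists>P. (\<forall>i\<le>0. primeideal (P i) (quot_alg n I)) \<and> (\<forall>i<0. P i \<subset> P (Suc i))"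
      using a(2) by (intro exI[of _ "\<lambda>_. MQ"]) auto
    fix l P assume P: "(\<forall>i\<le>l. primeideal (P i) (quot_alg n I)) \<and> (\<forall>i<l. P i \<subset> P (Suc i))"
    show "l \<le> 0"
    proof (rule ccontr)
      assume "\<not> l \<le> 0"
      then have "P 0 \<subset> P 1" "P 0 = MQ" "P 1 = MQ" using P a(1) by auto
      then show False by auto
    qed
  qed
qed

end


section \<open>Hilbert functions of Gorenstein algebras with a Lefschetz element\<close>

text \<open>Bridges the exponent vectors of the ring and the multisets of the combinatorial
  part.\<close>

definition mset_of_mon :: "monomial \<Rightarrow> nat multiset" where
  "mset_of_mon m = Abs_multiset (Poly_Mapping.lookup m)"

lemma count_mset_of_mon [simp]: "count (mset_of_mon m) v = Poly_Mapping.lookup m v"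
proof -
  have "{v. 0 < Poly_Mapping.lookup m v} = Poly_Mapping.keys m" by (auto simp: in_keys_iff)
  then show ?thesis unfolding mset_of_mon_def by (simp add: count_Abs_multiset)
qed

lemma set_mset_of_mon: "set_mset (mset_of_mon m) = Poly_Mapping.keys m"
  by (auto simp: in_keys_iff simp flip: count_greater_zero_iff)

lemma size_mset_of_mon: "size (mset_of_mon m) = mono_degree m"
  unfolding size_multiset_overloaded_eq mono_degree_def set_mset_of_mon by simp

lemma inj_mset_of_mon: "inj mset_of_mon"
  by (rule injI, rule poly_mapping_eqI) (metis count_mset_of_mon)

lemma mon_remove:
  assumes "v \<in> Poly_Mapping.keys (m :: monomial)"
  obtains m' where "m = m' + Poly_Mapping.single v 1"
proof
  show "m = (m - Poly_Mapping.single v 1) + Poly_Mapping.single v 1"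
    by (rule poly_mapping_eqI)
      (use assms in \<open>auto simp: lookup_add lookup_minus lookup_single when_def in_keys_iff\<close>)
qed

lemma single_add_mon:
  "Poly_Mapping.single (m + Poly_Mapping.single v 1) c = Var v * Poly_Mapping.single m (c :: 'k::field)"
  unfolding Var_def by (simp add: mult_single add.commute)

section \<open>Standard monomials as an order ideal\<close>

context graded_ideal
begin

abbreviation stdm :: "nat \<Rightarrow> monomial set" where "stdm i \<equiv> std_mons I n i"

abbreviation bmon :: "monomial \<Rightarrow> 'k mpoly" where "bmon m \<equiv> Poly_Mapping.single m 1"

lemma stdm_basis: "basis_mod I (homog_part n i) (stdm i) bmon"
  by (rule basis_std_mons[OF subsp])

lemma finite_stdm: "finite (stdm i)"
  using stdm_basis unfolding basis_mod_def by blast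

lemma stdm_mons: "stdm i \<subseteq> mons n i"
  unfolding std_mons_def by auto

text \<open>If \<open>m\<close> leads a member of \<open>I\<close>, then its multiple by a variable
  leads the multiple of that member, because the monomial order is compatible with addition of
  exponents.\<close>

lemma stdm_down:
  assumes "m + Poly_Mapping.single v 1 \<in> stdm (Suc i)"
  shows "m \<in> stdm i"
proof -
  let ?s = "Poly_Mapping.single v (1 :: nat)"
  have ms: "m + ?s \<in> mons n (Suc i)" using assms stdm_mons by auto
  then have m: "m \<in> mons n i" "v \<le> n"
    unfolding mons_def by (auto simp: keys_add_monomial mono_degree_add)
  show ?thesis
  proof (rule ccontr)
    assume "m \<notin> stdm i"
    then obtain f where f: "f \<in> I" "m \<in> Poly_Mapping.keys f" "Poly_Mapping.keys f \<subseteq> mons n i"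
      "\<forall>m'\<in>Poly_Mapping.keys f. m' \<le> m"
      using m unfolding std_mons_def by auto
    have look: "Poly_Mapping.lookup (Var v * f) (a + ?s) = Poly_Mapping.lookup f a" for a
    proof -
      have "Poly_Mapping.lookup (Var v * p) (a + ?s) = Poly_Mapping.lookup p a" for p :: "'k mpoly"
        by (rule poly_induct[of p UNIV])
          (auto simp: distrib_left lookup_add lookup_single when_def simp flip: single_add_mon[simplified])
      then show ?thesis .
    qed
    have keys: "\<exists>a\<in>Poly_Mapping.keys f. b = a + ?s" if "b \<in> Poly_Mapping.keys (Var v * f)" for b
      using Poly_Mapping.keys_mult[of "Var v" f] that unfolding Var_def by (auto simp: add.commute)
    have "Var v * f \<in> I" using mult_closed[OF f(1) Var_polys[OF m(2)]] .
    moreover have "m + ?s \<in> Poly_Mapping.keys (Var v * f)" using look[of m] f(2) by (simp add: in_keys_iff)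
    moreover have "Poly_Mapping.keys (Var v * f) \<subseteq> mons n (Suc i)"
    proof
      fix b assume "b \<in> Poly_Mapping.keys (Var v * f)"
      then obtain a where "a \<in> Poly_Mapping.keys f" "b = a + ?s" using keys by auto
      then show "b \<in> mons n (Suc i)" using f(3) m(2) mons_add[of a n i ?s 1] by (auto simp: mons_def)
    qed
    moreover have "\<forall>b\<in>Poly_Mapping.keys (Var v * f). b \<le> m + ?s"
      using keys f(4) by (metis add_right_mono)
    ultimately have "m + ?s \<notin> stdm (Suc i)" unfolding std_mons_def by blast
    then show False using assms by simp
  qed
qed

theorem macaulay_bound:
  assumes "1 \<le> i"
  shows "card (stdm (Suc i)) \<le> mgrowth i (card (stdm i))"
proof -
  let ?T = "mset_of_mon ` stdm (Suc i)"
  have c: "card (mset_of_mon ` A) = card A" for A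
    by (rule card_image) (rule inj_on_subset[OF inj_mset_of_mon], simp)
  have "card ?T \<le> mgrowth i (card (shadow ?T))"
  proof (rule macaulay_shadow)
    show "finite ?T" using finite_stdm by auto
    show "size f = Suc i" "set_mset f \<subseteq> {..<Suc n}" if "f \<in> ?T" for f
      using that subsetD[OF stdm_mons[of "Suc i"]]
      by (fastforce simp: size_mset_of_mon set_mset_of_mon mons_def lessThan_Suc_atMost)+
  qed (use assms in auto)
  also have "shadow ?T \<subseteq> mset_of_mon ` stdm i"
  proof
    fix M assume "M \<in> shadow ?T"
    then obtain x m where m: "add_mset x M = mset_of_mon m" "m \<in> stdm (Suc i)" unfolding shadow_def by auto
    have "x \<in> Poly_Mapping.keys m" using m(1) set_mset_of_mon[of m] by (metis union_single_eq_member)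
    then obtain m' where m': "m = m' + Poly_Mapping.single x 1" by (rule mon_remove)
    have "mset_of_mon m = add_mset x (mset_of_mon m')"
      unfolding m' by (rule multiset_eqI) (simp add: lookup_add lookup_single when_def)
    then have "M = mset_of_mon m'" using m(1) by simp
    then show "M \<in> mset_of_mon ` stdm i" using stdm_down m(2) unfolding m' by auto
  qed
  then have "mgrowth i (card (shadow ?T)) \<le> mgrowth i (card (stdm i))"
    using card_mono[of "mset_of_mon ` stdm i" "shadow ?T"] finite_stdm[of i] assms by (intro mgrowth_mono) (auto simp: c)
  finally show ?thesis unfolding c .
qed

lemma stdm_0:
  assumes "1 \<notin> I" shows "card (stdm 0) = 1"
proof -
  have "basis_mod I (homog_part n 0) {()} (\<lambda>_. 1)"
    unfolding basis_mod_def indep_mod_def spans_mod_def lincomb_def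
  proof (intro conjI allI impI ballI)
    fix c :: "unit \<Rightarrow> 'k" and x
    assume "(\<Sum>x\<in>{()}. Const (c x) * 1) \<in> I"
    then have "Const (1 / c ()) * Const (c ()) \<in> I" by (intro mult_closed) auto
    then have "Const (1 / c () * c ()) \<in> I" by (simp only: Const_simps)
    then show "c x = 0" using assms by (cases "c x = 0") auto
  next
    fix f :: "'k mpoly" assume f: "f \<in> homog_part n 0"
    have "f = Const (Poly_Mapping.lookup f 0)"
      using f by (intro poly_mapping_eqI) (auto simp: homog_part_iff mons_def Const_def lookup_single when_def in_keys_iff subset_iff)
    then show "\<exists>c. f - (\<Sum>x\<in>{()}. Const (c x) * 1) \<in> I"
      by (intro exI[of _ "\<lambda>_. Poly_Mapping.lookup f 0"]) (simp add: zero_closed)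
  qed auto
  then show ?thesis using basis_card_eq[OF subsp stdm_basis[of 0], of "{()}" "\<lambda>_. 1"] by simp
qed

section \<open>Multiplication maps between graded parts\<close>

lemma card_stdm_inj:
  assumes "l \<in> homog_part n j" "\<And>f. f \<in> homog_part n i \<Longrightarrow> l * f \<in> I \<Longrightarrow> f \<in> I"
  shows "indep_mod I (stdm i) (\<lambda>m. l * bmon m)" "(\<lambda>m. l * bmon m) ` stdm i \<subseteq> homog_part n (j + i)"
    "card (stdm i) \<le> card (stdm (j + i))"
proof -
  have H: "lincomb (stdm i) bmon c \<in> homog_part n i" for c
    using stdm_mons by (intro subsp_lincomb[OF subsp_homog_part] single_homog) auto
  show 1: "indep_mod I (stdm i) (\<lambda>m. l * bmon m)"
    unfolding indep_mod_def lincomb_mult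
    using assms(2)[OF H] stdm_basis[of i] unfolding basis_mod_def indep_mod_def by blast
  show 2: "(\<lambda>m. l * bmon m) ` stdm i \<subseteq> homog_part n (j + i)"
    using stdm_mons by (auto intro!: homog_part_mult[OF assms(1)] single_homog)
  show "card (stdm i) \<le> card (stdm (j + i))"
    using stdm_basis[of "j + i"] indep_card_le[OF subsp finite_stdm finite_stdm 1 _ 2, where w = bmon]
    by (simp add: basis_mod_def)
qed

text \<open>Preimages of a basis are independent, since a relation among them could be multiplied by
  \<open>l\<close>.\<close>

lemma card_stdm_surj:
  assumes "l \<in> homog_part n j" "\<And>f. f \<in> homog_part n (i + j) \<Longrightarrow> \<exists>g\<in>homog_part n i. f - l * g \<in> I"
  shows "card (stdm (i + j)) \<le> card (stdm i)"
proof -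
  have "\<forall>m\<in>stdm (i + j). \<exists>g\<in>homog_part n i. bmon m - l * g \<in> I"
    using assms(2) single_homog stdm_mons by blast
  then obtain G where G: "\<And>m. m \<in> stdm (i + j) \<Longrightarrow> G m \<in> homog_part n i"
    "\<And>m. m \<in> stdm (i + j) \<Longrightarrow> bmon m - l * G m \<in> I" by metis
  have "indep_mod I (stdm (i + j)) G"
    unfolding indep_mod_def
  proof (intro allI impI)
    fix c assume "lincomb (stdm (i + j)) G c \<in> I"
    then have "l * lincomb (stdm (i + j)) G c \<in> I" using mult_closed homog_part_sub[OF assms(1)] by blast
    then have "lincomb (stdm (i + j)) (\<lambda>m. l * G m) c \<in> I" unfolding lincomb_mult .
    moreover have "lincomb (stdm (i + j)) bmon c - lincomb (stdm (i + j)) (\<lambda>m. l * G m) c \<in> I"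
      by (rule lincomb_cong_mod[OF subsp G(2)])
    ultimately have "lincomb (stdm (i + j)) bmon c \<in> I" using add_closed by fastforce
    then show "\<forall>x\<in>stdm (i + j). c x = 0"
      using stdm_basis[of "i + j"] unfolding basis_mod_def indep_mod_def by blast
  qed
  then show ?thesis
    using stdm_basis[of i] image_subsetI[of "stdm (i + j)" G "homog_part n i", OF G(1)]
      indep_card_le[OF subsp finite_stdm finite_stdm, where u = G and V = "homog_part n i" and w = bmon]
    by (simp add: basis_mod_def)
qed

lemma surj_if_inj_card:
  assumes "l \<in> homog_part n j" "\<And>f. f \<in> homog_part n i \<Longrightarrow> l * f \<in> I \<Longrightarrow> f \<in> I"
    "card (stdm (j + i)) \<le> card (stdm i)" "f \<in> homog_part n (j + i)"
  shows "\<exists>g\<in>homog_part n i. f - l * g \<in> I"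
proof -
  have "spans_mod I (homog_part n (j + i)) (stdm i) (\<lambda>m. l * bmon m)"
  proof (rule indep_card_eq_spans[OF subsp finite_stdm _ _ finite_stdm _ assms(3)])
    show "indep_mod I (stdm i) (\<lambda>m. l * bmon m)" by (rule card_stdm_inj(1)[OF assms(1,2)])
    show "(\<lambda>m. l * bmon m) ` stdm i \<subseteq> homog_part n (j + i)" by (rule card_stdm_inj(2)[OF assms(1,2)])
    show "spans_mod I (homog_part n (j + i)) (stdm (j + i)) bmon"
      using stdm_basis[of "j + i"] by (simp add: basis_mod_def)
  qed
  then obtain c where "f - l * lincomb (stdm i) bmon c \<in> I"
    using assms(4) unfolding spans_mod_def lincomb_mult by blast
  moreover have "lincomb (stdm i) bmon c \<in> homog_part n i"
    using stdm_mons by (intro subsp_lincomb[OF subsp_homog_part] single_homog) auto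
  ultimately show ?thesis by blast
qed

text \<open>The algebra is generated in degree one: a monomial is a variable times one of lower
  degree, and the variable can be moved into the preimage.\<close>

lemma surj_Suc:
  assumes l: "l \<in> homog_part n 1" and surj: "\<And>f. f \<in> homog_part n (Suc i) \<Longrightarrow> \<exists>g\<in>homog_part n i. f - l * g \<in> I"
    and f: "f \<in> homog_part n (Suc (Suc i))"
  shows "\<exists>g\<in>homog_part n (Suc i). f - l * g \<in> I"
  using f[unfolded homog_part_iff]
proof (induction f rule: poly_induct)
  case zero
  then show ?case by (intro bexI[of _ 0]) (auto simp: zero_closed)
next
  case (add p q)
  then obtain g h where gh: "g \<in> homog_part n (Suc i)" "h \<in> homog_part n (Suc i)" "p - l * g \<in> I" "q - l * h \<in> I" by blast
  then have "(p - l * g) + (q - l * h) \<in> I" by (intro add_closed)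
  then have "p + q - l * (g + h) \<in> I" by (simp add: algebra_simps)
  then show ?case using gh by (intro bexI[of _ "g + h"]) auto
next
  case (single m c)
  then have "m \<noteq> 0" by (auto simp: mons_def)
  then have "Poly_Mapping.keys m \<noteq> {}" by simp
  then obtain v where v: "v \<in> Poly_Mapping.keys m" by blast
  then obtain m' where m': "m = m' + Poly_Mapping.single v 1" by (rule mon_remove)
  have m'm: "m' \<in> mons n (Suc i)" "v \<le> n"
    using single unfolding m' mons_def by (auto simp: keys_add_monomial mono_degree_add)
  then obtain g where g: "g \<in> homog_part n i" "Poly_Mapping.single m' c - l * g \<in> I"
    using surj[OF single_homog] by blast
  have "Var v * (Poly_Mapping.single m' c - l * g) \<in> I" by (rule mult_closed[OF g(2) Var_polys[OF m'm(2)]])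
  then have "Poly_Mapping.single m c - l * (Var v * g) \<in> I"
    unfolding m' single_add_mon by (simp add: right_diff_distrib ac_simps)
  moreover have "Var v * g \<in> homog_part n (Suc i)" using homog_part_mult[OF Var_homog[OF m'm(2)] g(1)] by simp
  ultimately show ?case by blast
qed

section \<open>The algebra modulo a linear form\<close>

text \<open>The ideal \<open>I + l S\<close>, whose quotient is \<open>A/lA\<close>.\<close>

definition quot_by :: "'k mpoly \<Rightarrow> 'k mpoly set" where
  "quot_by l = {f \<in> polys n. \<exists>g\<in>polys n. f - l * g \<in> I}"

lemma graded_quot_by:
  assumes l: "l \<in> homog_part n 1"
  shows "graded_ideal n (quot_by l)"
proof (rule graded_ideal.intro)
  show "ideal (quot_by l) (poly_ring n)"
  proof (rule ideal_poly_ringI)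
    show "quot_by l \<subseteq> polys n" "0 \<in> quot_by l"
      unfolding quot_by_def by (auto intro!: bexI[of _ 0] simp: zero_closed)
  next
    fix f g :: "'k mpoly" assume "f \<in> quot_by l" "g \<in> quot_by l"
    then obtain a b where ab: "f \<in> polys n" "a \<in> polys n" "f - l * a \<in> I"
      "g \<in> polys n" "b \<in> polys n" "g - l * b \<in> I"
      unfolding quot_by_def by blast
    then have "(f - l * a) + (g - l * b) \<in> I" by (intro add_closed)
    then have "f + g - l * (a + b) \<in> I" by (simp add: algebra_simps)
    then show "f + g \<in> quot_by l" using ab unfolding quot_by_def by blast
  next
    fix f g :: "'k mpoly" assume "f \<in> quot_by l" and g: "g \<in> polys n"
    then obtain a where a: "f \<in> polys n" "a \<in> polys n" "f - l * a \<in> I" unfolding quot_by_def by blast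
    then have "g * (f - l * a) \<in> I" using g by (intro mult_closed)
    then have "g * f - l * (g * a) \<in> I" by (simp add: right_diff_distrib ac_simps)
    then show "g * f \<in> quot_by l" using a g unfolding quot_by_def by blast
  qed
next
  fix f :: "'k mpoly" and i assume "f \<in> quot_by l"
  then obtain a where a: "f \<in> polys n" "a \<in> polys n" "f - l * a \<in> I" unfolding quot_by_def by auto
  have "hcomp i f - hcomp i (a * l) \<in> I"
    using hcomp_closed[OF a(3), of i] by (simp add: hcomp_diff mult.commute)
  then have hc: "hcomp i f - (if 1 \<le> i then hcomp (i - 1) a * l else 0) \<in> I"
    unfolding hcomp_mult[OF l a(2)] .
  have "\<exists>g\<in>polys n. hcomp i f - l * g \<in> I"
  proof (cases "1 \<le> i")
    case True
    then show ?thesis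
      using hc homog_part_sub[OF hcomp_homog[OF a(2), of "i - 1"]]
      by (intro bexI[of _ "hcomp (i - 1) a"]) (simp_all add: mult.commute)
  next
    case False
    then show ?thesis using hc by (intro bexI[of _ 0]) simp_all
  qed
  then show "hcomp i f \<in> quot_by l"
    using hcomp_homog[OF a(1), of i] homog_part_sub unfolding quot_by_def by blast
qed

text \<open>The exact sequence \<open>0 -> A_i -> A_(i+1) -> (A/lA)_(i+1) -> 0\<close> in terms of
  bases: \<open>l\<close> times a basis of \<open>A_i\<close>, together with a lifted basis of the
  cokernel, is a basis of the middle term.\<close>

lemma card_quot_by:
  assumes l: "l \<in> homog_part n 1" and inj: "\<And>f. f \<in> homog_part n i \<Longrightarrow> l * f \<in> I \<Longrightarrow> f \<in> I"
  shows "card (stdm (Suc i)) = card (stdm i) + card (std_mons (quot_by l) n (Suc i))"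
proof -
  interpret J: graded_ideal n "quot_by l" by (rule graded_quot_by[OF l])
  let ?B = "J.stdm (Suc i)"
  let ?X = "stdm i <+> ?B"
  let ?u = "case_sum (\<lambda>m. l * bmon m) bmon"
  have lc: "lincomb ?X ?u c = l * lincomb (stdm i) bmon (c \<circ> Inl) + lincomb ?B bmon (c \<circ> Inr)" for c
  proof -
    have "lincomb ?X ?u c = lincomb (stdm i) (\<lambda>m. l * bmon m) (c \<circ> Inl) + lincomb ?B bmon (c \<circ> Inr)"
      unfolding lincomb_def by (subst sum.Plus) (simp_all add: finite_stdm J.finite_stdm)
    then show ?thesis by (simp add: lincomb_mult)
  qed
  have H: "lincomb (stdm i) bmon c \<in> homog_part n i" for c
    using stdm_mons by (intro subsp_lincomb[OF subsp_homog_part] single_homog) auto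
  have HJ: "lincomb ?B bmon c \<in> homog_part n (Suc i)" for c
    using J.stdm_mons by (intro subsp_lincomb[OF subsp_homog_part] single_homog) auto
  have "basis_mod I (homog_part n (Suc i)) ?X ?u"
    unfolding basis_mod_def
  proof (intro conjI)
    show "finite ?X" using finite_stdm J.finite_stdm by auto
    show "?u ` ?X \<subseteq> homog_part n (Suc i)"
      using card_stdm_inj(2)[OF l inj] J.stdm_mons single_homog by fastforce
    show "indep_mod I ?X ?u"
      unfolding indep_mod_def lc
    proof (intro allI impI ballI)
      fix c x assume c: "l * lincomb (stdm i) bmon (c \<circ> Inl) + lincomb ?B bmon (c \<circ> Inr) \<in> I" and x: "x \<in> ?X"
      let ?a = "lincomb (stdm i) bmon (c \<circ> Inl)" and ?b = "lincomb ?B bmon (c \<circ> Inr)"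
      have "?b - l * (- ?a) \<in> I" using c by (simp add: add.commute)
      then have "?b \<in> quot_by l"
        using homog_part_sub[OF HJ] homog_part_sub[OF H[of "c \<circ> Inl"]] unfolding quot_by_def by blast
      then have 1: "\<forall>x\<in>?B. (c \<circ> Inr) x = 0"
        using J.stdm_basis[of "Suc i"] unfolding basis_mod_def indep_mod_def by blast
      then have "?b = 0" unfolding lincomb_def by simp
      then have "?a \<in> I" using c inj[OF H] by simp
      then have "\<forall>x\<in>stdm i. (c \<circ> Inl) x = 0"
        using stdm_basis[of i] unfolding basis_mod_def indep_mod_def by blast
      then show "c x = 0" using 1 x by auto
    qed
    show "spans_mod I (homog_part n (Suc i)) ?X ?u"
      unfolding spans_mod_def lc
    proof
      fix f :: "'k mpoly" assume f: "f \<in> homog_part n (Suc i)"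
      then obtain c where "f - lincomb ?B bmon c \<in> quot_by l"
        using J.stdm_basis[of "Suc i"] unfolding basis_mod_def spans_mod_def by blast
      then obtain g where g: "g \<in> polys n" "f - lincomb ?B bmon c - l * g \<in> I" unfolding quot_by_def by auto
      \<comment> \<open>Taking the component of degree \<open>Suc i\<close> replaces the cofactor
        \<open>g\<close> by a homogeneous one.\<close>
      have "hcomp (Suc i) (f - lincomb ?B bmon c - g * l) \<in> I" using g(2) hcomp_closed by (simp add: mult.commute)
      then have 1: "f - lincomb ?B bmon c - l * hcomp i g \<in> I"
        using hcomp_mult[OF l g(1), of "Suc i"] hcomp_same[OF homog_part_closed(3)[OF f HJ[of c]]]
        by (simp add: hcomp_diff[of _ "_ - _"] mult.commute)
      obtain c' where "hcomp i g - lincomb (stdm i) bmon c' \<in> I"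
        using stdm_basis[of i] hcomp_homog[OF g(1), of i] unfolding basis_mod_def spans_mod_def by blast
      then have "l * (hcomp i g - lincomb (stdm i) bmon c') \<in> I" using mult_closed homog_part_sub[OF l] by blast
      from add_closed[OF 1 this] have "f - (l * lincomb (stdm i) bmon c' + lincomb ?B bmon c) \<in> I"
        by (simp add: algebra_simps)
      then show "\<exists>c. f - (l * lincomb (stdm i) bmon (c \<circ> Inl) + lincomb ?B bmon (c \<circ> Inr)) \<in> I"
        by (intro exI[of _ "case_sum c' c"]) (simp add: comp_def)
    qed
  qed
  from basis_card_eq[OF subsp stdm_basis this] show ?thesis
    by (simp add: card_Plus finite_stdm J.finite_stdm)
qed

end

section \<open>Duality and necessity of the SI conditions\<close>

locale gorenstein_ideal = graded_ideal n I for n and I :: "'k::field mpoly set" +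
  fixes d :: nat and e :: "'k mpoly"
  assumes nontrivial: "1 \<notin> I" and large_degree: "\<And>i. i > d \<Longrightarrow> homog_part n i \<subseteq> I"
    and e: "e \<in> homog_part n d" "e \<notin> I" and soc_e: "\<And>f. f \<in> soc \<Longrightarrow> \<exists>c. f - Const c * e \<in> I"
begin

lemma top_soc: "homog_part n d \<subseteq> soc"
proof
  fix f :: "'k mpoly" assume f: "f \<in> homog_part n d"
  have "Var v * f \<in> I" if "v \<le> n" for v
    using homog_part_mult[OF Var_homog[OF that] f] large_degree[of "1 + d"] by auto
  then show "f \<in> soc" using homog_part_sub[OF f] unfolding soc_def by auto
qed

text \<open>The socle lives in degree \<open>d\<close>, so a nonzero element of lower degree is not
  killed by all variables. Some variable moves it up one degree, and this continues to the
  top.\<close>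

lemma pairing:
  assumes "f \<in> homog_part n i" "i \<le> d" "f \<notin> I"
  shows "\<exists>g\<in>homog_part n (d - i). f * g \<notin> I"
  using assms
proof (induction "d - i" arbitrary: f i)
  case 0
  then show ?case by (intro bexI[of _ 1]) auto
next
  case (Suc k)
  have "f \<notin> soc"
  proof
    assume "f \<in> soc"
    then obtain c where "f - Const c * e \<in> I" using soc_e by blast
    then have "hcomp i (f - Const c * e) \<in> I" by (rule hcomp_closed)
    moreover have "hcomp i (f - Const c * e) = f"
      using hcomp_same[OF Suc.prems(1)] hcomp_other[OF e(1), of i] Suc.hyps(2)
      by (simp add: hcomp_diff hcomp_Const_mult)
    ultimately show False using Suc.prems by simp
  qed
  then obtain v where v: "v \<le> n" "Var v * f \<notin> I" using homog_part_sub[OF Suc.prems(1)] unfolding soc_def by auto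
  have "\<exists>g\<in>homog_part n (d - Suc i). (Var v * f) * g \<notin> I"
    using Suc.hyps v homog_part_mult[OF Var_homog[OF v(1)] Suc.prems(1)] by (intro Suc.hyps(1)) auto
  then obtain g where g: "g \<in> homog_part n (d - Suc i)" "(Var v * f) * g \<notin> I" by blast
  have "Var v * g \<in> homog_part n (d - i)"
    using homog_part_mult[OF Var_homog[OF v(1)] g(1)] Suc.hyps(2) by (simp add: Suc_diff_Suc)
  moreover have "f * (Var v * g) \<notin> I" using g(2) by (simp add: ac_simps)
  ultimately show ?case by blast
qed

text \<open>Products in \<open>A_d\<close> are multiples of \<open>e\<close>, so orthogonality to a
  basis of \<open>A_(d-i)\<close> is a system of scalar equations. If \<open>A_i\<close> were
  larger, it would have a nonzero solution, against \<open>pairing\<close>.\<close>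

lemma card_stdm_le_dual:
  assumes "i \<le> d" shows "card (stdm i) \<le> card (stdm (d - i))"
proof (rule ccontr)
  assume gt: "\<not> card (stdm i) \<le> card (stdm (d - i))"
  have "\<exists>c. bmon x * bmon y - Const c * e \<in> I" if "x \<in> stdm i" "y \<in> stdm (d - i)" for x y
  proof -
    have "bmon x * bmon y \<in> homog_part n (i + (d - i))"
      using that stdm_mons by (intro homog_part_mult single_homog) auto
    then show ?thesis using top_soc soc_e assms by auto
  qed
  then obtain A where A: "\<And>x y. x \<in> stdm i \<Longrightarrow> y \<in> stdm (d - i) \<Longrightarrow> bmon x * bmon y - Const (A x y) * e \<in> I"
    by metis
  obtain c x where c: "x \<in> stdm i" "c x \<noteq> 0" "\<And>y. y \<in> stdm (d - i) \<Longrightarrow> (\<Sum>x\<in>stdm i. c x * A x y) = 0"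
    using underdetermined_system[OF finite_stdm finite_stdm, of "d - i" i A] gt by (auto simp: not_le)
  define p where "p = lincomb (stdm i) bmon c"
  have p: "p \<in> homog_part n i"
    unfolding p_def using stdm_mons by (intro subsp_lincomb[OF subsp_homog_part] single_homog) auto
  have py: "bmon y * p \<in> I" if y: "y \<in> stdm (d - i)" for y
  proof -
    have "lincomb (stdm i) (\<lambda>x. bmon y * bmon x) c - lincomb (stdm i) (\<lambda>x. Const (A x y) * e) c \<in> I"
      using A y by (intro lincomb_cong_mod[OF subsp]) (simp add: mult.commute)
    moreover have "lincomb (stdm i) (\<lambda>x. Const (A x y) * e) c = Const (\<Sum>x\<in>stdm i. c x * A x y) * e"
      unfolding lincomb_def by (simp add: Const_sum sum_distrib_right mult.assoc)
    ultimately show ?thesis using c(3)[OF y] unfolding p_def lincomb_mult by simp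
  qed
  have "p * g \<in> I" if g: "g \<in> homog_part n (d - i)" for g
  proof -
    obtain b where "g - lincomb (stdm (d - i)) bmon b \<in> I"
      using stdm_basis[of "d - i"] g unfolding basis_mod_def spans_mod_def by blast
    then have "p * (g - lincomb (stdm (d - i)) bmon b) \<in> I" using mult_closed homog_part_sub[OF p] by blast
    moreover have "lincomb (stdm (d - i)) (\<lambda>y. p * bmon y) b \<in> I"
      using py by (intro subsp_lincomb[OF subsp]) (simp add: mult.commute)
    ultimately have "p * (g - lincomb (stdm (d - i)) bmon b) + p * lincomb (stdm (d - i)) bmon b \<in> I"
      unfolding lincomb_mult by (rule add_closed)
    then show ?thesis by (simp add: algebra_simps)
  qed
  then have "p \<in> I" using pairing[OF p assms] by blast
  then show False using c stdm_basis[of i] unfolding p_def basis_mod_def indep_mod_def by blast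
qed

lemma card_stdm_dual: "i \<le> d \<Longrightarrow> card (stdm (d - i)) = card (stdm i)"
  using card_stdm_le_dual[of i] card_stdm_le_dual[of "d - i"] by simp

theorem SI_sequence_hilbert:
  assumes l: "l \<in> homog_part n 1"
    and max_rank: "\<And>i. (\<forall>f\<in>homog_part n i. l * f \<in> I \<longrightarrow> f \<in> I) \<or>
      (\<forall>f\<in>homog_part n (Suc i). \<exists>g\<in>homog_part n i. f - l * g \<in> I)"
    and h: "\<And>i. i \<le> d \<Longrightarrow> h i = card (stdm i)"
  shows "SI_sequence d h"
proof -
  interpret J: graded_ideal n "quot_by l" by (rule graded_quot_by[OF l])
  define inj where "inj = (\<lambda>i. \<forall>f\<in>homog_part n i. l * f \<in> I \<longrightarrow> f \<in> I)"
  define surj where "surj = (\<lambda>i. \<forall>f\<in>homog_part n (Suc i). \<exists>g\<in>homog_part n i. f - l * g \<in> I)"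
  have nd: "\<not> inj d"
    using e homog_part_mult[OF l e(1)] large_degree[of "1 + d"] unfolding inj_def by auto
  \<comment> \<open>The peak of \<open>h\<close>: multiplication by \<open>l\<close> is injective
    below \<open>u\<close> and surjective from \<open>u\<close> on.\<close>
  define u where "u = (LEAST i. \<not> inj i)"
  have u: "\<not> inj u" "u \<le> d"
    unfolding u_def using LeastI[of "\<lambda>i. \<not> inj i", OF nd] Least_le[of "\<lambda>i. \<not> inj i", OF nd] by auto
  have inju: "inj i" if "i < u" for i using not_less_Least that unfolding u_def by blast
  have surju: "surj i" if "u \<le> i" for i
    using that
  proof (induction i rule: dec_induct)
    case base
    then show ?case using max_rank[of u] u unfolding inj_def surj_def by blast
  next
    case (step i)
    then show ?case using surj_Suc[OF l] unfolding surj_def by blast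
  qed
  \<comment> \<open>Otherwise some \<open>f\<close> of degree \<open>u\<close> is killed by
    \<open>l\<close> and pairs nontrivially with a \<open>g\<close> of degree \<open>d - u\<close>,
    which exceeds \<open>u\<close>. Then \<open>g\<close> is a multiple of \<open>l\<close> modulo
    \<open>I\<close>, so \<open>f * g\<close> lies in \<open>I\<close> after all.\<close>
  have tu: "d div 2 \<le> u"
  proof (rule ccontr)
    assume "\<not> d div 2 \<le> u"
    then have du: "u \<le> d - u - 1" "Suc (d - u - 1) = d - u" by auto
    obtain f where f: "f \<in> homog_part n u" "l * f \<in> I" "f \<notin> I" using u(1) unfolding inj_def by auto
    then obtain g where g: "g \<in> homog_part n (d - u)" "f * g \<notin> I" using pairing u(2) by blast
    obtain g' where g': "g' \<in> homog_part n (d - u - 1)" "g - l * g' \<in> I"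
      using surju[OF du(1)] g(1) du(2) unfolding surj_def by auto
    have "f * (g - l * g') \<in> I" using g'(2) homog_part_sub[OF f(1)] by (rule mult_closed)
    moreover have "g' * (l * f) \<in> I" using f(2) homog_part_sub[OF g'(1)] by (rule mult_closed)
    ultimately have "f * (g - l * g') + g' * (l * f) \<in> I" by (rule add_closed)
    then show False using g(2) by (simp add: algebra_simps)
  qed
  have hinj: "h (Suc i) = h i + card (J.stdm (Suc i))" if "i < u" for i
    using card_quot_by[OF l, of i] inju[OF that] h[of i] h[of "Suc i"] u(2) that unfolding inj_def by simp
  have hsurj: "h (Suc i) \<le> h i" if "u \<le> i" "i < d" for i
    using card_stdm_surj[OF l, of i] surju[OF that(1)] h[of i] h[of "Suc i"] that unfolding surj_def by simp
  have "symmetric_seq d h"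
    unfolding symmetric_seq_def using h card_stdm_dual by simp
  moreover have "unimodal_seq d h"
    unfolding unimodal_seq_def using u(2) hinj hsurj by (intro exI[of _ u]) auto
  moreover have "differentiable_seq (d div 2) h"
  proof -
    have fd: "first_difference h (Suc i) = int (card (J.stdm (Suc i)))" if "Suc i \<le> d div 2" for i
      using hinj[of i] that tu unfolding first_difference_def by simp
    have fd0: "first_difference h 0 = 1" unfolding first_difference_def using h[of 0] stdm_0[OF nontrivial] by simp
    show ?thesis
      unfolding differentiable_seq_def O_sequence_def
    proof (intro conjI allI impI)
      fix i assume "i \<le> d div 2"
      then show "0 \<le> first_difference h i" using fd fd0 by (cases i) auto
    next
      fix i assume i: "1 \<le> i \<and> i < d div 2"
      then obtain k where k: "i = Suc k" by (cases i) auto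
      have "card (J.stdm (Suc i)) \<le> mgrowth i (card (J.stdm i))" using i by (intro J.macaulay_bound) auto
      then show "first_difference h (Suc i) \<le> int (macaulay_growth (nat (first_difference h i)) i)"
        using fd[of i] fd[of k] i k by (simp add: macaulay_growth_eq_mgrowth)
    qed (rule fd0)
  qed
  ultimately show ?thesis unfolding SI_sequence_def by simp
qed

end

theorem SI_sequence_if_gorenstein_SLP:
  fixes I :: "'k::field mpoly set"
  assumes "artinian_graded n I" "gorenstein n I" "strong_lefschetz n I" "has_h_vector n I d h"
  shows "SI_sequence d h"
proof -
  interpret graded_ideal n I using assms(1) unfolding artinian_graded_def homogeneous_ideal_iff by simp
  have 1: "1 \<notin> I" using assms(1) krull_dim_imp_nontrivial unfolding artinian_graded_def by blast
  have hf: "hilbert_function n I i = card (stdm i)" for i by (rule hilbert_function_eq_card[OF 1 stdm_basis])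
  have large: "homog_part n i \<subseteq> I" if "i > d" for i
  proof
    fix f :: "'k mpoly" assume f: "f \<in> homog_part n i"
    have "stdm i = {}" using assms(4) hf[of i] finite_stdm[of i] that unfolding has_h_vector_def by simp
    then show "f \<in> I" using stdm_basis[of i] f unfolding basis_mod_def spans_mod_def lincomb_def by simp
  qed
  have "stdm d \<noteq> {}" using assms(4) hf[of d] unfolding has_h_vector_def by auto
  then obtain m where m: "m \<in> stdm d" by auto
  have e0: "bmon m \<in> homog_part n d" using m stdm_mons by (intro single_homog) auto
  have e0I: "bmon m \<notin> I"
  proof
    assume "bmon m \<in> I"
    moreover have "lincomb (stdm d) bmon (\<lambda>x. if x = m then 1 else 0) = bmon m"
      by (rule poly_mapping_eqI) (use m in \<open>auto simp: lookup_lincomb_single[OF finite_stdm] lookup_single when_def\<close>)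
    ultimately have "lincomb (stdm d) bmon (\<lambda>x. if x = m then 1 else 0) \<in> I" by simp
    then have "\<forall>x\<in>stdm d. (if x = m then 1 else 0) = (0 :: 'k)"
      using stdm_basis[of d] unfolding basis_mod_def indep_mod_def by blast
    then show False using m by auto
  qed
  obtain e where e: "e \<in> soc" "e \<notin> I" "\<And>f. f \<in> soc \<Longrightarrow> \<exists>c. f - Const c * e \<in> I"
    using assms(2) gorenstein_iff[OF 1] by blast
  have "Var v * bmon m \<in> I" if "v \<le> n" for v
    using homog_part_mult[OF Var_homog[OF that] e0] large[of "1 + d"] by auto
  then have "bmon m \<in> soc" using homog_part_sub[OF e0] unfolding soc_def by auto
  then obtain c0 where c0: "bmon m - Const c0 * e \<in> I" using e(3) by blast
  have c0': "c0 \<noteq> 0" using c0 e0I by auto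
  \<comment> \<open>The generator \<open>e\<close> of the socle need not be homogeneous. A standard
    monomial of top degree is a nonzero socle element, hence a nonzero multiple of \<open>e\<close>
    modulo \<open>I\<close>, and can replace it.\<close>
  interpret gorenstein_ideal n I d "bmon m"
  proof
    fix f assume "f \<in> soc"
    then obtain c where c: "f - Const c * e \<in> I" using e(3) by blast
    have "Const (c / c0) * (bmon m - Const c0 * e) \<in> I" using c0 by (rule subspD(3)[OF subsp])
    then have "Const (c / c0) * bmon m - Const (c / c0 * c0) * e \<in> I"
      by (simp only: right_diff_distrib Const_simps mult.assoc)
    then have "Const (c / c0) * bmon m - Const c * e \<in> I" using c0' by simp
    from diff_closed[OF c this] have "f - Const (c / c0) * bmon m \<in> I" by simp
    then show "\<exists>c. f - Const c * bmon m \<in> I" by blast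
  qed (use 1 large e0 e0I in auto)
  obtain l where l: "l \<in> homog_part n 1" "\<And>i j. (\<forall>f\<in>homog_part n i. l ^ j * f \<in> I \<longrightarrow> f \<in> I) \<or>
     (\<forall>f\<in>homog_part n (i + j). \<exists>g\<in>homog_part n i. f - l ^ j * g \<in> I)"
    using assms(3) unfolding strong_lefschetz_iff by blast
  show ?thesis
  proof (rule SI_sequence_hilbert[OF l(1)])
    show "(\<forall>f\<in>homog_part n i. l * f \<in> I \<longrightarrow> f \<in> I) \<or>
      (\<forall>f\<in>homog_part n (Suc i). \<exists>g\<in>homog_part n i. f - l * g \<in> I)" for i
      using l(2)[of i 1] by simp
    show "h i = card (stdm i)" if "i \<le> d" for i
      using assms(4) hf that unfolding has_h_vector_def by metis
  qed
qed


section \<open>Construction from points\<close>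

subsection \<open>Evaluation\<close>

definition eval_mon :: "(nat \<Rightarrow> 'k::comm_ring_1) \<Rightarrow> monomial \<Rightarrow> 'k" where
  "eval_mon x m = (\<Prod>v\<in>Poly_Mapping.keys m. x v ^ Poly_Mapping.lookup m v)"

definition eval_poly :: "(nat \<Rightarrow> 'k::comm_ring_1) \<Rightarrow> 'k mpoly \<Rightarrow> 'k" where
  "eval_poly x f = (\<Sum>m\<in>Poly_Mapping.keys f. Poly_Mapping.lookup f m * eval_mon x m)"

lemma eval_mon_superset:
  "finite A \<Longrightarrow> Poly_Mapping.keys m \<subseteq> A \<Longrightarrow> eval_mon x m = (\<Prod>v\<in>A. x v ^ Poly_Mapping.lookup m v)"
  unfolding eval_mon_def by (rule prod.mono_neutral_left) (auto simp: in_keys_iff)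

lemma eval_mon_add: "eval_mon x (m + m') = eval_mon x m * eval_mon x m'"
proof -
  let ?A = "Poly_Mapping.keys m \<union> Poly_Mapping.keys m'"
  show ?thesis
    using eval_mon_superset[of ?A "m + m'" x] eval_mon_superset[of ?A m x] eval_mon_superset[of ?A m' x]
    by (simp add: keys_add_monomial lookup_add power_add prod.distrib)
qed

lemma eval_poly_superset:
  "finite A \<Longrightarrow> Poly_Mapping.keys f \<subseteq> A \<Longrightarrow> eval_poly x f = (\<Sum>m\<in>A. Poly_Mapping.lookup f m * eval_mon x m)"
  unfolding eval_poly_def by (rule sum.mono_neutral_left) (auto simp: in_keys_iff)

lemma eval_poly_0 [simp]: "eval_poly x 0 = 0"
  by (simp add: eval_poly_def)

lemma eval_poly_add: "eval_poly x (f + g) = eval_poly x f + eval_poly x g"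
proof -
  let ?A = "Poly_Mapping.keys f \<union> Poly_Mapping.keys g"
  show ?thesis
    using eval_poly_superset[of ?A "f + g" x] eval_poly_superset[of ?A f x] eval_poly_superset[of ?A g x]
      Poly_Mapping.keys_add[of f g]
    by (simp add: lookup_add distrib_right sum.distrib)
qed

lemma eval_poly_single: "eval_poly x (Poly_Mapping.single m c) = c * eval_mon x m"
  by (simp add: eval_poly_def)

lemma eval_poly_mult: "eval_poly x (f * g) = eval_poly x f * eval_poly x g"
proof (rule poly_induct[of f UNIV])
  fix m c
  show "eval_poly x (Poly_Mapping.single m c * g) = eval_poly x (Poly_Mapping.single m c) * eval_poly x g"
    by (rule poly_induct[of g UNIV])
      (auto simp: distrib_left eval_poly_add mult_single eval_poly_single eval_mon_add)
qed (auto simp: distrib_right eval_poly_add)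

lemma eval_poly_Const [simp]: "eval_poly x (Const c) = c"
  by (simp add: Const_def eval_poly_single eval_mon_def)

lemma eval_poly_Var [simp]: "eval_poly x (Var v) = x v"
  by (simp add: Var_def eval_poly_single eval_mon_def)

lemma eval_poly_1 [simp]: "eval_poly x 1 = 1"
  using eval_poly_Const[of x 1] by simp

lemma eval_poly_power: "eval_poly x (f ^ j) = eval_poly x f ^ j"
  by (induction j) (simp_all add: eval_poly_mult)

lemma eval_poly_diff: "eval_poly x (f - g) = eval_poly x f - eval_poly x g"
  using eval_poly_add[of x "f - g" g] by simp

lemma eval_poly_lincomb: "eval_poly x (lincomb X u c) = (\<Sum>y\<in>X. c y * eval_poly x (u y))"
  unfolding lincomb_def by (induction X rule: infinite_finite_induct) (simp_all add: eval_poly_add eval_poly_mult)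

text \<open>The field is a vector space over its rationals, and a linear map can be prescribed on
  the independent set \<open>{x0}\<close>. In \<open>positivity\<close> it stands in for an ordering
  of the field.\<close>

lemma rat_functional_ex:
  fixes x0 :: "'k::field_char_0"
  assumes "x0 \<noteq> 0"
  shows "\<exists>F :: 'k \<Rightarrow> rat. (\<forall>x y. F (x + y) = F x + F y) \<and> (\<forall>r x. F (of_rat r * x) = r * F x) \<and> F x0 = 1"
proof -
  interpret V: vector_space "\<lambda>r (x :: 'k). of_rat r * x"
    by unfold_locales (simp_all add: algebra_simps of_rat_add of_rat_mult)
  interpret W: vector_space "(*) :: rat \<Rightarrow> rat \<Rightarrow> rat"
    by unfold_locales (simp_all add: algebra_simps)
  interpret P: vector_space_pair "\<lambda>r (x :: 'k). of_rat r * x" "(*) :: rat \<Rightarrow> rat \<Rightarrow> rat" ..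
  have "V.independent {x0}" using assms by simp
  then obtain F where F: "Vector_Spaces.linear (\<lambda>r (x :: 'k). of_rat r * x) (*) F" "\<forall>x\<in>{x0}. F x = (1 :: rat)"
    using P.linear_independent_extend[of "{x0}" "\<lambda>_. 1"] by blast
  then show ?thesis using P.linear_add[OF F(1)] P.linear_scale[OF F(1)] by (intro exI[of _ F]) auto
qed

lemma of_nat_choose_Suc:
  "(of_nat (Suc k) :: 'k::comm_ring_1) * of_nat (x choose Suc k) = (of_nat x - of_nat k) * of_nat (x choose k)"
proof (cases "k \<le> x")
  case True
  have "Suc k * (x choose Suc k) = (x - k) * (x choose k)"
    using binomial_absorption[of k x] binomial_absorb_comp[of x k] by simp
  then have "(of_nat (Suc k * (x choose Suc k)) :: 'k) = of_nat ((x - k) * (x choose k))" by simp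
  then show ?thesis using True by (simp only: of_nat_mult of_nat_diff)
qed (simp add: binomial_eq_0)

lemma multiset_down_closed:
  assumes "\<And>x m. add_mset x m \<in> M \<Longrightarrow> m \<in> M" "p \<in> M" "q \<subseteq># p"
  shows "q \<in> M"
proof -
  have "q \<in> M" if "q + r \<in> M" for r
    using that by (induction r) (auto dest: assms(1))
  then show ?thesis using assms(2,3) by (metis subset_mset.add_diff_inverse)
qed

subsection \<open>The Gorenstein algebra of a set of points\<close>

locale order_ideal =
  fixes M :: "nat multiset set" and n d :: nat
  assumes finite_M: "finite M" and empty_M: "{#} \<in> M"
    and down: "\<And>x m. add_mset x m \<in> M \<Longrightarrow> m \<in> M"
    and size_M: "\<And>m. m \<in> M \<Longrightarrow> size m \<le> d div 2"
    and vars_M: "\<And>m. m \<in> M \<Longrightarrow> set_mset m \<subseteq> {..<n}"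
begin

text \<open>Exponent vectors are themselves used as points, in the affine chart where the variable \<open>0\<close> is \<open>1\<close>.\<close>

definition point :: "nat multiset \<Rightarrow> nat \<Rightarrow> 'k::field_char_0" where
  "point p v = (case v of 0 \<Rightarrow> 1 | Suc w \<Rightarrow> of_nat (count p w))"

abbreviation ev :: "nat multiset \<Rightarrow> 'k::field_char_0 mpoly \<Rightarrow> 'k" where
  "ev p \<equiv> eval_poly (point p)"

definition phi :: "'k::field_char_0 mpoly \<Rightarrow> 'k" where
  "phi f = (\<Sum>p\<in>M. ev p (hcomp d f))"

text \<open>The ideal dual to the functional \<open>phi\<close>, that is, the annihilator of the form
  \<open>\<Sum>p L\<^sub>p\<^sup>d\<close> in the inverse system, where \<open>L\<^sub>p\<close> is the linear form dual to the point \<open>p\<close>.\<close>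

definition perp :: "'k::field_char_0 mpoly set" where
  "perp = {f \<in> polys n. \<forall>g\<in>polys n. phi (f * g) = 0}"

lemma phi_add: "phi (f + g) = phi f + phi g"
  unfolding phi_def by (simp add: hcomp_add eval_poly_add sum.distrib)

lemma phi_diff: "phi (f - g) = phi f - phi g"
  unfolding phi_def by (simp add: hcomp_diff eval_poly_diff sum_subtractf)

lemma phi_Const: "phi (Const c * f) = c * phi f"
  unfolding phi_def by (simp add: hcomp_Const_mult eval_poly_mult sum_distrib_left)

lemma phi_0 [simp]: "phi 0 = 0"
  unfolding phi_def by simp

lemma phi_homog: "f \<in> homog_part n d \<Longrightarrow> phi f = (\<Sum>p\<in>M. ev p f)"
  unfolding phi_def by (simp add: hcomp_same)

lemma phi_mult_homog:
  assumes "f \<in> homog_part n i" "g \<in> polys n"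
  shows "phi (f * g) = (if i \<le> d then \<Sum>p\<in>M. ev p f * ev p (hcomp (d - i) g) else 0)"
  using hcomp_mult[OF assms, of d] unfolding phi_def
  by (simp add: mult.commute[of f] eval_poly_mult) (simp add: mult.commute)

lemma Var0_polys: "Var 0 \<in> polys n" "Var 0 ^ j \<in> polys n" "Var 0 ^ j \<in> homog_part n j"
  using Var_homog[of 0 n] homog_part_sub[of "Var 0" n 1] polys_power homog_part_power[of "Var 0" n 1 j] by auto

lemma point_0 [simp]: "point p 0 = 1"
  by (simp add: point_def)

section \<open>The dual ideal and its pairing\<close>

text \<open>\<open>phi\<close> sees degree \<open>d\<close> alone, so the component
  \<open>f_i\<close> meets \<open>g\<close> through \<open>g_(d-i)\<close>, which in turn meets
  \<open>f\<close> through \<open>f_i\<close>. Thus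
  \<open>phi (f_i * g) = phi (g_(d-i) * f)\<close>.\<close>

lemma graded_perp: "graded_ideal n (perp :: 'k::field_char_0 mpoly set)"
proof (rule graded_ideal.intro)
  show "ideal (perp :: 'k mpoly set) (poly_ring n)"
  proof (rule ideal_poly_ringI)
    fix f g :: "'k mpoly" assume f: "f \<in> perp" and g: "g \<in> polys n"
    have "phi (g * f * p) = 0" if "p \<in> polys n" for p
      using f g that polys_closed(5)[OF g that] unfolding perp_def by (auto simp: ac_simps)
    then show "g * f \<in> perp" using f g unfolding perp_def by auto
  qed (auto simp: perp_def phi_add distrib_right)
next
  fix f :: "'k mpoly" and i assume f: "f \<in> perp"
  have fp: "f \<in> polys n" using f unfolding perp_def by auto
  have "phi (hcomp i f * g) = 0" if g: "g \<in> polys n" for g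
  proof (cases "i \<le> d")
    case True
    have "phi (hcomp i f * g) = phi (hcomp (d - i) g * f)"
      using phi_mult_homog[OF hcomp_homog[OF fp] g, of i] phi_mult_homog[OF hcomp_homog[OF g] fp, of "d - i"] True
      by (simp add: mult.commute)
    also have "\<dots> = 0"
      using f homog_part_sub[OF hcomp_homog[OF g, of "d - i"]] unfolding perp_def by (auto simp: mult.commute)
    finally show ?thesis .
  next
    case False
    then show ?thesis using phi_mult_homog[OF hcomp_homog[OF fp] g, of i] by simp
  qed
  then show "hcomp i f \<in> perp" using homog_part_sub[OF hcomp_homog[OF fp, of i]] unfolding perp_def by auto
qed

lemma phi_Var0: "phi (Var 0 ^ d :: 'k::field_char_0 mpoly) = of_nat (card M)"
  using phi_homog[OF Var0_polys(3)] by (simp add: eval_poly_power)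

lemma card_M_nonzero: "of_nat (card M) \<noteq> (0 :: 'k::field_char_0)"
  using finite_M empty_M by auto

text \<open>For an element of the socle, \<open>phi (f' * g)\<close> depends only on the constant
  term of \<open>g\<close>, so \<open>phi f' = 0\<close> already puts \<open>f'\<close> into
  \<open>perp\<close>. Subtracting a multiple of \<open>x_0^d\<close> achieves this, as
  \<open>phi\<close> takes on it the value \<open>card M\<close>, nonzero in characteristic
  zero.\<close>

lemma gorenstein_perp: "gorenstein_ideal n (perp :: 'k::field_char_0 mpoly set) d (Var 0 ^ d)"
proof -
  interpret graded_ideal n "perp :: 'k mpoly set" by (rule graded_perp)
  have eI: "(Var 0 ^ d :: 'k mpoly) \<notin> perp"
  proof
    assume "(Var 0 ^ d :: 'k mpoly) \<in> perp"
    then have "phi (Var 0 ^ d * 1 :: 'k mpoly) = 0" unfolding perp_def by blast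
    then show False using phi_Var0[where 'k = 'k] card_M_nonzero[where 'k = 'k] by simp
  qed
  have large: "homog_part n i \<subseteq> (perp :: 'k mpoly set)" if "i > d" for i
    using phi_mult_homog that homog_part_sub unfolding perp_def by fastforce
  show ?thesis
  proof
    show "1 \<notin> (perp :: 'k mpoly set)" using eI mult_closed[of 1 "Var 0 ^ d"] Var0_polys by auto
    fix f :: "'k mpoly" assume f: "f \<in> soc"
    define c where "c = phi f / of_nat (card M)"
    define f' where "f' = f - Const c * Var 0 ^ d"
    have f'p: "f' \<in> polys n" using f Var0_polys unfolding f'_def soc_def by auto
    have 0: "phi f' = 0"
      unfolding f'_def c_def using card_M_nonzero[where 'k = 'k] by (simp add: phi_diff phi_Const phi_Var0)
    have V: "Var v * f' \<in> perp" if "v \<le> n" for v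
    proof -
      have "Var v * Var 0 ^ d \<in> (perp :: 'k mpoly set)"
        using homog_part_mult[OF Var_homog[OF that] Var0_polys(3)[of d]] large[of "1 + d"] by auto
      then have "Var v * f - Const c * (Var v * Var 0 ^ d) \<in> perp"
        using f that unfolding soc_def by (intro diff_closed subspD(3)[OF subsp]) auto
      then show ?thesis unfolding f'_def by (simp add: right_diff_distrib ac_simps)
    qed
    have "phi (f' * g) = 0" if g: "g \<in> polys n" for g
    proof -
      have "Poly_Mapping.keys g \<subseteq> {m. Poly_Mapping.keys m \<subseteq> {..n}}" using g by (auto simp: polys_iff)
      then show ?thesis
      proof (induction g rule: poly_induct)
        case (single m a)
        show ?case
        proof (cases "m = 0")
          case True
          then show ?thesis using phi_Const[of a f'] 0 by (simp add: Const_def mult.commute)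
        next
          case False
          then have "Poly_Mapping.keys m \<noteq> {}" by simp
          then obtain v where v: "v \<in> Poly_Mapping.keys m" by blast
          then obtain m' where m': "m = m' + Poly_Mapping.single v 1" by (rule mon_remove)
          have vn: "v \<le> n" and m'n: "Poly_Mapping.keys m' \<subseteq> {..n}"
            using single unfolding m' by (auto simp: keys_add_monomial)
          have "Poly_Mapping.single m' a \<in> polys n" using m'n by (simp add: polys_iff)
          then have "phi (Var v * f' * Poly_Mapping.single m' a) = 0" using V[OF vn] unfolding perp_def by blast
          then show ?thesis unfolding m' single_add_mon by (simp add: ac_simps)
        qed
      qed (auto simp: distrib_left phi_add)
    qed
    then have "f' \<in> perp" using f'p unfolding perp_def by auto
    then show "\<exists>c. f - Const c * Var 0 ^ d \<in> perp" unfolding f'_def by blast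
  qed (use eI large Var0_polys in auto)
qed

lemma vanishing_in_perp:
  assumes "f \<in> homog_part n i" "\<And>p. p \<in> M \<Longrightarrow> ev p f = 0"
  shows "f \<in> perp"
  using phi_mult_homog[OF assms(1)] assms(2) homog_part_sub[OF assms(1)] unfolding perp_def by simp

text \<open>Over an ordered field \<open>g = f\<close> would do, since the pairing of \<open>f\<close> with itself is a sum of squares.
  In general, a \<open>\<rat>\<close>-linear functional applied to the coefficients of \<open>f\<close> gives a rational \<open>g\<close>
  whose pairing with \<open>f\<close> is mapped to a sum of squares.\<close>

lemma positivity:
  fixes f :: "'k::field_char_0 mpoly"
  assumes f: "f \<in> homog_part n i" and i: "2 * i \<le> d"
    and 0: "\<And>g. g \<in> homog_part n i \<Longrightarrow> phi (Var 0 ^ (d - 2 * i) * f * g) = 0" and p: "p \<in> M"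
  shows "ev p f = 0"
proof (rule ccontr)
  assume "ev p f \<noteq> 0"
  then obtain F :: "'k \<Rightarrow> rat" where F: "\<And>x y. F (x + y) = F x + F y" "\<And>r x. F (of_rat r * x) = r * F x" "F (ev p f) = 1"
    using rat_functional_ex[of "ev p f"] by blast
  have F0: "F 0 = 0" using F(1)[of 0 0] by simp
  have Fsum: "F (sum a X) = (\<Sum>x\<in>X. F (a x))" for a :: "'z \<Rightarrow> 'k" and X
    by (induction X rule: infinite_finite_induct) (simp_all add: F0 F(1))
  define g where "g = (\<Sum>m\<in>Poly_Mapping.keys f. Poly_Mapping.single m (of_rat (F (Poly_Mapping.lookup f m)) :: 'k))"
  have lg: "Poly_Mapping.lookup g m = of_rat (F (Poly_Mapping.lookup f m))" for m
    unfolding g_def by (auto simp: lookup_sum lookup_single when_def in_keys_iff F0)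
  have keys_g: "Poly_Mapping.keys g \<subseteq> Poly_Mapping.keys f"
    by (auto simp: in_keys_iff lg F0)
  have g: "g \<in> homog_part n i" using f keys_g unfolding homog_part_iff by blast
  have evg: "ev q g = of_rat (F (ev q f))" for q
  proof -
    \<comment> \<open>The points have natural coordinates, so monomials take natural values there
      and the rational-linear \<open>F\<close> commutes with evaluation.\<close>
    define N where "N = (\<lambda>m. \<Prod>v\<in>Poly_Mapping.keys m. (case v of 0 \<Rightarrow> 1 | Suc w \<Rightarrow> count q w) ^ Poly_Mapping.lookup m v)"
    have "eval_mon (point q) m = (of_nat (N m) :: 'k)" for m
      unfolding eval_mon_def N_def of_nat_prod of_nat_power
      by (rule prod.cong) (simp_all add: point_def split: nat.split)
    then have N: "eval_mon (point q) m = (of_rat (of_nat (N m)) :: 'k)" for m by simp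
    have "ev q g = (\<Sum>m\<in>Poly_Mapping.keys f. of_rat (F (Poly_Mapping.lookup f m)) * of_rat (of_nat (N m)))"
      using eval_poly_superset[OF _ keys_g, of "point q"] by (simp add: lg N)
    also have "\<dots> = of_rat (\<Sum>m\<in>Poly_Mapping.keys f. of_nat (N m) * F (Poly_Mapping.lookup f m))"
      by (simp add: of_rat_sum of_rat_mult mult.commute)
    also have "(\<Sum>m\<in>Poly_Mapping.keys f. of_nat (N m) * F (Poly_Mapping.lookup f m)) = F (ev q f)"
      unfolding eval_poly_def Fsum N by (rule sum.cong) (simp_all add: F(2) mult.commute[of _ "of_rat _"] del: of_rat_of_nat_eq)
    finally show ?thesis .
  qed
  have "Var 0 ^ (d - 2 * i) * f * g \<in> homog_part n d"
    using homog_part_mult[OF homog_part_mult[OF Var0_polys(3) f] g, of "d - 2 * i"] i by simp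
  then have "0 = (\<Sum>q\<in>M. ev q f * ev q g)"
    using 0[OF g] by (simp add: phi_homog eval_poly_mult eval_poly_power)
  then have "0 = F (\<Sum>q\<in>M. of_rat (F (ev q f)) * ev q f)" by (simp add: evg F0 mult.commute)
  also have "\<dots> = (\<Sum>q\<in>M. F (ev q f) * F (ev q f))" unfolding Fsum F(2) ..
  finally have "\<forall>q\<in>M. F (ev q f) * F (ev q f) = 0"
    using sum_nonneg_eq_0_iff[OF finite_M, of "\<lambda>q. F (ev q f) * F (ev q f)"] by simp
  then show False using p F(3) by fastforce
qed

text \<open>Together with \<open>vanishing_in_perp\<close> this identifies \<open>perp\<close>, in
  degrees up to the middle, with the forms vanishing on \<open>M\<close>.\<close>

lemma perp_vanishes:
  assumes "f \<in> homog_part n i" "2 * i \<le> d" "f \<in> perp" "p \<in> M"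
  shows "ev p f = 0"
proof (rule positivity[OF assms(1,2) _ assms(4)])
  fix g :: "'a mpoly" assume "g \<in> homog_part n i"
  then have "phi (f * (Var 0 ^ (d - 2 * i) * g)) = 0"
    using assms(3) Var0_polys homog_part_sub polys_closed(5) unfolding perp_def by blast
  then show "phi (Var 0 ^ (d - 2 * i) * f * g) = 0" by (simp add: ac_simps)
qed

text \<open>The kernel of \<open>x_0^(d-2i)\<close> on \<open>A_i\<close> is the radical of the form
  treated in \<open>positivity\<close>.\<close>

lemma power_Var0_inj:
  assumes "f \<in> homog_part n i" "2 * i \<le> d" "Var 0 ^ (d - 2 * i) * f \<in> perp"
  shows "f \<in> perp"
proof (rule vanishing_in_perp[OF assms(1)])
  fix p assume p: "p \<in> M"
  show "ev p f = 0"
    by (rule positivity[OF assms(1,2) _ p]) (use assms(3) homog_part_sub in \<open>auto simp: perp_def\<close>)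
qed

text \<open>Newton's interpolation basis: as \<open>M\<close> is closed under taking submultisets, the polynomial of
  \<open>q \<notin> M\<close> vanishes on \<open>M\<close>.\<close>

definition newton :: "nat multiset \<Rightarrow> nat multiset \<Rightarrow> nat" where
  "newton m p = (\<Prod>w<n. count p w choose count m w)"

lemma newton_nonzero:
  assumes "newton q p \<noteq> 0" "set_mset q \<subseteq> {..<n}" shows "q \<subseteq># p"
proof (rule mset_subset_eqI)
  fix w
  show "count q w \<le> count p w"
  proof (cases "w < n")
    case True
    then have "(count p w choose count q w) \<noteq> 0" using assms(1) unfolding newton_def by auto
    then show ?thesis using binomial_eq_0_iff not_less by blast
  next
    case False
    then have "w \<notin># q" using assms(2) by auto
    then show ?thesis by (simp add: not_in_iff)
  qed
qed

lemma newton_self [simp]: "newton q q = 1"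
  unfolding newton_def by simp

lemma newton_add:
  assumes "w < n"
  shows "(of_nat (Suc (count m w)) :: 'k::field_char_0) * of_nat (newton (add_mset w m) p)
    = (of_nat (count p w) - of_nat (count m w)) * of_nat (newton m p)"
proof -
  have 1: "newton q p = (count p w choose count q w) * (\<Prod>v\<in>{..<n} - {w}. count p v choose count q v)" for q
    unfolding newton_def using assms by (intro prod.remove) auto
  have 2: "(\<Prod>v\<in>{..<n} - {w}. count p v choose count (add_mset w m) v) = (\<Prod>v\<in>{..<n} - {w}. count p v choose count m v)"
    by (rule prod.cong) auto
  show ?thesis
    unfolding 1 2 of_nat_mult mult.assoc[symmetric] using of_nat_choose_Suc[of "count m w" "count p w", where 'k = 'k] by simp
qed

text \<open>The product of binomial coefficients is a product of linear factors
  \<open>p_w - a\<close> up to a constant. Each is homogenised by \<open>x_0\<close>, which is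
  \<open>1\<close> at the points, so the degree is exactly \<open>size m\<close>.\<close>

lemma newton_poly_ex:
  assumes "set_mset m \<subseteq> {..<n}"
  shows "\<exists>u :: 'k::field_char_0 mpoly. u \<in> homog_part n (size m) \<and> (\<forall>p. ev p u = of_nat (newton m p))"
  using assms
proof (induction m)
  case empty
  show ?case by (intro exI[of _ 1]) (simp add: newton_def)
next
  case (add w m)
  then obtain u :: "'k mpoly" where u: "u \<in> homog_part n (size m)" "\<And>p. ev p u = of_nat (newton m p)" by auto
  have w: "w < n" using add.prems by auto
  let ?u = "Const (1 / of_nat (Suc (count m w))) * ((Var (Suc w) - Const (of_nat (count m w)) * Var 0) * u)"
  have "(Var (Suc w) - Const (of_nat (count m w)) * Var 0) * u \<in> homog_part n (1 + size m)"
    using w by (intro homog_part_mult[OF _ u(1)] homog_part_closed Var_homog) auto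
  then have "?u \<in> homog_part n (size (add_mset w m))" by (intro homog_part_closed) simp
  moreover have "ev p ?u = of_nat (newton (add_mset w m) p)" for p
  proof -
    have "ev p ?u = 1 / of_nat (Suc (count m w)) * ((of_nat (count p w) - of_nat (count m w)) * of_nat (newton m p))"
      by (simp add: eval_poly_mult eval_poly_diff u(2) point_def del: of_nat_Suc)
    also have "\<dots> = of_nat (newton (add_mset w m) p)"
      unfolding newton_add[OF w, symmetric] by (simp del: of_nat_Suc)
    finally show ?thesis .
  qed
  ultimately show ?case by blast
qed

definition npoly :: "nat multiset \<Rightarrow> 'k::field_char_0 mpoly" where
  "npoly m = (SOME u. u \<in> homog_part n (size m) \<and> (\<forall>p. ev p u = of_nat (newton m p)))"

lemma npoly:
  assumes "m \<in> M"
  shows "npoly m \<in> homog_part n (size m)" "ev p (npoly m) = of_nat (newton m p)"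
  using someI_ex[OF newton_poly_ex[OF vars_M[OF assms]]] unfolding npoly_def by auto

section \<open>Restrictions of forms to the points\<close>

abbreviation M_le :: "nat \<Rightarrow> nat multiset set" where "M_le i \<equiv> {m \<in> M. size m \<le> i}"

definition newton_span :: "nat \<Rightarrow> (nat multiset \<Rightarrow> 'k::field_char_0) \<Rightarrow> bool" where
  "newton_span i F \<longleftrightarrow> (\<exists>c. \<forall>p\<in>M. F p = (\<Sum>q\<in>M_le i. c q * of_nat (newton q p)))"

lemma newton_span_0: "newton_span i (\<lambda>_. 0)"
  unfolding newton_span_def by (intro exI[of _ "\<lambda>_. 0"]) simp

lemma newton_span_add: "newton_span i F \<Longrightarrow> newton_span i G \<Longrightarrow> newton_span i (\<lambda>p. F p + G p)"
  unfolding newton_span_def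
proof (elim exE)
  fix b c assume "\<forall>p\<in>M. F p = (\<Sum>q\<in>M_le i. b q * of_nat (newton q p))" "\<forall>p\<in>M. G p = (\<Sum>q\<in>M_le i. c q * of_nat (newton q p))"
  then show "\<exists>c. \<forall>p\<in>M. F p + G p = (\<Sum>q\<in>M_le i. c q * of_nat (newton q p))"
    by (intro exI[of _ "\<lambda>q. b q + c q"]) (simp add: distrib_right sum.distrib)
qed

lemma newton_span_scale: "newton_span i F \<Longrightarrow> newton_span i (\<lambda>p. a * F p)"
  unfolding newton_span_def
proof (elim exE)
  fix c assume "\<forall>p\<in>M. F p = (\<Sum>q\<in>M_le i. c q * of_nat (newton q p))"
  then show "\<exists>c. \<forall>p\<in>M. a * F p = (\<Sum>q\<in>M_le i. c q * of_nat (newton q p))"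
    by (intro exI[of _ "\<lambda>q. a * c q"]) (simp add: sum_distrib_left mult.assoc)
qed

lemma newton_span_sum: "(\<And>x. x \<in> X \<Longrightarrow> newton_span i (F x)) \<Longrightarrow> newton_span i (\<lambda>p. \<Sum>x\<in>X. F x p)"
  by (induction X rule: infinite_finite_induct) (auto intro: newton_span_0 newton_span_add)

lemma newton_span_cong: "(\<And>p. p \<in> M \<Longrightarrow> F p = G p) \<Longrightarrow> newton_span i F = newton_span i G"
  unfolding newton_span_def by simp

lemma newton_span_newton:
  assumes "size q \<le> i" "set_mset q \<subseteq> {..<n}"
  shows "newton_span i (\<lambda>p. of_nat (newton q p) :: 'k::field_char_0)"
proof (cases "q \<in> M")
  case True
  have "finite (M_le i)" using finite_M by simp
  then show ?thesis
    unfolding newton_span_def using True assms(1)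
    by (intro exI[of _ "\<lambda>x. if x = q then 1 else 0"]) (simp add: if_distrib[of "\<lambda>x. x * _"] cong: if_cong)
next
  case False
  have "newton q p = 0" if "p \<in> M" for p
    using newton_nonzero[OF _ assms(2), of p] multiset_down_closed[of M p q] down that False by blast
  then show ?thesis 
    using newton_span_cong[of "\<lambda>p. of_nat (newton q p) :: 'k" "\<lambda>_. 0"] newton_span_0 by simp
qed

lemma newton_span_mult:
  fixes F :: "nat multiset \<Rightarrow> 'k::field_char_0"
  assumes "newton_span i F" "v \<le> n"
  shows "newton_span (Suc i) (\<lambda>p. point p v * F p)"
proof -
  obtain c where c: "\<And>p. p \<in> M \<Longrightarrow> F p = (\<Sum>q\<in>M_le i. c q * of_nat (newton q p))"
    using assms(1) unfolding newton_span_def by auto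
  have "newton_span (Suc i) (\<lambda>p. point p v * (of_nat (newton q p) :: 'k))" if q: "q \<in> M_le i" for q
  proof (cases v)
    case 0
    have "newton_span (Suc i) (\<lambda>p. of_nat (newton q p) :: 'k)"
      using q vars_M by (intro newton_span_newton) auto
    then show ?thesis by (simp add: 0 point_def)
  next
    case (Suc w)
    then have w: "w < n" using assms(2) by simp
    have "point p v * (of_nat (newton q p) :: 'k) = of_nat (Suc (count q w)) * of_nat (newton (add_mset w q) p)
        + of_nat (count q w) * of_nat (newton q p)" for p
      unfolding newton_add[OF w] by (simp add: Suc point_def algebra_simps)
    moreover have "newton_span (Suc i) (\<lambda>p. of_nat (Suc (count q w)) * (of_nat (newton (add_mset w q) p) :: 'k)
        + of_nat (count q w) * of_nat (newton q p))"
      using q vars_M[of q] w by (intro newton_span_add newton_span_scale newton_span_newton) auto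
    ultimately show ?thesis by simp
  qed
  then have "newton_span (Suc i) (\<lambda>p. \<Sum>q\<in>M_le i. c q * (point p v * of_nat (newton q p)))"
    by (intro newton_span_sum newton_span_scale)
  moreover have "point p v * F p = (\<Sum>q\<in>M_le i. c q * (point p v * of_nat (newton q p)))" if "p \<in> M" for p
    unfolding c[OF that] by (simp add: sum_distrib_left ac_simps)
  ultimately show ?thesis
    using newton_span_cong[of "\<lambda>p. point p v * F p" "\<lambda>p. \<Sum>q\<in>M_le i. c q * (point p v * of_nat (newton q p))"] by simp
qed

lemma newton_span_mon:
  "m \<in> mons n i \<Longrightarrow> newton_span i (\<lambda>p. eval_mon (point p) m :: 'k::field_char_0)"
proof (induction i arbitrary: m)
  case 0
  then have "m = 0" by (simp add: mons_def)
  then show ?case using newton_span_newton[of "{#}" 0, where 'k = 'k] by (simp add: eval_mon_def newton_def)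
next
  case (Suc i)
  then have "Poly_Mapping.keys m \<noteq> {}" by (auto simp: mons_def)
  then obtain v where v: "v \<in> Poly_Mapping.keys m" by blast
  then obtain m' where m': "m = m' + Poly_Mapping.single v 1" by (rule mon_remove)
  have m'm: "m' \<in> mons n i" "v \<le> n"
    using Suc.prems unfolding m' mons_def by (auto simp: keys_add_monomial mono_degree_add)
  have "eval_mon (point p) m = point p v * (eval_mon (point p) m' :: 'k)" for p
    unfolding m' eval_mon_add by (simp add: eval_mon_def)
  then show ?case using newton_span_mult[OF Suc.IH[OF m'm(1)] m'm(2)] by simp
qed

lemma newton_span_poly:
  assumes "f \<in> homog_part n i" shows "newton_span i (\<lambda>p. ev p f)"
  unfolding eval_poly_def
  using assms by (intro newton_span_sum newton_span_scale newton_span_mon) (auto simp: homog_part_iff)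

text \<open>Unitriangularity: at the point \<open>q\<close> only submultisets of \<open>q\<close>
  contribute, the proper ones are smaller and have coefficient zero by induction, and
  \<open>newton q q = 1\<close>.\<close>

lemma newton_indep:
  assumes "\<And>p. p \<in> M \<Longrightarrow> (\<Sum>q\<in>M_le i. c q * of_nat (newton q p)) = (0 :: 'k::field_char_0)" "q \<in> M_le i"
  shows "c q = 0"
  using assms(2)
proof (induction "size q" arbitrary: q rule: less_induct)
  case less
  have fin: "finite (M_le i)" using finite_M by simp
  have "c q' * of_nat (newton q' q) = 0" if "q' \<in> M_le i - {q}" for q'
  proof (cases "newton q' q = 0")
    case False
    then have "q' \<subseteq># q" using newton_nonzero vars_M that by blast
    then have "q' \<subset># q" using that by (auto simp: subset_mset.less_le)
    then have "size q' < size q" by (rule mset_subset_size)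
    then show ?thesis using less.hyps[of q'] that by simp
  qed simp
  then have "(\<Sum>q'\<in>M_le i - {q}. c q' * of_nat (newton q' q)) = 0" by (intro sum.neutral) blast
  then have "(\<Sum>q'\<in>M_le i. c q' * of_nat (newton q' q)) = c q"
    using sum.remove[OF fin less.prems, of "\<lambda>q'. c q' * of_nat (newton q' q)"] by simp
  then show ?case using assms(1)[of q] less.prems by simp
qed

section \<open>Hilbert function and Lefschetz property of the constructed algebra\<close>

text \<open>Powers of \<open>x_0\<close> lift the Newton polynomials to degree \<open>i\<close>
  without changing their values. Up to the middle degree independence modulo \<open>perp\<close> is
  independence of the restrictions to \<open>M\<close>.\<close>

lemma basis_perp:
  assumes i: "2 * i \<le> d"
  shows "basis_mod (perp :: 'k::field_char_0 mpoly set) (homog_part n i) (M_le i) (\<lambda>q. Var 0 ^ (i - size q) * npoly q)"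
proof -
  let ?u = "\<lambda>q. Var 0 ^ (i - size q) * npoly q :: 'k mpoly"
  have u: "?u q \<in> homog_part n i" if "q \<in> M_le i" for q
    using homog_part_mult[OF Var0_polys(3) npoly(1), of q "i - size q"] that by simp
  have evu: "ev p (lincomb (M_le i) ?u c) = (\<Sum>q\<in>M_le i. c q * of_nat (newton q p))" for p c
    unfolding eval_poly_lincomb by (rule sum.cong) (simp_all add: eval_poly_mult eval_poly_power npoly(2))
  have H: "lincomb (M_le i) ?u c \<in> homog_part n i" for c
    using u by (intro subsp_lincomb[OF subsp_homog_part])
  show ?thesis
    unfolding basis_mod_def indep_mod_def spans_mod_def
  proof (intro conjI allI impI ballI)
    show "finite (M_le i)" using finite_M by simp
    show "?u ` M_le i \<subseteq> homog_part n i" using u by auto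
    show "c q = 0" if "lincomb (M_le i) ?u c \<in> perp" "q \<in> M_le i" for c q
      using newton_indep[OF _ that(2)] perp_vanishes[OF H i that(1)] unfolding evu by blast
    fix f :: "'k mpoly" assume f: "f \<in> homog_part n i"
    then obtain c where c: "\<And>p. p \<in> M \<Longrightarrow> ev p f = (\<Sum>q\<in>M_le i. c q * of_nat (newton q p))"
      using newton_span_poly[OF f] unfolding newton_span_def by blast
    have "f - lincomb (M_le i) ?u c \<in> perp"
      using f H c by (intro vanishing_in_perp[of _ i]) (auto simp: eval_poly_diff evu)
    then show "\<exists>c. f - lincomb (M_le i) ?u c \<in> perp" by blast
  qed
qed

theorem perp_properties:
  fixes h :: "nat \<Rightarrow> nat"
  assumes h: "\<And>i. i \<le> d div 2 \<Longrightarrow> h i = card (M_le i)" and sym: "\<And>i. i \<le> d \<Longrightarrow> h i = h (d - i)"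
    and pos: "\<And>i. i \<le> d \<Longrightarrow> 0 < h i"
  shows "artinian_graded n (perp :: 'k::field_char_0 mpoly set)" "gorenstein n (perp :: 'k mpoly set)"
    "strong_lefschetz n (perp :: 'k mpoly set)" "has_h_vector n (perp :: 'k mpoly set) d h"
proof -
  interpret gorenstein_ideal n "perp :: 'k mpoly set" d "Var 0 ^ d" by (rule gorenstein_perp)
  show "artinian_graded n (perp :: 'k mpoly set)"
    unfolding artinian_graded_def homogeneous_ideal_iff
    using graded_perp krull_dim_0I[OF nontrivial large_degree] by blast
  show "gorenstein n (perp :: 'k mpoly set)"
    unfolding gorenstein_iff[OF nontrivial] using e top_soc soc_e by blast
  have hs: "card (stdm i) = h i" if "i \<le> d" for i
  proof (cases "i \<le> d div 2")
    case True
    then have "2 * i \<le> d" by simp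
    from basis_card_eq[OF subsp stdm_basis basis_perp[OF this]] show ?thesis using h[OF True] by simp
  next
    case False
    then have "2 * (d - i) \<le> d" "d - i \<le> d div 2" by auto
    from basis_card_eq[OF subsp stdm_basis basis_perp[OF this(1)]] have "card (stdm (d - i)) = h (d - i)"
      using h[OF \<open>d - i \<le> d div 2\<close>] by simp
    then show ?thesis using card_stdm_dual[OF that] sym[OF that] by simp
  qed
  have hf: "hilbert_function n (perp :: 'k mpoly set) i = card (stdm i)" for i
    by (rule hilbert_function_eq_card[OF nontrivial stdm_basis])
  have "card (stdm i) = 0" if "i > d" for i
  proof -
    have "basis_mod (perp :: 'k mpoly set) (homog_part n i) {} (bmon :: monomial \<Rightarrow> 'k mpoly)"
      unfolding basis_mod_def indep_mod_def spans_mod_def lincomb_def using large_degree[OF that] by auto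
    from basis_card_eq[OF subsp stdm_basis this] show ?thesis by simp
  qed
  then show "has_h_vector n (perp :: 'k mpoly set) d h"
    unfolding has_h_vector_def hf using hs pos[of d] by auto
  \<comment> \<open>Injective from \<open>A_i\<close> to \<open>A_(d-i)\<close>, whose dimensions
    agree by duality.\<close>
  have surj: "\<exists>g\<in>homog_part n i. f - Var 0 ^ (d - 2 * i) * g \<in> perp"
    if i: "2 * i \<le> d" and f: "f \<in> homog_part n (d - i)" for i and f :: "'k mpoly"
  proof (rule surj_if_inj_card[OF Var0_polys(3)])
    show "f' \<in> perp" if "f' \<in> homog_part n i" "Var 0 ^ (d - 2 * i) * f' \<in> perp" for f' :: "'k mpoly"
      using power_Var0_inj[OF that(1) i that(2)] .
    have "d - 2 * i + i = d - i" using i by simp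
    then show "card (stdm (d - 2 * i + i)) \<le> card (stdm i)" "f \<in> homog_part n (d - 2 * i + i)"
      using card_stdm_dual[of i] i f by auto
  qed
  show "strong_lefschetz n (perp :: 'k mpoly set)"
    unfolding strong_lefschetz_iff
  proof (intro bexI[of _ "Var 0"] allI)
    show "Var 0 \<in> homog_part n 1" by (rule Var_homog) simp
    fix i j
    consider "d < i + j" | "i + j \<le> d" "2 * i + j \<le> d" | "i + j \<le> d" "d < 2 * i + j" by linarith
    then show "(\<forall>f\<in>homog_part n i. Var 0 ^ j * f \<in> perp \<longrightarrow> f \<in> (perp :: 'k mpoly set)) \<or>
        (\<forall>f\<in>homog_part n (i + j). \<exists>g\<in>homog_part n i. f - Var 0 ^ j * g \<in> (perp :: 'k mpoly set))"
    proof cases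
      case 1
      then have "f - Var 0 ^ j * 0 \<in> perp" if "f \<in> homog_part n (i + j)" for f :: "'k mpoly"
        using large_degree that by auto
      then show ?thesis using homog_part_closed(1) by blast
    next
      \<comment> \<open>\<open>x_0^j\<close> is the first factor of the injective map
        \<open>x_0^(d-2i)\<close>.\<close>
      case 2
      have "f \<in> perp" if f: "f \<in> homog_part n i" "Var 0 ^ j * f \<in> perp" for f :: "'k mpoly"
      proof (rule power_Var0_inj[OF f(1)])
        show "2 * i \<le> d" using 2 by simp
        have "Var 0 ^ (d - 2 * i - j) * (Var 0 ^ j * f) \<in> perp" by (rule mult_closed[OF f(2) Var0_polys(2)])
        moreover have "d - 2 * i = (d - 2 * i - j) + j" using 2 by simp
        ultimately show "Var 0 ^ (d - 2 * i) * f \<in> perp" by (metis mult.assoc power_add)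
      qed
      then show ?thesis by blast
    next
      case 3
      \<comment> \<open>The degree dual to the target \<open>i + j\<close>. The surjection
        \<open>x_0^(d-2i')\<close> from there onto degree \<open>i + j\<close> passes through degree
        \<open>i\<close>, so its last \<open>j\<close> factors are surjective.\<close>
      define i' where "i' = d - i - j"
      have i': "2 * i' \<le> d" "d - i' = i + j" "d - 2 * i' = j + (i - i')" "i' \<le> i" using 3 unfolding i'_def by auto
      have "\<exists>g\<in>homog_part n i. f - Var 0 ^ j * g \<in> perp" if f: "f \<in> homog_part n (i + j)" for f :: "'k mpoly"
      proof -
        obtain g where g: "g \<in> homog_part n i'" "f - Var 0 ^ (d - 2 * i') * g \<in> perp"
          using surj[OF i'(1)] f unfolding i'(2) by blast
        have "Var 0 ^ (i - i') * g \<in> homog_part n (i - i' + i')" by (rule homog_part_mult[OF Var0_polys(3) g(1)])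
        then have "Var 0 ^ (i - i') * g \<in> homog_part n i" using i'(4) by simp
        moreover have "f - Var 0 ^ j * (Var 0 ^ (i - i') * g) \<in> perp"
          using g(2) unfolding i'(3) power_add by (simp add: mult.assoc)
        ultimately show ?thesis by blast
      qed
      then show ?thesis by blast
    qed
  qed
qed

end

section \<open>Sufficiency and the equivalence\<close>

theorem gorenstein_SLP_if_SI_sequence:
  assumes pos: "\<forall>i\<le>d. 0 < h i" and SI: "SI_sequence d h"
  shows "\<exists>n (I :: 'k::field_char_0 mpoly set).
    artinian_graded n I \<and> gorenstein n I \<and> strong_lefschetz n I \<and> has_h_vector n I d h"
proof -
  define t where "t = d div 2"
  define g where "g = (\<lambda>i. nat (first_difference h i))"
  have O: "O_sequence t (first_difference h)" and sym: "\<And>i. i \<le> d \<Longrightarrow> h i = h (d - i)"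
    using SI unfolding SI_sequence_def differentiable_seq_def symmetric_seq_def t_def by blast+
  have fd: "first_difference h i = int (g i)" if "i \<le> t" for i
    using O that unfolding O_sequence_def g_def by simp
  have g0: "g 0 = 1" using O unfolding O_sequence_def g_def by simp
  have growth: "g (Suc i) \<le> mgrowth i (g i)" if "1 \<le> i" "i < t" for i
  proof -
    have "first_difference h (Suc i) \<le> int (macaulay_growth (nat (first_difference h i)) i)"
      using O that unfolding O_sequence_def by blast
    then show ?thesis using fd[of "Suc i"] fd[of i] that by (simp add: macaulay_growth_eq_mgrowth)
  qed
  have "\<exists>M :: nat multiset set. finite M \<and> (\<forall>x m. add_mset x m \<in> M \<longrightarrow> m \<in> M) \<and> (\<forall>m\<in>M. size m \<le> t) \<and>
      (\<forall>i\<le>t. card {m \<in> M. size m = i} = g i)"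
    by (rule order_ideal_ex[OF g0 growth])
  then obtain M :: "nat multiset set" where
    M0: "finite M \<and> (\<forall>x m. add_mset x m \<in> M \<longrightarrow> m \<in> M) \<and> (\<forall>m\<in>M. size m \<le> t) \<and>
      (\<forall>i\<le>t. card {m \<in> M. size m = i} = g i)"
    by (elim exE)
  then have M: "finite M" "\<And>x m. add_mset x m \<in> M \<Longrightarrow> m \<in> M" "\<And>m. m \<in> M \<Longrightarrow> size m \<le> t"
    "\<And>i. i \<le> t \<Longrightarrow> card {m \<in> M. size m = i} = g i"
    by simp_all
  have "card {m \<in> M. size m = 0} = 1" using M(4)[of 0] g0 by simp
  then have "{m \<in> M. size m = 0} \<noteq> {}" by (metis card.empty zero_neq_one)
  then have empty: "{#} \<in> M" by auto
  have "finite (\<Union>m\<in>M. set_mset m)" using M(1) by auto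
  from this[unfolded finite_nat_set_iff_bounded] obtain n where n: "\<forall>x\<in>(\<Union>m\<in>M. set_mset m). x < n" ..
  interpret order_ideal M n d
  proof
    show "set_mset m \<subseteq> {..<n}" if "m \<in> M" for m using n that by auto
    show "size m \<le> d div 2" if "m \<in> M" for m using M(3)[OF that] unfolding t_def .
    show "m \<in> M" if "add_mset x m \<in> M" for x m using M(2)[OF that] .
  qed (use M(1) empty in auto)
  have h: "h i = card {m \<in> M. size m \<le> i}" if "i \<le> t" for i
    using that
  proof (induction i)
    case 0
    have "{m \<in> M. size m \<le> 0} = {m \<in> M. size m = 0}" by auto
    then show ?case using M(4)[of 0] g0 fd[of 0] by (simp add: first_difference_def)
  next
    case (Suc i)
    have "{m \<in> M. size m \<le> Suc i} = {m \<in> M. size m \<le> i} \<union> {m \<in> M. size m = Suc i}" by auto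
    then have "card {m \<in> M. size m \<le> Suc i} = card {m \<in> M. size m \<le> i} + card {m \<in> M. size m = Suc i}"
      using M(1) by (simp add: card_Un_disjoint disjoint_iff)
    then show ?case using Suc M(4)[of "Suc i"] fd[of "Suc i"] by (simp add: first_difference_def)
  qed
  have pos': "0 < h i" if "i \<le> d" for i using pos that by blast
  show ?thesis
    using perp_properties[where 'k = 'k, OF h[unfolded t_def] sym pos'] by blast
qed

theorem theorem3p2:
  fixes d :: nat and h :: "nat \<Rightarrow> nat"
  assumes "\<forall>i\<le>d. 0 < h i"
  shows "(\<exists>n (I :: 'k::field_char_0 mpoly set).
            artinian_graded n I \<and> gorenstein n I \<and> strong_lefschetz n I \<and> has_h_vector n I d h)
         \<longleftrightarrow> SI_sequence d h"
  using SI_sequence_if_gorenstein_SLP gorenstein_SLP_if_SI_sequence[OF assms, where 'k = 'k] by blast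

end
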